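(* Let (P-max), (P-min), (R-max), (R-min) be as in the context. Suppose that $\mathcal W^*_{\max}=\mathcal W^*_{\min}$ and that there exist a maximizer $(X^*,z^*,Z^* )$ of (P-max) and a minimizer $(Y^*,w^*,W^* )$ of (P-min) such that $p_{Z^*}:=\psi_m(Z^* )\in\mathrm{IQ}[\Delta^m]$, $p_{W^*}:=\psi_n(W^* )\in\mathrm{IQ}[\Delta^n]$, and both optimization problems $$\min_{x\in\mathbb R^n}\ p_{W^*}(x)\ \ \text{s.t. } x\in\Delta^n,\qquad\qquad \min_{y\in\mathbb R^m}\ p_{Z^*}(y)\ \ \text{s.t. } y\in\Delta^m$$ have only finitely many critical points at which their objective value equals $0$. Then for all sufficiently large $k_1,k_2$, every maximizer $(X,z,Z,\xi)$ of (R-max) of order $(k_1,k_2)$ and every minimizer $(Y,w,W,\nu)$ of (R-min) of order $(k_1,k_2)$ satisfy the flat truncation conditions: there exists $1\le t\le k_1$ with $\operatorname{rank}M_t[\xi]=\operatorname{rank}M_{t-1}[\xi]$, and there exists $1\le s\le k_2$ with $\operatorname{rank}M_s[\nu]=\operatorname{rank}M_{s-1}[\nu]$.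
   Context: Notation. $\mathcal S^n$: real symmetric $n\times n$ matrices with trace inner product. $\Delta^n=\{x\in\mathbb R^n_+: e^{\mathsf T}x=1,\ 1-x^{\mathsf T}x\ge0\}$ ($e$ all-ones; the last inequality is redundant). A critical point of the problem of minimizing a polynomial over $\Delta^n$ means a feasible point satisfying the first-order (Karush-Kuhn-Tucker) conditions with respect to the constraints $e^{\mathsf T}x=1$, $x_i\ge0$, $1-x^{\mathsf T}x\ge0$. $W\in\mathcal S^n$ is copositive, $W\succcurlyeq_{co}0$, if $x^{\mathsf T}Wx\ge0$ on $\Delta^n$. $X\succcurlyeq_{cp}0$ (completely positive) if $X=\sum_i\lambda_ix^{(i)}(x^{(i)})^{\mathsf T}$ (finite, possibly empty, sum) with $\lambda_i>0$, $x^{(i)}\in\Delta^n$. Data. $A_1,\dots,A_I\in\mathcal S^n$, $b\in\mathbb R^I$, $B_1,\dots,B_J\in\mathcal S^m$, $c\in\mathbb R^J$, linear $\mathcal Q:\mathcal S^n\to\mathcal S^m$ with adjoint $\mathcal Q^\star$. Optimal values are sup/inf in the extended reals. (P-max) $\mathcal W^*_{\max}=\max c^{\mathsf T}z$ over $(X,z,Z)\in\mathcal S^n\times\mathbb R^J\times\mathcal S^m$ s.t. $\langle A_i,X\rangle=b_i\ \forall i$, $\mathcal Q(X)-\sum_jz_jB_j=Z$, $X\succcurlyeq_{cp}0$, $Z\succcurlyeq_{co}0$. (P-min) $\mathcal W^*_{\min}=\min b^{\mathsf T}w$ over $(Y,w,W)\in\mathcal S^m\times\mathbb R^I\times\mathcal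 S^n$ s.t. $\langle B_j,Y\rangle=c_j\ \forall j$, $\sum_iw_iA_i-\mathcal Q^\star(Y)=W$, $Y\succcurlyeq_{cp}0$, $W\succcurlyeq_{co}0$. Truncated multi-sequences. $\mathbb N^n_d=\{\alpha\in\mathbb N^n:|\alpha|\le d\}$, $\mathbb N^n_{2,\hom}=\{\alpha:|\alpha|=2\}$, $[x]_d=(x^\alpha)_{\alpha\in\mathbb N^n_d}$. For $\xi\in\mathbb R^{\mathbb N^n_{2k}}$, the Riesz functional $\mathcal L_\xi:\mathbb R[x]_{2k}\to\mathbb R$ is linear with $\mathcal L_\xi(x^\alpha)=\xi_\alpha$ (applied entrywise to vectors/matrices of polynomials), $\xi|_2^{\hom}=(\xi_\alpha)_{|\alpha|=2}$, and for $0\le t\le k$ the moment matrix is $M_t[\xi]=\mathcal L_\xi([x]_t[x]_t^{\mathsf T})$. For $k\ge1$, $\mathscr S[\Delta^n]_{2k}$ is the set of $\xi\in\mathbb R^{\mathbb N^n_{2k}}$ with $M_k[\xi]\succeq0$, $\mathcal L_\xi((1-e^{\mathsf T}x)[x]_{2k-1})=0$, $\mathcal L_\xi((1-x^{\mathsf T}x)[x]_{k-1}[x]_{k-1}^{\mathsf T})\succeq0$, and $\mathcal L_\xi(x_i[x]_{k-1}[x]_{k-1}^{\mathsf T})\succeq0$ for $i=1,\dots,n$. SOS cone. $\Sigma[x]_{2k}$ is the set of sums of squares of polynomials of degree $\le k$. $\mathrm{IQ}[\Delta^n]_{2k}$ is the set of polynomials $(1-e^{\mathsf T}x)q+\sigma_0+\sum_{i=1}^nx_i\sigma_i+(1-x^{\mathsf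 T}x)\sigma_{n+1}$ with $q\in\mathbb R[x]_{2k-1}$, $\sigma_0\in\Sigma[x]_{2k}$, $\sigma_1,\dots,\sigma_{n+1}\in\Sigma[x]_{2k-2}$; $\mathrm{IQ}[\Delta^n]=\bigcup_{k\ge1}\mathrm{IQ}[\Delta^n]_{2k}$. Isomorphisms. $\varphi_n:\mathcal S^n\to\mathbb R^{\mathbb N^n_{2,\hom}}$ is the linear map with $\varphi_n(xx^{\mathsf T})=(x^\alpha)_{|\alpha|=2}$ (i.e. $\varphi_n(X)_{e_i+e_j}=X_{ij}$); $\psi_n(W)=x^{\mathsf T}Wx$. Analogously for $m$. Relaxations of order $(k_1,k_2)$, $k_1,k_2\in\mathbb N_+$: (R-max) $\mathcal W^{(k_1,k_2)}_{\max}=\max c^{\mathsf T}z$ over $(X,z,Z,\xi)$ s.t. $\langle A_i,X\rangle=b_i\ \forall i$, $\mathcal Q(X)-\sum_jz_jB_j=Z$, $\varphi_n(X)=\xi|_2^{\hom}$, $\xi\in\mathscr S[\Delta^n]_{2k_1}$, $\psi_m(Z)\in\mathrm{IQ}[\Delta^m]_{2k_2}$. (R-min) $\mathcal W^{(k_1,k_2)}_{\min}=\min b^{\mathsf T}w$ over $(Y,w,W,\nu)$ s.t. $\langle B_j,Y\rangle=c_j\ \forall j$, $\sum_iw_iA_i-\mathcal Q^\star(Y)=W$, $\varphi_m(Y)=\nu|_2^{\hom}$, $\nu\in\mathscr S[\Delta^m]_{2k_2}$, $\psi_n(W)\in\mathrm{IQ}[\Delta^n]_{2k_1}$. *)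

theory Defs
  imports
    "HOL-Analysis.Analysis"
    "HOL-Library.Poly_Mapping"
    "HOL-Library.Function_Algebras"
begin

section \<open>Symmetric matrices, the standard simplex, and the two matrix cones\<close>

text \<open>
  On symmetric matrices the trace inner product \<open>trace (A ** X)\<close> is the Euclidean inner product
  \<open>A \<bullet> X\<close> of the type \<open>real^'n^'n\<close>; see \<open>inner_eq_trace\<close>.
\<close>

definition sym_mats :: "(real^'n^'n) set" where
  "sym_mats = {X. transpose X = X}"

definition std_simplex :: "(real^'n) set" where
  "std_simplex = {x. (\<forall>i. 0 \<le> x $ i) \<and> (\<Sum>i\<in>UNIV. x $ i) = 1 \<and> 0 \<le> 1 - x \<bullet> x}"

definition copositive :: "real^'n^'n \<Rightarrow> bool" where
  "copositive W \<longleftrightarrow> W \<in> sym_mats \<and> (\<forall>x\<in>std_simplex. 0 \<le> x \<bullet> (W *v x))"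

definition outer :: "real^'n \<Rightarrow> real^'n^'n" where
  "outer x = (\<chi> i j. x $ i * x $ j)"

definition completely_positive :: "real^'n^'n \<Rightarrow> bool" where
  "completely_positive X \<longleftrightarrow>
     (\<exists>(N::nat) l x. (\<forall>i<N. 0 < l i \<and> x i \<in> std_simplex) \<and> X = (\<Sum>i<N. l i *\<^sub>R outer (x i)))"

definition linear_on_sym :: "(real^'n^'n \<Rightarrow> real^'m^'m) \<Rightarrow> bool" where
  "linear_on_sym Q \<longleftrightarrow>
     (\<forall>X\<in>sym_mats. Q X \<in> sym_mats) \<and>
     (\<forall>X\<in>sym_mats. \<forall>Y\<in>sym_mats. Q (X + Y) = Q X + Q Y) \<and>
     (\<forall>r. \<forall>X\<in>sym_mats. Q (r *\<^sub>R X) = r *\<^sub>R Q X)"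

text \<open>
  The adjoint between the spaces of symmetric matrices. The map \<open>Q\<close> need not be linear off
  \<^const>\<open>sym_mats\<close>, so the library constant \<^const>\<open>adjoint\<close> does not apply directly.
  Existence and uniqueness are \<open>sym_adjoint\<close> and \<open>sym_adjoint_unique\<close>.
\<close>

definition sym_adjoint :: "(real^'n^'n \<Rightarrow> real^'m^'m) \<Rightarrow> real^'m^'m \<Rightarrow> real^'n^'n" where
  "sym_adjoint Q Y = (THE V. V \<in> sym_mats \<and> (\<forall>X\<in>sym_mats. Q X \<bullet> Y = X \<bullet> V))"

lemma sym_mats_entry:
  assumes "X \<in> sym_mats"
  shows "X $ i $ j = X $ j $ i"
proof -
  have "X $ i $ j = transpose X $ i $ j"
    using assms by (simp add: sym_mats_def)
  then show ?thesis
    by (simp add: transpose_def)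
qed

lemma inner_eq_trace:
  fixes A X :: "real^'n^'n"
  assumes "A \<in> sym_mats"
  shows "A \<bullet> X = trace (A ** X)"
proof -
  have "A $ i $ j = A $ j $ i" for i j
    using assms by (rule sym_mats_entry)
  then have "trace (A ** X) = (\<Sum>i\<in>UNIV. \<Sum>j\<in>UNIV. A $ j $ i * X $ j $ i)"
    unfolding trace_def matrix_matrix_mult_def by (simp cong: sum.cong)
  also have "\<dots> = A \<bullet> X"
    by (subst sum.swap) (simp add: inner_vec_def)
  finally show ?thesis by simp
qed

lemma inner_transpose_sym:
  fixes V X :: "real^'n^'n"
  assumes "X \<in> sym_mats"
  shows "X \<bullet> transpose V = X \<bullet> V"
proof -
  have "X \<bullet> transpose V = transpose X \<bullet> V"
    unfolding inner_vec_def transpose_def by (simp, subst sum.swap, simp)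
  then show ?thesis using assms by (simp add: sym_mats_def)
qed

lemma sym_adjoint_unique:
  fixes V V' :: "real^'n^'n"
  assumes "V \<in> sym_mats" "V' \<in> sym_mats" "\<forall>X\<in>sym_mats. X \<bullet> V = X \<bullet> V'"
  shows "V = V'"
proof -
  have "transpose (V - V') = V - V'"
    using assms(1,2) by (simp add: sym_mats_def transpose_def vec_eq_iff)
  then have "(V - V') \<bullet> V = (V - V') \<bullet> V'"
    using assms(3) by (simp add: sym_mats_def)
  then have "(V - V') \<bullet> (V - V') = 0"
    by (simp add: inner_diff_right)
  then show ?thesis by simp
qed

lemma sym_adjoint:
  fixes Q :: "real^'n^'n \<Rightarrow> real^'m^'m"
  assumes "linear_on_sym Q"
  shows "sym_adjoint Q Y \<in> sym_mats" and "X \<in> sym_mats \<Longrightarrow> Q X \<bullet> Y = X \<bullet> sym_adjoint Q Y"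
proof -
  define P :: "real^'n^'n \<Rightarrow> real^'n^'n" where "P = (\<lambda>X. (1/2) *\<^sub>R (X + transpose X))"
  have P_sym: "P X \<in> sym_mats" for X
    by (simp add: P_def sym_mats_def transpose_def vec_eq_iff add.commute)
  have P_id: "P X = X" if "X \<in> sym_mats" for X
    using that by (simp add: P_def sym_mats_def flip: scaleR_2)
  have P_add: "P (X + X') = P X + P X'" for X X'
    by (simp add: P_def transpose_def vec_eq_iff algebra_simps)
  have P_scale: "P (r *\<^sub>R X) = r *\<^sub>R P X" for r X
    by (simp add: P_def transpose_def vec_eq_iff algebra_simps)
  have lin: "linear (\<lambda>X. Q (P X))"
  proof (rule linearI)
    show "Q (P (X + X')) = Q (P X) + Q (P X')" for X X'
      using assms P_sym unfolding linear_on_sym_def P_add by blast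
    show "Q (P (r *\<^sub>R X)) = r *\<^sub>R Q (P X)" for r X
      using assms P_sym unfolding linear_on_sym_def P_scale by blast
  qed
  let ?V = "P (adjoint (\<lambda>X. Q (P X)) Y)"
  have V: "Q X \<bullet> Y = X \<bullet> ?V" if "X \<in> sym_mats" for X
  proof -
    have "Q X \<bullet> Y = X \<bullet> adjoint (\<lambda>X. Q (P X)) Y"
      using adjoint_works[OF lin, of X Y] P_id[OF that] by simp
    also have "\<dots> = X \<bullet> ?V"
      using inner_transpose_sym[OF that] by (simp add: P_def inner_add_right)
    finally show ?thesis .
  qed
  have "\<exists>!V. V \<in> sym_mats \<and> (\<forall>X\<in>sym_mats. Q X \<bullet> Y = X \<bullet> V)"
  proof (rule ex1I[of _ ?V])
    show "?V \<in> sym_mats \<and> (\<forall>X\<in>sym_mats. Q X \<bullet> Y = X \<bullet> ?V)"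
      using P_sym V by blast
    fix V' assume V': "V' \<in> sym_mats \<and> (\<forall>X\<in>sym_mats. Q X \<bullet> Y = X \<bullet> V')"
    have "X \<bullet> V' = X \<bullet> ?V" if "X \<in> sym_mats" for X
    proof -
      have "X \<bullet> V' = Q X \<bullet> Y"
        by (rule sym, rule bspec[OF conjunct2[OF V'] that])
      also have "\<dots> = X \<bullet> ?V" by (rule V[OF that])
      finally show ?thesis .
    qed
    then show "V' = ?V"
      by (intro sym_adjoint_unique ballI P_sym V'[THEN conjunct1])
  qed
  from theI'[OF this] show "sym_adjoint Q Y \<in> sym_mats"
    and "X \<in> sym_mats \<Longrightarrow> Q X \<bullet> Y = X \<bullet> sym_adjoint Q Y"
    unfolding sym_adjoint_def by blast+
qed

section \<open>Polynomials\<close>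

text \<open>
  Exponents are vectors \<open>\<alpha> :: nat^'n\<close>, and a polynomial is a finitely supported family of
  coefficients. Addition of exponents makes multiplication of \<open>poly_mapping\<close>s
  the usual product of polynomials.
\<close>

type_synonym 'n mpoly = "(nat, 'n) vec \<Rightarrow>\<^sub>0 real"

definition mdeg :: "nat^'n \<Rightarrow> nat" where
  "mdeg \<alpha> = (\<Sum>i\<in>UNIV. \<alpha> $ i)"

definition exps_le :: "nat \<Rightarrow> (nat^'n) set" where
  "exps_le d = {\<alpha>. mdeg \<alpha> \<le> d}"

definition exps_hom2 :: "(nat^'n) set" where
  "exps_hom2 = {\<alpha>. mdeg \<alpha> = 2}"

definition polys_le :: "nat \<Rightarrow> 'n::finite mpoly set" where
  "polys_le d = {p. Poly_Mapping.keys p \<subseteq> exps_le d}"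

definition monomial :: "nat^'n \<Rightarrow> 'n mpoly" where
  "monomial \<alpha> = Poly_Mapping.single \<alpha> 1"

definition Const :: "real \<Rightarrow> 'n::finite mpoly" where
  "Const r = Poly_Mapping.single 0 r"

definition Var :: "'n::finite \<Rightarrow> 'n mpoly" where
  "Var i = monomial (axis i 1)"

definition peval :: "'n::finite mpoly \<Rightarrow> real^'n \<Rightarrow> real" where
  "peval p x = (\<Sum>\<alpha>\<in>Poly_Mapping.keys p. Poly_Mapping.lookup p \<alpha> * (\<Prod>i\<in>UNIV. x $ i ^ (\<alpha> $ i)))"

definition hyper_poly :: "'n::finite mpoly" where
  "hyper_poly = 1 - (\<Sum>i\<in>UNIV. Var i)"

definition ball_poly :: "'n::finite mpoly" where
  "ball_poly = 1 - (\<Sum>i\<in>UNIV. Var i ^ 2)"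

definition psi :: "real^'n^'n \<Rightarrow> 'n::finite mpoly" where
  "psi W = (\<Sum>i\<in>UNIV. \<Sum>j\<in>UNIV. Const (W $ i $ j) * Var i * Var j)"

text \<open>Sums of squares of polynomials of degree at most \<open>k\<close>, i.e. the cone in degree \<open>2k\<close>.\<close>

definition sos :: "nat \<Rightarrow> 'n::finite mpoly set" where
  "sos k = {sum_list (map (\<lambda>q. q ^ 2) qs) | qs. set qs \<subseteq> polys_le k}"

text \<open>\<open>IQ_trunc k\<close> is the truncation in degree \<open>2k\<close>; it is meant for \<open>k \<ge> 1\<close>.\<close>

definition IQ_trunc :: "nat \<Rightarrow> 'n::finite mpoly set" where
  "IQ_trunc k =
     {hyper_poly * q + s0 + (\<Sum>i\<in>UNIV. Var i * s i) + ball_poly * s1 | q s0 s s1.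
        q \<in> polys_le (2 * k - 1) \<and> s0 \<in> sos k \<and> (\<forall>i. s i \<in> sos (k - 1)) \<and> s1 \<in> sos (k - 1)}"

definition IQ :: "'n::finite mpoly set" where
  "IQ = (\<Union>k\<in>{1..}. IQ_trunc k)"

text \<open>
  Karush-Kuhn-Tucker points of the minimization of \<open>p\<close> over the simplex: the multiplier \<open>\<mu>\<close>
  belongs to \<open>\<Sum>i. x $ i = 1\<close>, \<open>l $ i\<close> to \<open>x $ i \<ge> 0\<close>, and \<open>r\<close> to
  \<open>1 - x \<bullet> x \<ge> 0\<close>; stationarity is the vanishing of the derivative of the Lagrangian.
\<close>

definition simplex_critical :: "'n::finite mpoly \<Rightarrow> real^'n \<Rightarrow> bool" where
  "simplex_critical p x \<longleftrightarrow>
     x \<in> std_simplex \<and>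
     (\<exists>(\<mu>::real) (l::real^'n) (r::real).
        (\<forall>i. 0 \<le> l $ i) \<and> 0 \<le> r \<and>
        (\<forall>i. l $ i * x $ i = 0) \<and> r * (1 - x \<bullet> x) = 0 \<and>
        ((\<lambda>y. peval p y - \<mu> * (1 - (\<Sum>i\<in>UNIV. y $ i)) - (\<Sum>i\<in>UNIV. l $ i * y $ i) - r * (1 - y \<bullet> y))
           has_derivative (\<lambda>_. 0)) (at x))"

section \<open>Truncated multi-sequences and moment matrices\<close>

definition riesz :: "(nat^'n \<Rightarrow> real) \<Rightarrow> 'n::finite mpoly \<Rightarrow> real" where
  "riesz \<xi> p = (\<Sum>\<alpha>\<in>Poly_Mapping.keys p. Poly_Mapping.lookup p \<alpha> * \<xi> \<alpha>)"

text \<open>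
  Matrices whose rows and columns are indexed by a finite set \<open>S\<close> are functions of two arguments,
  of which only the values on \<open>S \<times> S\<close> matter. The rank is the dimension of the space spanned by
  the columns, each extended by \<open>0\<close> outside \<open>S\<close>.
\<close>

definition psd_on :: "'a set \<Rightarrow> ('a \<Rightarrow> 'a \<Rightarrow> real) \<Rightarrow> bool" where
  "psd_on S M \<longleftrightarrow>
     (\<forall>a\<in>S. \<forall>b\<in>S. M a b = M b a) \<and>
     (\<forall>v. 0 \<le> (\<Sum>a\<in>S. \<Sum>b\<in>S. v a * M a b * v b))"

definition rank_on :: "'a set \<Rightarrow> ('a \<Rightarrow> 'a \<Rightarrow> real) \<Rightarrow> nat" where
  "rank_on S M =
     vector_space.dim (\<lambda>(r::real) (f::'a \<Rightarrow> real) a. r * f a) ((\<lambda>b a. if a \<in> S then M a b else 0) ` S)"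

lemma vector_space_fun: "vector_space (\<lambda>(r::real) (f::'a \<Rightarrow> real) a. r * f a)"
  by unfold_locales (simp_all add: fun_eq_iff algebra_simps)

text \<open>
  \<open>loc_matrix \<xi> g\<close> is the matrix obtained by applying the Riesz functional entrywise to
  \<open>g * [x] * [x]\<^sup>T\<close>; its rows and columns are to be restricted to \<open>exps_le t\<close>.
\<close>

definition loc_matrix :: "(nat^'n \<Rightarrow> real) \<Rightarrow> 'n::finite mpoly \<Rightarrow> nat^'n \<Rightarrow> nat^'n \<Rightarrow> real" where
  "loc_matrix \<xi> g = (\<lambda>\<alpha> \<beta>. riesz \<xi> (g * monomial \<alpha> * monomial \<beta>))"

definition moment_psd :: "nat \<Rightarrow> (nat^'n \<Rightarrow> real) \<Rightarrow> bool" where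
  "moment_psd t \<xi> \<longleftrightarrow> psd_on (exps_le t) (loc_matrix \<xi> 1)"

definition moment_rank :: "nat \<Rightarrow> (nat^'n \<Rightarrow> real) \<Rightarrow> nat" where
  "moment_rank t \<xi> = rank_on (exps_le t) (loc_matrix \<xi> 1)"

text \<open>
  Members of \<open>moment_cone k\<close> are families indexed by \<open>exps_le (2 * k)\<close>, represented as
  functions that are \<^const>\<open>undefined\<close> elsewhere. The definition is meant for \<open>k \<ge> 1\<close>.
\<close>

definition moment_cone :: "nat \<Rightarrow> (nat^'n \<Rightarrow> real) set" where
  "moment_cone k =
     {\<xi> \<in> extensional (exps_le (2 * k)).
        moment_psd k \<xi> \<and>
        (\<forall>\<alpha>\<in>exps_le (2 * k - 1). riesz \<xi> (hyper_poly * monomial \<alpha>) = 0) \<and>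
        psd_on (exps_le (k - 1)) (loc_matrix \<xi> ball_poly) \<and>
        (\<forall>i. psd_on (exps_le (k - 1)) (loc_matrix \<xi> (Var i)))}"

text \<open>\<open>phi X\<close> is the family on \<^const>\<open>exps_hom2\<close> with entry \<open>X $ i $ j\<close> at \<open>e\<^sub>i + e\<^sub>j\<close>; see \<open>phi_axis\<close>.\<close>

definition phi :: "real^'n^'n \<Rightarrow> nat^'n \<Rightarrow> real" where
  "phi X = (\<lambda>\<alpha>\<in>exps_hom2. THE r. \<exists>i j. \<alpha> = axis i 1 + axis j 1 \<and> r = X $ i $ j)"

lemma axis_add_axis_eq:
  fixes i j i' j' :: "'n::finite"
  assumes "(axis i 1 + axis j 1 :: nat^'n) = axis i' 1 + axis j' 1"
  shows "i = i' \<and> j = j' \<or> i = j' \<and> j = i'"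
proof -
  have "(axis i 1 + axis j 1 :: nat^'n) $ i \<noteq> 0"
    by (simp add: axis_def)
  then have "(axis i' 1 + axis j' 1 :: nat^'n) $ i \<noteq> 0"
    by (simp only: assms not_False_eq_True)
  then consider "i = i'" | "i = j'"
    by (fastforce simp: axis_def)
  then show ?thesis
  proof cases
    case 1
    then have "(axis j 1 :: nat^'n) = axis j' 1"
      using assms by (metis add_left_cancel)
    then show ?thesis using 1 by (simp add: axis_eq_axis)
  next
    case 2
    then have "(axis j 1 :: nat^'n) = axis i' 1"
      using assms by (metis add.commute add_left_cancel)
    then show ?thesis using 2 by (simp add: axis_eq_axis)
  qed
qed

lemma axis_add_axis_hom2: "(axis i 1 + axis j 1 :: nat^'n) \<in> exps_hom2"
  by (simp add: exps_hom2_def mdeg_def axis_def sum.distrib)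

lemma phi_axis:
  assumes "X \<in> sym_mats"
  shows "phi X (axis i 1 + axis j 1) = X $ i $ j"
proof -
  have sym: "X $ a $ b = X $ b $ a" for a b
    using assms by (rule sym_mats_entry)
  have "(THE r. \<exists>a b. (axis i 1 + axis j 1 :: nat^_) = axis a 1 + axis b 1 \<and> r = X $ a $ b) = X $ i $ j"
  proof (rule the_equality)
    fix r assume "\<exists>a b. (axis i 1 + axis j 1 :: nat^_) = axis a 1 + axis b 1 \<and> r = X $ a $ b"
    then obtain a b where "(axis i 1 + axis j 1 :: nat^_) = axis a 1 + axis b 1" and r: "r = X $ a $ b"
      by blast
    from axis_add_axis_eq[OF this(1)] show "r = X $ i $ j"
      using sym[of i j] r by metis
  qed blast
  then show ?thesis
    using axis_add_axis_hom2[of i j] by (simp add: phi_def)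
qed

section \<open>The primal-dual pair and its relaxations\<close>

definition pmax_feasible ::
  "('i::finite \<Rightarrow> real^'n^'n) \<Rightarrow> real^'i \<Rightarrow> ('j::finite \<Rightarrow> real^'m^'m) \<Rightarrow> (real^'n^'n \<Rightarrow> real^'m^'m)
    \<Rightarrow> (real^'n^'n) \<times> (real^'j) \<times> (real^'m^'m) \<Rightarrow> bool" where
  "pmax_feasible A b B Q = (\<lambda>(X, z, Z).
     X \<in> sym_mats \<and> Z \<in> sym_mats \<and>
     (\<forall>i. A i \<bullet> X = b $ i) \<and>
     Q X - (\<Sum>j\<in>UNIV. z $ j *\<^sub>R B j) = Z \<and>
     completely_positive X \<and> copositive Z)"

definition pmin_feasible ::
  "('i::finite \<Rightarrow> real^'n^'n) \<Rightarrow> ('j::finite \<Rightarrow> real^'m^'m) \<Rightarrow> real^'j \<Rightarrow> (real^'n^'n \<Rightarrow> real^'m^'m)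
    \<Rightarrow> (real^'m^'m) \<times> (real^'i) \<times> (real^'n^'n) \<Rightarrow> bool" where
  "pmin_feasible A B c Q = (\<lambda>(Y, w, W).
     Y \<in> sym_mats \<and> W \<in> sym_mats \<and>
     (\<forall>j. B j \<bullet> Y = c $ j) \<and>
     (\<Sum>i\<in>UNIV. w $ i *\<^sub>R A i) - sym_adjoint Q Y = W \<and>
     completely_positive Y \<and> copositive W)"

definition pmax_value ::
  "('i::finite \<Rightarrow> real^'n^'n) \<Rightarrow> real^'i \<Rightarrow> ('j::finite \<Rightarrow> real^'m^'m) \<Rightarrow> real^'j
    \<Rightarrow> (real^'n^'n \<Rightarrow> real^'m^'m) \<Rightarrow> ereal" where
  "pmax_value A b B c Q = (SUP (X, z, Z) \<in> Collect (pmax_feasible A b B Q). ereal (c \<bullet> z))"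

definition pmin_value ::
  "('i::finite \<Rightarrow> real^'n^'n) \<Rightarrow> real^'i \<Rightarrow> ('j::finite \<Rightarrow> real^'m^'m) \<Rightarrow> real^'j
    \<Rightarrow> (real^'n^'n \<Rightarrow> real^'m^'m) \<Rightarrow> ereal" where
  "pmin_value A b B c Q = (INF (Y, w, W) \<in> Collect (pmin_feasible A B c Q). ereal (b \<bullet> w))"

definition rmax_feasible ::
  "nat \<Rightarrow> nat \<Rightarrow> ('i::finite \<Rightarrow> real^'n^'n) \<Rightarrow> real^'i \<Rightarrow> ('j::finite \<Rightarrow> real^'m^'m)
    \<Rightarrow> (real^'n^'n \<Rightarrow> real^'m^'m)
    \<Rightarrow> (real^'n^'n) \<times> (real^'j) \<times> (real^'m^'m) \<times> (nat^'n \<Rightarrow> real) \<Rightarrow> bool" where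
  "rmax_feasible k1 k2 A b B Q = (\<lambda>(X, z, Z, \<xi>).
     X \<in> sym_mats \<and> Z \<in> sym_mats \<and>
     (\<forall>i. A i \<bullet> X = b $ i) \<and>
     Q X - (\<Sum>j\<in>UNIV. z $ j *\<^sub>R B j) = Z \<and>
     phi X = restrict \<xi> exps_hom2 \<and> \<xi> \<in> moment_cone k1 \<and>
     psi Z \<in> IQ_trunc k2)"

definition rmin_feasible ::
  "nat \<Rightarrow> nat \<Rightarrow> ('i::finite \<Rightarrow> real^'n^'n) \<Rightarrow> ('j::finite \<Rightarrow> real^'m^'m) \<Rightarrow> real^'j
    \<Rightarrow> (real^'n^'n \<Rightarrow> real^'m^'m)
    \<Rightarrow> (real^'m^'m) \<times> (real^'i) \<times> (real^'n^'n) \<times> (nat^'m \<Rightarrow> real) \<Rightarrow> bool" where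
  "rmin_feasible k1 k2 A B c Q = (\<lambda>(Y, w, W, \<nu>).
     Y \<in> sym_mats \<and> W \<in> sym_mats \<and>
     (\<forall>j. B j \<bullet> Y = c $ j) \<and>
     (\<Sum>i\<in>UNIV. w $ i *\<^sub>R A i) - sym_adjoint Q Y = W \<and>
     phi Y = restrict \<nu> exps_hom2 \<and> \<nu> \<in> moment_cone k2 \<and>
     psi W \<in> IQ_trunc k1)"

end

theory Submission
  imports Defs
begin

text \<open>
  By weak duality, an optimal solution of a relaxation of large order satisfies
  \<open>\<langle>W*, X\<rangle> = L\<^sub>\<xi>(p) = 0\<close> for \<open>p = psi W*\<close>, so it remains to show that a
  truncated sequence \<open>\<xi>\<close> annihilating \<open>p\<close> also annihilates \<open>h\<^sup>2\<close> for every
  \<open>h\<close> vanishing on the finite zero set \<open>Z\<close> of \<open>p\<close> in the simplex, once the order is large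
  compared with \<open>h\<close>. Then every monomial reduces, modulo the kernel of the moment matrix, to its
  interpolation polynomial on \<open>Z\<close>, whose degree is bounded, and the rank stabilizes.

  Fix a certificate \<open>p = (1 - e\<^sup>T x) q + \<Sum>a\<^sup>2 + \<Sum>x\<^sub>i b\<^sup>2\<close>. All terms are annihilated, so
  the polynomials \<open>a\<close> and \<open>x\<^sub>i b\<close> lie in the ideal of null polynomials, and so does \<open>p\<close>.
  At a zero \<open>u\<close> of \<open>p\<close>, comparing Taylor expansions of the certificate shows that \<open>x\<^sub>i\<close> is
  locally null at \<open>u\<close> whenever \<open>(W u)\<^sub>i > 0\<close>, and that \<open>W\<close> is a sum of squares of linear forms
  on the remaining tangent directions. By Jensen's inequality the barycenter of the localized
  functional is joined to \<open>u\<close> by a segment of zeros, so it equals \<open>u\<close> because \<open>Z\<close> is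
  finite; hence \<open>x\<^sub>j - u\<^sub>j\<close> is locally null at \<open>u\<close>: there is \<open>e\<^sub>u\<close> with \<open>e\<^sub>u(u) \<noteq> 0\<close>
  such that \<open>e\<^sub>u h\<close> is null for every \<open>h\<close> vanishing on \<open>Z\<close>. Finally
  \<open>P = p + \<Sum>e\<^sub>u\<^sup>2\<close> is positive on the simplex, while \<open>P h\<close> is null, and a Positivstellensatz
  gives \<open>\<epsilon> L(h\<^sup>2) \<le> L(P h\<^sup>2) = 0\<close>.
\<close>

section \<open>Polynomial algebra\<close>

lemma mpoly_induct [case_names zero single add]:
  fixes p :: "'n::finite mpoly"
  assumes "P 0" and "\<And>\<alpha> r. P (Poly_Mapping.single \<alpha> r)" and "\<And>p q. P p \<Longrightarrow> P q \<Longrightarrow> P (p + q)"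
  shows "P p"
proof -
  have expand: "p = (\<Sum>\<alpha>\<in>Poly_Mapping.keys p. Poly_Mapping.single \<alpha> (Poly_Mapping.lookup p \<alpha>))"
    by (rule poly_mapping_eqI)
      (auto simp: lookup_sum lookup_single when_def in_keys_iff)
  have "P (\<Sum>\<alpha>\<in>S. Poly_Mapping.single \<alpha> (Poly_Mapping.lookup p \<alpha>))" if "finite S" for S
    using that by induction (auto simp: assms)
  then show ?thesis
    by (subst expand) simp
qed

section \<open>Linearity of the Riesz functional\<close>

lemma riesz_eq:
  assumes "finite S" "Poly_Mapping.keys p \<subseteq> S"
  shows "riesz \<xi> p = (\<Sum>\<alpha>\<in>S. Poly_Mapping.lookup p \<alpha> * \<xi> \<alpha>)"
  unfolding riesz_def using assms by (intro sum.mono_neutral_left) (auto simp: in_keys_iff)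

lemma riesz_0 [simp]: "riesz \<xi> 0 = 0"
  by (simp add: riesz_def)

lemma riesz_add: "riesz \<xi> (p + q) = riesz \<xi> p + riesz \<xi> q"
proof -
  let ?S = "Poly_Mapping.keys p \<union> Poly_Mapping.keys q"
  have "riesz \<xi> (p + q) = (\<Sum>\<alpha>\<in>?S. Poly_Mapping.lookup (p + q) \<alpha> * \<xi> \<alpha>)"
    by (intro riesz_eq finite_UnI finite_keys keys_add)
  also have "\<dots> = riesz \<xi> p + riesz \<xi> q"
    by (simp add: riesz_eq[of ?S] lookup_add distrib_right sum.distrib)
  finally show ?thesis .
qed

lemma riesz_single [simp]: "riesz \<xi> (Poly_Mapping.single \<alpha> r) = r * \<xi> \<alpha>"
  by (simp add: riesz_def)

lemma riesz_monomial [simp]: "riesz \<xi> (monomial \<alpha>) = \<xi> \<alpha>"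
  by (simp add: monomial_def)

lemma Const_0 [simp]: "Const 0 = 0" and Const_1 [simp]: "Const 1 = 1"
  by (simp_all add: Const_def)

lemma Const_add: "Const (r + s) = Const r + Const s"
  and Const_mult: "Const (r * s) = Const r * Const s"
  and Const_uminus: "Const (- r) = - Const r"
  by (simp_all add: Const_def single_add mult_single single_uminus)

lemma Const_numeral [simp]: "Const (numeral k) = numeral k"
  by (simp add: Const_def)

lemma Const_power: "Const (r ^ k) = Const r ^ k"
  by (induction k) (simp_all add: Const_mult)

lemma Const_sum: "Const (sum f S) = (\<Sum>i\<in>S. Const (f i))"
  by (induction S rule: infinite_finite_induct) (simp_all add: Const_add)

lemma riesz_Const_mult: "riesz \<xi> (Const r * p) = r * riesz \<xi> p"
  by (induction p rule: mpoly_induct)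
    (simp_all add: Const_def mult_single riesz_add distrib_left)

lemma riesz_uminus: "riesz \<xi> (- p) = - riesz \<xi> p"
  using riesz_Const_mult[of \<xi> "-1" p] by (simp add: Const_uminus)

lemma riesz_diff: "riesz \<xi> (p - q) = riesz \<xi> p - riesz \<xi> q"
  using riesz_add[of \<xi> p "- q"] by (simp add: riesz_uminus)

lemma riesz_sum: "riesz \<xi> (sum f S) = (\<Sum>i\<in>S. riesz \<xi> (f i))"
  by (induction S rule: infinite_finite_induct) (simp_all add: riesz_add)

lemma monomial_0 [simp]: "monomial 0 = 1"
  by (simp add: monomial_def)

lemma monomial_add: "monomial (\<alpha> + \<beta>) = monomial \<alpha> * monomial \<beta>"
  by (simp add: monomial_def mult_single)

lemma single_eq_monomial: "Poly_Mapping.single \<alpha> r = Const r * monomial \<alpha>"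
  by (simp add: Const_def monomial_def mult_single)

lemma mpoly_eq_sum:
  assumes "finite S" "Poly_Mapping.keys p \<subseteq> S"
  shows "p = (\<Sum>\<alpha>\<in>S. Const (Poly_Mapping.lookup p \<alpha>) * monomial \<alpha>)"
  by (rule poly_mapping_eqI)
    (use assms in \<open>auto simp: single_eq_monomial[symmetric] lookup_sum lookup_single when_def in_keys_iff\<close>)

section \<open>Total degree and induction over exponents\<close>

lemma mdeg_add: "mdeg (\<alpha> + \<beta>) = mdeg \<alpha> + mdeg \<beta>"
  by (simp add: mdeg_def sum.distrib)

lemma mdeg_axis [simp]: "mdeg (axis i 1) = 1"
  by (simp add: mdeg_def axis_def)

lemma mdeg_eq_0_iff [simp]: "mdeg \<alpha> = 0 \<longleftrightarrow> \<alpha> = 0"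
  by (simp add: mdeg_def vec_eq_iff)

lemma mdeg_SucE:
  fixes \<alpha> :: "nat^'n"
  assumes "mdeg \<alpha> = Suc d"
  obtains \<beta> i where "\<alpha> = \<beta> + axis i 1" "mdeg \<beta> = d"
proof -
  from assms obtain i where i: "\<alpha> $ i \<noteq> 0"
    by (metis mdeg_def nat.distinct(1) sum.neutral)
  define \<beta> :: "nat^'n" where "\<beta> = \<alpha> - axis i 1"
  have eq: "\<alpha> = \<beta> + axis i 1"
    using i by (auto simp: \<beta>_def vec_eq_iff axis_def)
  then have "mdeg \<alpha> = mdeg \<beta> + 1"
    by (simp add: mdeg_add del: One_nat_def)
  with assms eq show thesis
    by (intro that) simp_all
qed

lemma exponent_induct [case_names zero axis]:
  fixes \<alpha> :: "nat^'n"
  assumes "P 0" and step: "\<And>\<alpha> i. P \<alpha> \<Longrightarrow> P (\<alpha> + axis i 1)"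
  shows "P \<alpha>"
proof (induction "mdeg \<alpha>" arbitrary: \<alpha>)
  case 0
  with \<open>P 0\<close> show ?case by simp
next
  case (Suc d)
  obtain \<beta> i where "\<alpha> = \<beta> + axis i 1" "mdeg \<beta> = d"
    using Suc(2) by (metis mdeg_SucE)
  with Suc(1) step show ?case by blast
qed

lemma mpoly_ring_induct [case_names Const Var_mult add]:
  fixes p :: "'n::finite mpoly"
  assumes "\<And>r. P (Const r)" and "\<And>p i. P p \<Longrightarrow> P (Var i * p)"
    and "\<And>p q. P p \<Longrightarrow> P q \<Longrightarrow> P (p + q)"
  shows "P p"
proof (induction p rule: mpoly_induct)
  case zero
  show ?case using assms(1)[of 0] by simp
next
  case (single \<alpha> r)
  have "P (Const r * monomial \<alpha>)"
  proof (induction \<alpha> rule: exponent_induct)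
    case zero
    then show ?case using assms(1) by simp
  next
    case (axis \<alpha> i)
    from assms(2)[OF this, of i] show ?case
      by (simp add: monomial_add Var_def mult_ac)
  qed
  then show ?case by (simp add: single_eq_monomial)
qed (rule assms)

subsection \<open>Evaluation\<close>

lemma peval_eq_riesz: "peval p x = riesz (\<lambda>\<alpha>. \<Prod>i\<in>UNIV. x $ i ^ (\<alpha> $ i)) p"
  by (simp add: peval_def riesz_def)

lemma peval_0 [simp]: "peval 0 x = 0"
  and peval_add [simp]: "peval (p + q) x = peval p x + peval q x"
  and peval_diff [simp]: "peval (p - q) x = peval p x - peval q x"
  and peval_uminus [simp]: "peval (- p) x = - peval p x"
  and peval_sum [simp]: "peval (sum f S) x = (\<Sum>i\<in>S. peval (f i) x)"
  by (simp_all add: peval_eq_riesz riesz_add riesz_diff riesz_uminus riesz_sum)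

lemma peval_monomial: "peval (monomial \<alpha>) x = (\<Prod>i\<in>UNIV. x $ i ^ (\<alpha> $ i))"
  by (simp add: peval_eq_riesz)

lemma peval_Const [simp]: "peval (Const r) x = r"
  by (simp add: peval_eq_riesz Const_def)

lemma peval_1 [simp]: "peval 1 x = 1"
  using peval_Const[of 1 x] by simp

lemma peval_mult [simp]: "peval (p * q) x = peval p x * peval q x"
proof -
  have "peval (Const r * q) x = r * peval q x" for r q
    by (simp add: peval_eq_riesz riesz_Const_mult)
  moreover have "peval (monomial \<alpha> * q) x = peval (monomial \<alpha>) x * peval q x" for \<alpha> q
  proof (induction q rule: mpoly_induct)
    case (single \<beta> r)
    then show ?case
      by (simp add: monomial_def mult_single peval_eq_riesz power_add prod.distrib)
  qed (simp_all add: distrib_left)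
  ultimately show ?thesis
    by (induction p rule: mpoly_induct)
      (simp_all add: single_eq_monomial distrib_right mult.assoc)
qed

lemma peval_power [simp]: "peval (p ^ k) x = peval p x ^ k"
  by (induction k) simp_all

lemma peval_prod [simp]: "peval (prod f S) x = (\<Prod>i\<in>S. peval (f i) x)"
  by (induction S rule: infinite_finite_induct) simp_all

lemma peval_sum_list [simp]: "peval (sum_list ps) x = (\<Sum>p\<leftarrow>ps. peval p x)"
  by (induction ps) simp_all

lemma peval_Var [simp]: "peval (Var i) x = x $ i"
proof -
  have "peval (Var i) x = (\<Prod>j\<in>UNIV. if j = i then x $ i else 1)"
    unfolding Var_def peval_monomial by (intro prod.cong) (auto simp: axis_def)
  then show ?thesis by simp
qed

lemma peval_hyper_poly [simp]: "peval hyper_poly x = 1 - (\<Sum>i\<in>UNIV. x $ i)"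
  by (simp add: hyper_poly_def)

lemma peval_ball_poly [simp]: "peval ball_poly x = 1 - x \<bullet> x"
  by (simp add: ball_poly_def inner_vec_def power2_eq_square)

lemma peval_psi [simp]: "peval (psi W) x = x \<bullet> (W *v x)"
  by (simp add: psi_def inner_vec_def matrix_vector_mult_def sum_distrib_left mult_ac)

lemma continuous_on_peval: "continuous_on S (peval p)"
proof -
  have "continuous_on S (\<lambda>x. peval p x)"
    unfolding peval_def by (intro continuous_intros)
  then show ?thesis by simp
qed

text \<open>Hadamard's lemma with polynomial quotients. It puts every polynomial that vanishes at
  \<open>u\<close> into the ideal of the \<open>Var j - Const (u $ j)\<close>, and the values of the
  \<open>g j\<close> at \<open>u\<close> form the gradient.\<close>

lemma mpoly_taylor1:
  obtains g where "p = Const (peval p u) + (\<Sum>j\<in>UNIV. (Var j - Const (u $ j)) * g j)"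
proof -
  have "\<exists>g. p = Const (peval p u) + (\<Sum>j\<in>UNIV. (Var j - Const (u $ j)) * g j)"
  proof (induction p rule: mpoly_ring_induct)
    case (Const r)
    then show ?case by (intro exI[of _ "\<lambda>_. 0"]) simp
  next
    case (Var_mult p i)
    then obtain g where g: "p = Const (peval p u) + (\<Sum>j\<in>UNIV. (Var j - Const (u $ j)) * g j)"
      by blast
    \<comment> \<open>Since x_i p = x_i (p - p(u)) + (x_i - u_i) p(u) + u_i p(u), only the quotient
      with index \<open>i\<close> needs the correction p(u).\<close>
    let ?h = "\<lambda>j. Var i * g j + (if j = i then Const (peval p u) else 0)"
    have "(\<Sum>j\<in>UNIV. (Var j - Const (u $ j)) * ?h j)
        = Var i * (\<Sum>j\<in>UNIV. (Var j - Const (u $ j)) * g j) + (Var i - Const (u $ i)) * Const (peval p u)"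
      by (simp add: distrib_left sum.distrib sum_distrib_left mult_ac if_distrib[of "times _"] cong: if_cong)
    also have "\<dots> = Var i * (p - Const (peval p u)) + (Var i - Const (u $ i)) * Const (peval p u)"
      using arg_cong[OF g, of "\<lambda>z. z - Const (peval p u)"] by simp
    finally show ?case
      by (intro exI[of _ ?h]) (simp add: algebra_simps Const_mult)
  next
    case (add p q)
    then obtain g h where g: "p = Const (peval p u) + (\<Sum>j\<in>UNIV. (Var j - Const (u $ j)) * g j)"
      and h: "q = Const (peval q u) + (\<Sum>j\<in>UNIV. (Var j - Const (u $ j)) * h j)"
      by blast
    have "p + q = Const (peval (p + q) u) + (\<Sum>j\<in>UNIV. (Var j - Const (u $ j)) * (g j + h j))"
      using arg_cong2[OF g h, of "(+)"] by (simp add: distrib_left sum.distrib Const_add add_ac)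
    then show ?case by (rule exI[of _ "\<lambda>j. g j + h j"])
  qed
  then show thesis using that by blast
qed

subsection \<open>Degree\<close>

lemma finite_exps_le [simp]: "finite (exps_le d :: (nat^'n) set)"
proof (rule finite_surj)
  show "finite (Pi\<^sub>E (UNIV :: 'n set) (\<lambda>_. {..d}))"
    by (intro finite_PiE) auto
  show "exps_le d \<subseteq> (\<lambda>f. \<chi> i. f i) ` Pi\<^sub>E (UNIV :: 'n set) (\<lambda>_. {..d})"
  proof
    fix \<alpha> :: "nat^'n" assume "\<alpha> \<in> exps_le d"
    then have "\<alpha> $ i \<le> d" for i
      using member_le_sum[of i UNIV "($) \<alpha>"] by (simp add: exps_le_def mdeg_def)
    then show "\<alpha> \<in> (\<lambda>f. \<chi> i. f i) ` Pi\<^sub>E UNIV (\<lambda>_. {..d})"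
      by (intro image_eqI[of _ _ "($) \<alpha>"]) auto
  qed
qed

lemma exps_le_mono: "d \<le> d' \<Longrightarrow> exps_le d \<subseteq> exps_le d'"
  by (auto simp: exps_le_def)

lemma polys_le_mono: "p \<in> polys_le d \<Longrightarrow> d \<le> d' \<Longrightarrow> p \<in> polys_le d'"
  using exps_le_mono by (fastforce simp: polys_le_def)

lemma polys_le_0 [simp]: "0 \<in> polys_le d"
  by (simp add: polys_le_def)

lemma polys_le_add: "p \<in> polys_le d \<Longrightarrow> q \<in> polys_le d \<Longrightarrow> p + q \<in> polys_le d"
  using keys_add[of p q] by (auto simp: polys_le_def)

lemma polys_le_mult: "p \<in> polys_le d \<Longrightarrow> q \<in> polys_le e \<Longrightarrow> p * q \<in> polys_le (d + e)"
  using keys_mult[of p q] by (fastforce simp: polys_le_def exps_le_def mdeg_add)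

lemma polys_le_Const [simp]: "Const r \<in> polys_le d"
  by (auto simp: polys_le_def Const_def exps_le_def mdeg_def)

lemma polys_le_1 [simp]: "1 \<in> polys_le d"
  using polys_le_Const[of 1 d] by simp

lemma polys_le_Const_mult: "p \<in> polys_le d \<Longrightarrow> Const r * p \<in> polys_le d"
  using polys_le_mult[of "Const r" 0 p d] by simp

lemma polys_le_uminus: "p \<in> polys_le d \<Longrightarrow> - p \<in> polys_le d"
  using polys_le_Const_mult[of p d "-1"] by (simp add: Const_uminus)

lemma polys_le_diff: "p \<in> polys_le d \<Longrightarrow> q \<in> polys_le d \<Longrightarrow> p - q \<in> polys_le d"
  using polys_le_add[of p d "- q"] polys_le_uminus[of q d] by simp

lemma polys_le_sum: "(\<And>i. i \<in> S \<Longrightarrow> f i \<in> polys_le d) \<Longrightarrow> sum f S \<in> polys_le d"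
  by (induction S rule: infinite_finite_induct) (auto intro: polys_le_add)

lemma polys_le_monomial: "mdeg \<alpha> \<le> d \<Longrightarrow> monomial \<alpha> \<in> polys_le d"
  by (simp add: polys_le_def monomial_def exps_le_def)

lemma polys_le_Var: "Var i \<in> polys_le 1"
  unfolding Var_def by (intro polys_le_monomial) (simp del: One_nat_def)

lemma polys_le_power2: "p \<in> polys_le d \<Longrightarrow> p ^ 2 \<in> polys_le (2 * d)"
  using polys_le_mult[of p d p d] by (simp add: power2_eq_square mult_2)

lemma polys_le_hyper: "hyper_poly \<in> polys_le 1"
  unfolding hyper_poly_def by (intro polys_le_diff polys_le_sum polys_le_Var polys_le_1)

lemma polys_le_ball: "ball_poly \<in> polys_le 2"
proof -
  have "Var i ^ 2 \<in> polys_le 2" for i :: 'a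
    using polys_le_power2[OF polys_le_Var[of i]] by simp
  then show ?thesis
    unfolding ball_poly_def by (intro polys_le_diff polys_le_sum) simp_all
qed

lemma polys_le_exists: "\<exists>d. p \<in> polys_le d"
proof -
  have "Poly_Mapping.keys p \<subseteq> exps_le (\<Sum>\<alpha>\<in>Poly_Mapping.keys p. mdeg \<alpha>)"
    by (auto simp: exps_le_def intro: member_le_sum)
  then show ?thesis unfolding polys_le_def by blast
qed

section \<open>Asymptotic positivity along a family of functionals\<close>

text \<open>Applied with \<open>L (k, \<xi>) = riesz \<xi>\<close> and \<open>k \<rightarrow> \<infinity>\<close> along \<open>F\<close>. Statements that hold
  eventually along \<open>F\<close> need no bookkeeping of the degree up to which a truncated sequence is
  positive; but only finitely many of them can be combined, hence the quantification over \<open>t\<close>.\<close>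

locale moment_family =
  fixes F :: "'w filter" and L :: "'w \<Rightarrow> 'n::finite mpoly \<Rightarrow> real"
  assumes L_add: "L w (f + g) = L w f + L w g"
    and L_Const_mult: "L w (Const r * f) = r * L w f"
    and L_square: "\<forall>\<^sub>F w in F. \<forall>t. 0 \<le> L w ((f + Const t * g) ^ 2)"
    and L_Var_square: "\<forall>\<^sub>F w in F. \<forall>t. 0 \<le> L w (Var i * (f + Const t * g) ^ 2)"
    and L_hyper: "\<forall>\<^sub>F w in F. L w (hyper_poly * f) = 0"
begin

lemma L_0 [simp]: "L w 0 = 0"
  using L_Const_mult[of w 0 0] by simp

lemma L_uminus: "L w (- f) = - L w f"
  using L_Const_mult[of w "-1" f] by (simp add: Const_uminus)

lemma L_diff: "L w (f - g) = L w f - L w g"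
  using L_add[of w f "- g"] by (simp add: L_uminus)

lemma L_sum: "L w (sum f S) = (\<Sum>i\<in>S. L w (f i))"
  by (induction S rule: infinite_finite_induct) (simp_all add: L_add)

lemma L_numeral_mult: "L w (numeral k * f) = numeral k * L w f"
  using L_Const_mult[of w "numeral k" f] by simp

lemma square_nonneg: "\<forall>\<^sub>F w in F. 0 \<le> L w (f ^ 2)"
  by (rule eventually_mono[OF L_square[of f 0]]) simp

lemma Var_square_nonneg: "\<forall>\<^sub>F w in F. 0 \<le> L w (Var i * f ^ 2)"
  by (rule eventually_mono[OF L_Var_square[of i f 0]]) simp

subsection \<open>The ideal of eventually vanishing polynomials\<close>

text \<open>The threshold may depend on \<open>g\<close>: a truncated sequence is controlled only up
  to a bounded degree, so no single threshold can serve all \<open>g\<close>. With this order of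
  quantifiers the null polynomials form an ideal.\<close>

definition null :: "'n mpoly \<Rightarrow> bool" where
  "null f \<longleftrightarrow> (\<forall>g. \<forall>\<^sub>F w in F. L w (f * g) = 0)"

lemma nullD: "null f \<Longrightarrow> \<forall>\<^sub>F w in F. L w (f * g) = 0"
  by (simp add: null_def)

lemma null_0 [simp]: "null 0"
  by (simp add: null_def)

lemma null_hyper: "null hyper_poly"
  using L_hyper by (simp add: null_def)

lemma null_add: "null f \<Longrightarrow> null g \<Longrightarrow> null (f + g)"
  unfolding null_def
proof (intro allI)
  fix h assume "\<forall>h. \<forall>\<^sub>F w in F. L w (f * h) = 0" "\<forall>h. \<forall>\<^sub>F w in F. L w (g * h) = 0"
  then have "\<forall>\<^sub>F w in F. L w (f * h) = 0" "\<forall>\<^sub>F w in F. L w (g * h) = 0"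
    by auto
  then show "\<forall>\<^sub>F w in F. L w ((f + g) * h) = 0"
    by eventually_elim (simp add: distrib_right L_add)
qed

lemma null_mult_right: "null f \<Longrightarrow> null (f * g)"
  by (simp add: null_def mult.assoc)

lemma null_mult_left: "null f \<Longrightarrow> null (g * f)"
  using null_mult_right[of f g] by (simp add: mult.commute)

lemma null_sum: "(\<And>i. i \<in> S \<Longrightarrow> null (f i)) \<Longrightarrow> null (sum f S)"
  by (induction S rule: infinite_finite_induct) (auto intro: null_add)

lemma null_sum_list: "(\<And>f. f \<in> set fs \<Longrightarrow> null f) \<Longrightarrow> null (sum_list fs)"
  by (induction fs) (auto intro: null_add)

text \<open>Near 0 the linear term dominates: at t = - s a, with s small against b, the sum would be
  negative for nonzero a.\<close>

lemma linear_form_vanish: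
  fixes a b :: real
  assumes "\<And>t. 0 \<le> t * a + t ^ 2 * b"
  shows "a = 0"
proof (rule ccontr)
  assume "a \<noteq> 0"
  define s where "s = 1 / (\<bar>b\<bar> + 1)"
  have s: "s > 0" "s * \<bar>b\<bar> < 1"
    by (auto simp: s_def field_simps add_pos_nonneg)
  have "0 \<le> - (s * a ^ 2) + (s * a) ^ 2 * b"
    using assms[of "- s * a"] by (simp add: power2_eq_square mult_ac)
  also have "(s * a) ^ 2 * b \<le> (s * a) ^ 2 * \<bar>b\<bar>"
    by (intro mult_left_mono) auto
  also have "\<dots> = (s * a ^ 2) * (s * \<bar>b\<bar>)"
    by (simp add: power2_eq_square)
  also have "\<dots> < s * a ^ 2"
    using s \<open>a \<noteq> 0\<close> by (simp add: mult_less_cancel_left1)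
  finally show False by simp
qed

text \<open>The degenerate case of Cauchy-Schwarz: expanded in t, the square has a constant term
  that is at most 0, so the linear coefficient must vanish.\<close>

lemma weighted_cauchy_schwarz:
  assumes "\<And>t. 0 \<le> L w (s * (f + Const t * g) ^ 2)" "L w (s * f ^ 2) \<le> 0"
  shows "L w (s * f * g) = 0"
proof -
  have expand: "L w (s * (f + Const t * g) ^ 2)
      = L w (s * f ^ 2) + t * (2 * L w (s * f * g)) + t ^ 2 * L w (s * g ^ 2)" for t
  proof -
    have "s * (f + Const t * g) ^ 2 = s * f ^ 2 + Const t * (2 * (s * f * g)) + Const (t ^ 2) * (s * g ^ 2)"
      by (simp add: Const_mult power2_eq_square algebra_simps)
    then show ?thesis
      by (simp only: L_add L_Const_mult L_numeral_mult)
  qed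
  have "0 \<le> t * (2 * L w (s * f * g)) + t ^ 2 * L w (s * g ^ 2)" for t
    using assms(2) assms(1)[of t] expand[of t] by linarith
  from linear_form_vanish[OF this] show ?thesis by simp
qed

lemma null_of_weighted_square:
  assumes "\<forall>\<^sub>F w in F. L w (s * f ^ 2) \<le> 0"
    and "\<And>g. \<forall>\<^sub>F w in F. \<forall>t. 0 \<le> L w (s * (f + Const t * g) ^ 2)"
  shows "null (s * f)"
  unfolding null_def
proof
  fix g
  show "\<forall>\<^sub>F w in F. L w (s * f * g) = 0"
    using assms(1) assms(2)[of g]
    by eventually_elim (simp add: weighted_cauchy_schwarz)
qed

lemma cauchy_schwarz:
  assumes "\<And>t. 0 \<le> L w ((f + Const t * g) ^ 2)" "L w (f ^ 2) \<le> 0"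
  shows "L w (f * g) = 0"
  using weighted_cauchy_schwarz[of w 1 f g] assms by simp

lemma null_of_square: "\<forall>\<^sub>F w in F. L w (f ^ 2) \<le> 0 \<Longrightarrow> null f"
  using null_of_weighted_square[of 1 f] L_square by simp

lemma null_of_Var_square: "\<forall>\<^sub>F w in F. L w (Var i * f ^ 2) \<le> 0 \<Longrightarrow> null (Var i * f)"
  using null_of_weighted_square[of "Var i" f] L_Var_square by simp

subsection \<open>Bounded multiplication operators\<close>

text \<open>\<open>c\<close> bounds the operator norm of multiplication by \<open>f\<close> in the
  seminorm that takes g to the root of L(g^2); the threshold again depends on
  \<open>g\<close>.\<close>

definition bounded_by :: "'n mpoly \<Rightarrow> real \<Rightarrow> bool" where
  "bounded_by f c \<longleftrightarrow> 0 \<le> c \<and> (\<forall>g. \<forall>\<^sub>F w in F. L w ((f * g) ^ 2) \<le> c ^ 2 * L w (g ^ 2))"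

lemma bounded_byD: "bounded_by f c \<Longrightarrow> \<forall>\<^sub>F w in F. L w ((f * g) ^ 2) \<le> c ^ 2 * L w (g ^ 2)"
  by (simp add: bounded_by_def)

lemma bounded_by_Const: "bounded_by (Const r) \<bar>r\<bar>"
proof -
  have "(Const r * g) ^ 2 = Const (r ^ 2) * g ^ 2" for g :: "'n mpoly"
    by (simp add: power_mult_distrib Const_power)
  then have "L w ((Const r * g) ^ 2) = r ^ 2 * L w (g ^ 2)" for w g
    by (simp only: L_Const_mult)
  then show ?thesis by (simp add: bounded_by_def)
qed

lemma bounded_by_mult:
  assumes "bounded_by f c" "bounded_by g d"
  shows "bounded_by (f * g) (c * d)"
  unfolding bounded_by_def
proof (intro conjI allI)
  show "0 \<le> c * d"
    using assms by (simp add: bounded_by_def)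
  fix h
  show "\<forall>\<^sub>F w in F. L w ((f * g * h) ^ 2) \<le> (c * d) ^ 2 * L w (h ^ 2)"
    using bounded_byD[OF assms(1), of "g * h"] bounded_byD[OF assms(2), of h]
  proof eventually_elim
    case (elim w)
    have "L w ((f * g * h) ^ 2) \<le> c ^ 2 * L w ((g * h) ^ 2)"
      using elim(1) by (simp add: mult.assoc)
    also have "\<dots> \<le> c ^ 2 * (d ^ 2 * L w (h ^ 2))"
      using elim(2) by (intro mult_left_mono) auto
    finally show ?case by (simp add: power_mult_distrib)
  qed
qed

text \<open>Triangle inequality. Positivity on the square of d f h - c g h bounds the cross term by
  c d L(h^2); this divides by c d, hence the strict signs.\<close>

lemma bounded_by_add:
  assumes f: "bounded_by f c" and g: "bounded_by g d" and "0 < c" "0 < d"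
  shows "bounded_by (f + g) (c + d)"
  unfolding bounded_by_def
proof (intro conjI allI)
  show "0 \<le> c + d" using assms by simp
  fix h
  show "\<forall>\<^sub>F w in F. L w (((f + g) * h) ^ 2) \<le> (c + d) ^ 2 * L w (h ^ 2)"
    using bounded_byD[OF f, of h] bounded_byD[OF g, of h]
      square_nonneg[of "Const d * (f * h) - Const c * (g * h)"]
  proof eventually_elim
    case (elim w)
    let ?a = "L w ((f * h) ^ 2)" and ?b = "L w ((g * h) ^ 2)" and ?m = "L w (f * h * (g * h))"
    have eq1: "((f + g) * h) ^ 2 = (f * h) ^ 2 + 2 * (f * h * (g * h)) + (g * h) ^ 2"
      by (simp add: power2_eq_square algebra_simps)
    have "(Const d * (f * h) - Const c * (g * h)) ^ 2
        = Const (d ^ 2) * (f * h) ^ 2 - Const (2 * (c * d)) * (f * h * (g * h)) + Const (c ^ 2) * (g * h) ^ 2"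
      by (simp add: Const_mult power2_eq_square algebra_simps)
    then have "0 \<le> d ^ 2 * ?a - 2 * (c * d) * ?m + c ^ 2 * ?b"
      using elim(3) by (simp only: L_add L_diff L_Const_mult)
    also have "\<dots> \<le> d ^ 2 * (c ^ 2 * L w (h ^ 2)) - 2 * (c * d) * ?m + c ^ 2 * (d ^ 2 * L w (h ^ 2))"
      using mult_left_mono[OF elim(1), of "d ^ 2"] mult_left_mono[OF elim(2), of "c ^ 2"] by (simp add: algebra_simps)
    also have "\<dots> = 2 * (c * d) * (c * d * L w (h ^ 2) - ?m)"
      by (simp add: power2_eq_square algebra_simps)
    finally have m: "?m \<le> c * d * L w (h ^ 2)"
      using mult_pos_pos[OF \<open>0 < c\<close> \<open>0 < d\<close>] by (auto simp: zero_le_mult_iff)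
    have "L w (((f + g) * h) ^ 2) = ?a + 2 * ?m + ?b"
      unfolding eq1 by (simp only: L_add L_numeral_mult)
    also have "\<dots> \<le> c ^ 2 * L w (h ^ 2) + 2 * (c * d * L w (h ^ 2)) + d ^ 2 * L w (h ^ 2)"
      using elim m by linarith
    also have "\<dots> = (c + d) ^ 2 * L w (h ^ 2)"
      by (simp add: power2_eq_square algebra_simps)
    finally show ?case .
  qed
qed

text \<open>Modulo the hyperplane, 1 - x_i is the sum of the other variables.\<close>

lemma one_minus_Var_square_nonneg: "\<forall>\<^sub>F w in F. 0 \<le> L w ((1 - Var i) * f ^ 2)"
proof -
  have "(1 - Var i :: 'n mpoly) = hyper_poly + (\<Sum>j\<in>UNIV - {i}. Var j)"
    using sum.remove[of UNIV i Var] by (simp add: hyper_poly_def algebra_simps)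
  then have eq: "(1 - Var i) * f ^ 2 = hyper_poly * f ^ 2 + (\<Sum>j\<in>UNIV - {i}. Var j * f ^ 2)"
    by (simp add: distrib_right sum_distrib_right)
  have "\<forall>\<^sub>F w in F. \<forall>j\<in>UNIV - {i}. 0 \<le> L w (Var j * f ^ 2)"
    by (intro eventually_ball_finite ballI Var_square_nonneg) simp
  then show ?thesis
    using L_hyper[of "f ^ 2"]
    by eventually_elim (auto simp: eq L_add L_sum intro!: sum_nonneg)
qed

text \<open>The identity 1 - f^2 = (1 - f) + (1 - f) f^2 + f (1 - f)^2 uses \<open>f\<close> and
  \<open>1 - f\<close> only with square weights and avoids their product.\<close>

lemma bounded_by_unit_interval:
  assumes "\<And>g. \<forall>\<^sub>F w in F. 0 \<le> L w (f * g ^ 2)" "\<And>g. \<forall>\<^sub>F w in F. 0 \<le> L w ((1 - f) * g ^ 2)"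
  shows "bounded_by f 1"
  unfolding bounded_by_def
proof (intro conjI allI)
  fix g
  show "\<forall>\<^sub>F w in F. L w ((f * g) ^ 2) \<le> 1 ^ 2 * L w (g ^ 2)"
    using assms(2)[of g] assms(2)[of "f * g"] assms(1)[of "(1 - f) * g"]
  proof eventually_elim
    case (elim w)
    have "g ^ 2 - (f * g) ^ 2 = (1 - f) * g ^ 2 + (1 - f) * (f * g) ^ 2 + f * ((1 - f) * g) ^ 2"
      by (simp add: power2_eq_square algebra_simps)
    then have "L w (g ^ 2) - L w ((f * g) ^ 2) \<ge> 0"
      using elim by (simp only: L_diff[symmetric] L_add)
    then show ?case by simp
  qed
qed simp

lemma bounded_by_Var: "bounded_by (Var i) 1"
  by (intro bounded_by_unit_interval Var_square_nonneg one_minus_Var_square_nonneg)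

lemma bounded_by_one_minus_Var: "bounded_by (1 - Var i) 1"
  by (intro bounded_by_unit_interval one_minus_Var_square_nonneg) (simp add: Var_square_nonneg)

end

subsection \<open>Polynomial square roots\<close>

text \<open>Newton-type iteration for \<open>1 - sqrt (1 - s)\<close>; its increments have nonnegative coefficients,
  so their norms are controlled by their values at \<open>s = 1\<close>, which tend to \<open>0\<close>.\<close>

fun sqrt_iter :: "'a::comm_ring_1 \<Rightarrow> 'a \<Rightarrow> nat \<Rightarrow> 'a" where
  "sqrt_iter h s 0 = h * s"
| "sqrt_iter h s (Suc k) = h * (s + sqrt_iter h s k ^ 2)"

abbreviation sqrt_iter_real :: "nat \<Rightarrow> real" where
  "sqrt_iter_real \<equiv> sqrt_iter (1/2) 1"

text \<open>By the recursion the square of an iterate is twice the next iterate minus s, so the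
  approximate root misses 1 - s by twice the next increment.\<close>

lemma sqrt_iter_square:
  assumes "2 * h = (1::'a::comm_ring_1)"
  shows "(1 - sqrt_iter h s k) ^ 2 = (1 - s) + 2 * (sqrt_iter h s (Suc k) - sqrt_iter h s k)"
proof -
  have "2 * sqrt_iter h s (Suc k) = s + sqrt_iter h s k ^ 2"
    using assms by (simp add: mult.assoc[symmetric])
  then show ?thesis
    by (simp add: power2_eq_square algebra_simps)
qed

text \<open>A difference of squares. Increments thus arise from earlier ones by products and sums,
  operations under which both signs and norm bounds propagate.\<close>

lemma sqrt_iter_Suc_diff:
  "sqrt_iter h s (Suc (Suc k)) - sqrt_iter h s (Suc k)
    = h * ((sqrt_iter h s (Suc k) - sqrt_iter h s k) * (sqrt_iter h s (Suc k) + sqrt_iter h s k))"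
proof -
  have "h * (s + a ^ 2) - h * (s + b ^ 2) = h * ((a - b) * (a + b))" for a b :: 'a
    by (simp add: power2_eq_square algebra_simps)
  from this[of "sqrt_iter h s (Suc k)" "sqrt_iter h s k"] show ?thesis
    by (simp only: sqrt_iter.simps(2)[symmetric])
qed

lemma sqrt_iter_real_pos: "0 < sqrt_iter_real k"
  by (cases k) (auto intro: add_pos_nonneg)

lemma sqrt_iter_real_le: "sqrt_iter_real k \<le> 1"
proof (induction k)
  case (Suc k)
  then have "sqrt_iter_real k ^ 2 \<le> 1"
    using sqrt_iter_real_pos[of k] by (intro power_le_one) auto
  then show ?case by simp
qed simp

lemma sqrt_iter_real_less: "sqrt_iter_real k < sqrt_iter_real (Suc k)"
proof (induction k)
  case (Suc k)
  have "0 < sqrt_iter_real (Suc (Suc k)) - sqrt_iter_real (Suc k)"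
    unfolding sqrt_iter_Suc_diff using Suc sqrt_iter_real_pos
    by (intro mult_pos_pos add_pos_pos) (simp_all del: sqrt_iter.simps)
  then show ?case by simp
qed simp

lemma sqrt_iter_real_diff_tendsto: "(\<lambda>k. sqrt_iter_real (Suc k) - sqrt_iter_real k) \<longlonglongrightarrow> 0"
proof -
  have "incseq sqrt_iter_real"
    using sqrt_iter_real_less by (intro incseq_SucI less_imp_le)
  then obtain l where l: "sqrt_iter_real \<longlonglongrightarrow> l"
    using incseq_convergent[of sqrt_iter_real 1] sqrt_iter_real_le by blast
  from tendsto_diff[OF LIMSEQ_Suc[OF l] l] show ?thesis by simp
qed

context moment_family
begin

lemma bounded_by_sqrt_iter:
  assumes s: "bounded_by s 1"
  shows "bounded_by (sqrt_iter (Const (1/2)) s k) (sqrt_iter_real k)" (is "?A k")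
    and "bounded_by (sqrt_iter (Const (1/2)) s (Suc k) - sqrt_iter (Const (1/2)) s k)
      (sqrt_iter_real (Suc k) - sqrt_iter_real k)"
proof -
  have half: "bounded_by (Const (1/2) * f) (1/2 * c)" if "bounded_by f c" for f c
    using bounded_by_mult[OF bounded_by_Const[of "1/2"] that] by simp
  show A: "?A k" for k
  proof (induction k)
    case 0
    show ?case using half[OF s] by simp
  next
    case (Suc k)
    show ?case
      unfolding sqrt_iter.simps power2_eq_square
      by (intro half bounded_by_add s bounded_by_mult Suc mult_pos_pos sqrt_iter_real_pos) simp
  qed
  show "bounded_by (sqrt_iter (Const (1/2)) s (Suc k) - sqrt_iter (Const (1/2)) s k)
      (sqrt_iter_real (Suc k) - sqrt_iter_real k)"
  proof (induction k)
    case 0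
    \<comment> \<open>The first increment equals h (h s)^2, so no bound on a difference is needed to
      start.\<close>
    show ?case
      using half[OF bounded_by_mult[OF A[of 0] A[of 0]]]
      by (simp add: power2_eq_square algebra_simps)
  next
    case (Suc k)
    show ?case
      unfolding sqrt_iter_Suc_diff
      by (intro half bounded_by_mult Suc bounded_by_add A sqrt_iter_real_pos)
  qed
qed

definition almost_nonneg :: "'n mpoly \<Rightarrow> bool" where
  "almost_nonneg f \<longleftrightarrow> (\<forall>\<delta>>0. \<forall>g. \<forall>\<^sub>F w in F. - \<delta> * L w (g ^ 2) \<le> L w (f * g ^ 2))"

text \<open>Products \<open>x\<^sub>i x\<^sub>j\<close> are in general not in the quadratic module of the simplex; replacing
  \<open>x\<^sub>j\<close> by an approximate square shows that they are nonnegative up to an arbitrarily small error.\<close>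

lemma almost_nonneg_mult_Var:
  assumes f: "almost_nonneg f" and bf: "bounded_by f 1"
  shows "almost_nonneg (f * Var i)"
  unfolding almost_nonneg_def
proof (intro allI impI)
  fix \<delta> :: real and g assume \<delta>: "\<delta> > 0"
  have "\<forall>\<^sub>F k in sequentially. sqrt_iter_real (Suc k) - sqrt_iter_real k < \<delta> / 4"
    using order_tendstoD(2)[OF sqrt_iter_real_diff_tendsto, of "\<delta> / 4"] \<delta> by simp
  then obtain k where k: "sqrt_iter_real (Suc k) - sqrt_iter_real k < \<delta> / 4"
    by (auto simp: eventually_sequentially)
  define r where "r = 1 - sqrt_iter (Const (1/2)) (1 - Var i :: 'n mpoly) k"
  define D where "D = 2 * (sqrt_iter (Const (1/2)) (1 - Var i) (Suc k) - sqrt_iter (Const (1/2)) (1 - Var i :: 'n mpoly) k)"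
  \<comment> \<open>\<open>\<eta>\<close> will bound the norm of the error \<open>D\<close>;
    \<open>k\<close> was chosen to make it less than \<delta> / 2.\<close>
  define \<eta> where "\<eta> = 2 * (sqrt_iter_real (Suc k) - sqrt_iter_real k)"
  have \<eta>: "0 < \<eta>" "\<eta> < \<delta> / 2"
    using k sqrt_iter_real_less[of k] by (simp_all add: \<eta>_def del: sqrt_iter.simps)
  have "2 * Const (1/2) = (1 :: 'n mpoly)"
    using Const_mult[of 2 "1/2"] by simp
  \<comment> \<open>The iteration at s = 1 - x_i approximates the root of 1 - s = x_i.\<close>
  from sqrt_iter_square[OF this, of "1 - Var i" k] have Var_eq: "Var i = r ^ 2 - D"
    by (simp add: r_def D_def)
  have bD: "bounded_by D \<eta>"
    unfolding D_def \<eta>_def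
    using bounded_by_mult[OF bounded_by_Const[of 2] bounded_by_sqrt_iter(2)[OF bounded_by_one_minus_Var]]
    by simp
  have br: "bounded_by r 2"
  proof -
    have "bounded_by (Const (- 1) * sqrt_iter (Const (1/2)) (1 - Var i) k) (\<bar>- 1\<bar> * sqrt_iter_real k)"
      by (intro bounded_by_mult bounded_by_Const bounded_by_sqrt_iter bounded_by_one_minus_Var)
    then have "bounded_by (1 + Const (- 1) * sqrt_iter (Const (1/2)) (1 - Var i) k) (1 + sqrt_iter_real k)"
      using bounded_by_Const[of 1] sqrt_iter_real_pos by (intro bounded_by_add) simp_all
    then have "bounded_by r (1 + sqrt_iter_real k)"
      by (simp add: r_def Const_uminus)
    moreover have "(1 + sqrt_iter_real k) ^ 2 \<le> 2 ^ 2"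
      using sqrt_iter_real_le[of k] sqrt_iter_real_pos[of k] by (intro power_mono) auto
    ultimately show ?thesis
      unfolding bounded_by_def
    proof (intro conjI allI)
      fix h
      assume *: "0 \<le> 1 + sqrt_iter_real k \<and>
        (\<forall>g. \<forall>\<^sub>F w in F. L w ((r * g) ^ 2) \<le> (1 + sqrt_iter_real k) ^ 2 * L w (g ^ 2))"
        and le: "(1 + sqrt_iter_real k) ^ 2 \<le> 2 ^ 2"
      from * have "\<forall>\<^sub>F w in F. L w ((r * h) ^ 2) \<le> (1 + sqrt_iter_real k) ^ 2 * L w (h ^ 2)"
        by blast
      then show "\<forall>\<^sub>F w in F. L w ((r * h) ^ 2) \<le> 2 ^ 2 * L w (h ^ 2)"
        using square_nonneg[of h]
        by eventually_elim (use le mult_right_mono order_trans in blast)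
    qed simp
  qed
  have "\<forall>\<^sub>F w in F. - (\<delta> / 8) * L w ((r * g) ^ 2) \<le> L w (f * (r * g) ^ 2)"
    using f[unfolded almost_nonneg_def, rule_format, of "\<delta> / 8" "r * g"] \<delta> by simp
  then show "\<forall>\<^sub>F w in F. - \<delta> * L w (g ^ 2) \<le> L w (f * Var i * g ^ 2)"
    using bounded_byD[OF br, of g] bounded_byD[OF bounded_by_mult[OF bf bD], of g]
      square_nonneg[of "f * D * g - Const \<eta> * g"] square_nonneg[of g]
  proof eventually_elim
    case (elim w)
    \<comment> \<open>The norm bound on f D becomes a bound on its quadratic form: expand the square
      of (f D - \<eta>) g and use that (f D)^2 is at most \<eta>^2.\<close>
    have "(f * D * g - Const \<eta> * g) ^ 2 = (f * D * g) ^ 2 - Const (2 * \<eta>) * (f * D * g ^ 2) + Const (\<eta> ^ 2) * g ^ 2"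
      by (simp add: Const_mult power2_eq_square algebra_simps)
    then have "0 \<le> L w ((f * D * g) ^ 2) - 2 * \<eta> * L w (f * D * g ^ 2) + \<eta> ^ 2 * L w (g ^ 2)"
      using elim(4) by (simp only: L_add L_diff L_Const_mult)
    also have "\<dots> \<le> 2 * \<eta> * (\<eta> * L w (g ^ 2) - L w (f * D * g ^ 2))"
      using elim(3) by (simp add: power2_eq_square algebra_simps)
    finally have D: "L w (f * D * g ^ 2) \<le> \<eta> * L w (g ^ 2)"
      using \<eta> by (simp add: zero_le_mult_iff)
    have "\<eta> * L w (g ^ 2) \<le> \<delta> / 2 * L w (g ^ 2)"
      using \<eta> elim(5) by (intro mult_right_mono) auto
    \<comment> \<open>The bound 2 on \<open>r\<close>, squared, turns \<delta> / 8 into \<delta> /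
      2; the other half is spent on \<open>D\<close>.\<close>
    moreover have "\<delta> / 8 * L w ((r * g) ^ 2) \<le> \<delta> / 8 * (2 ^ 2 * L w (g ^ 2))"
      using elim(2) \<delta> by (intro mult_left_mono) auto
    moreover have "f * Var i * g ^ 2 = f * (r * g) ^ 2 - f * D * g ^ 2"
      unfolding Var_eq by (simp add: power2_eq_square algebra_simps)
    then have "L w (f * Var i * g ^ 2) = L w (f * (r * g) ^ 2) - L w (f * D * g ^ 2)"
      by (simp only: L_diff)
    ultimately show ?case
      using elim(1) D by (simp add: field_simps)
  qed
qed

lemma almost_nonneg_monomial: "almost_nonneg (monomial \<alpha>)"
proof -
  \<comment> \<open>The norm bound is carried through the induction because
    \<open>almost_nonneg_mult_Var\<close> asks for it.\<close>
  have "almost_nonneg (monomial \<alpha>) \<and> bounded_by (monomial \<alpha>) 1"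
  proof (induction \<alpha> rule: exponent_induct)
    case zero
    have "\<forall>\<^sub>F w in F. - (\<delta> * L w (g ^ 2)) \<le> L w (g ^ 2)" if "0 < \<delta>" for \<delta> g
      using square_nonneg[of g]
    proof eventually_elim
      case (elim w)
      then have "0 \<le> \<delta> * L w (g ^ 2)" using that by simp
      with elim show ?case by linarith
    qed
    then show ?case
      using bounded_by_Const[of 1] by (simp add: almost_nonneg_def)
  next
    case (axis \<alpha> i)
    then show ?case
      using almost_nonneg_mult_Var bounded_by_mult[OF _ bounded_by_Var[of i]]
      by (fastforce simp: monomial_add Var_def)
  qed
  then show ?thesis ..
qed

end

section \<open>Polya's theorem\<close>

lemma compact_std_simplex: "compact std_simplex"
  unfolding compact_eq_bounded_closed
proof
  have "norm x \<le> 1" if "x \<in> std_simplex" for x :: "real^'n"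
    using that by (simp add: std_simplex_def norm_le_square)
  then show "bounded (std_simplex :: (real^'n) set)"
    by (auto simp: bounded_iff)
  show "closed (std_simplex :: (real^'n) set)"
    unfolding std_simplex_def
    by (intro closed_Collect_conj closed_Collect_all closed_Collect_le closed_Collect_eq continuous_intros)
qed

lemma std_simplexI:
  assumes "\<And>i. 0 \<le> x $ i" "(\<Sum>i\<in>UNIV. x $ i) = 1"
  shows "x \<in> std_simplex"
proof -
  have "x $ i \<le> 1" for i
    using member_le_sum[of i UNIV "($) x"] assms by auto
  then have "x \<bullet> x \<le> (\<Sum>i\<in>UNIV. x $ i)"
    unfolding inner_vec_def using assms(1) by (intro sum_mono) (simp add: mult_left_le)
  with assms show ?thesis by (simp add: std_simplex_def)
qed

lemma axis_in_std_simplex: "axis i 1 \<in> std_simplex"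
  by (rule std_simplexI) (auto simp: axis_def)

text \<open>The product of the falling factorials of \<alpha>_i of length \<beta>_i, that is
  \<alpha>! / (\<alpha> - \<beta>)!. Subtracting in the reals makes it 0 as soon as some \<beta>_i
  exceeds \<alpha>_i.\<close>

definition falling :: "nat^'n \<Rightarrow> nat^'n \<Rightarrow> real" where
  "falling \<beta> \<alpha> = (\<Prod>i\<in>UNIV. \<Prod>j<\<beta> $ i. real (\<alpha> $ i) - real j)"

text \<open>For \<open>\<phi> = 1\<close> this is \<open>(\<Sum>i. x\<^sub>i) ^ d / d!\<close> by the multinomial theorem.\<close>

definition homog_exp :: "nat \<Rightarrow> (nat^'n \<Rightarrow> real) \<Rightarrow> 'n::finite mpoly" where
  "homog_exp d \<phi> = (\<Sum>\<alpha> | mdeg \<alpha> = d. Const (\<phi> \<alpha> / (\<Prod>i\<in>UNIV. fact (\<alpha> $ i))) * monomial \<alpha>)"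

lemma finite_mdeg_eq [simp]: "finite {\<alpha> :: nat^'n. mdeg \<alpha> = d}"
  by (rule finite_subset[OF _ finite_exps_le[of d]]) (auto simp: exps_le_def)

lemma homog_exp_cong: "(\<And>\<alpha>. mdeg \<alpha> = d \<Longrightarrow> \<phi> \<alpha> = \<psi> \<alpha>) \<Longrightarrow> homog_exp d \<phi> = homog_exp d \<psi>"
  by (simp add: homog_exp_def)

lemma homog_exp_Const_mult: "Const r * homog_exp d \<phi> = homog_exp d (\<lambda>\<alpha>. r * \<phi> \<alpha>)"
  by (simp add: homog_exp_def sum_distrib_left Const_mult[symmetric] mult.assoc[symmetric])

lemma homog_exp_sum: "(\<Sum>i\<in>S. homog_exp d (\<phi> i)) = homog_exp d (\<lambda>\<alpha>. \<Sum>i\<in>S. \<phi> i \<alpha>)"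
  unfolding homog_exp_def
  by (subst sum.swap) (simp add: sum_divide_distrib Const_sum sum_distrib_right)

text \<open>Shifting the exponent by e_i divides the factorials by \<alpha>_i, which reappears as
  the factor in front. It also removes the exponents with \<alpha>_i = 0, where the subtraction is
  truncated.\<close>

lemma Var_mult_homog_exp:
  fixes i :: "'n::finite"
  shows "Var i * homog_exp d \<phi> = homog_exp (Suc d) (\<lambda>\<alpha>. real (\<alpha> $ i) * \<phi> (\<alpha> - axis i 1))"
proof -
  have "homog_exp (Suc d) (\<lambda>\<alpha>. real (\<alpha> $ i) * \<phi> (\<alpha> - axis i 1))
      = (\<Sum>\<alpha> | mdeg \<alpha> = Suc d \<and> \<alpha> $ i \<noteq> 0.
          Const (real (\<alpha> $ i) * \<phi> (\<alpha> - axis i 1) / (\<Prod>i\<in>UNIV. fact (\<alpha> $ i))) * monomial \<alpha>)"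
    unfolding homog_exp_def by (intro sum.mono_neutral_right) auto
  also have "\<dots> = (\<Sum>\<beta> | mdeg \<beta> = d. Const (\<phi> \<beta> / (\<Prod>i\<in>UNIV. fact (\<beta> $ i))) * monomial (\<beta> + axis i 1))"
  proof (rule sum.reindex_bij_witness[of _ "\<lambda>\<beta>. \<beta> + axis i 1" "\<lambda>\<alpha>. \<alpha> - axis i 1"])
    fix \<alpha> :: "nat^'n"
    assume "\<alpha> \<in> {\<alpha>. mdeg \<alpha> = Suc d \<and> \<alpha> $ i \<noteq> 0}"
    then have \<alpha>: "mdeg \<alpha> = Suc d" "\<alpha> $ i \<noteq> 0" by auto
    define \<beta> where "\<beta> = \<alpha> - axis i 1"
    have eq: "\<alpha> = \<beta> + axis i 1"
      using \<alpha> by (auto simp: \<beta>_def vec_eq_iff axis_def)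
    then show "\<alpha> - axis i 1 + axis i 1 = \<alpha>" by (simp add: \<beta>_def)
    show "\<alpha> - axis i 1 \<in> {\<beta>. mdeg \<beta> = d}"
      using \<alpha>(1) unfolding \<beta>_def[symmetric] by (simp add: eq mdeg_add del: One_nat_def)
    have "(\<Prod>j\<in>UNIV. fact (\<alpha> $ j)) = real (\<alpha> $ i) * (\<Prod>j\<in>UNIV. fact (\<beta> $ j))"
    proof -
      have "(\<Prod>j\<in>UNIV - {i}. fact (\<alpha> $ j)) = (\<Prod>j\<in>UNIV - {i}. fact (\<beta> $ j) :: real)"
        by (intro prod.cong) (auto simp: eq axis_def)
      then show ?thesis
        by (simp add: prod.remove[of UNIV i]) (simp add: eq axis_def)
    qed
    then show "Const (\<phi> (\<alpha> - axis i 1) / (\<Prod>j\<in>UNIV. fact ((\<alpha> - axis i 1) $ j))) * monomial (\<alpha> - axis i 1 + axis i 1)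
        = Const (real (\<alpha> $ i) * \<phi> (\<alpha> - axis i 1) / (\<Prod>i\<in>UNIV. fact (\<alpha> $ i))) * monomial \<alpha>"
      using \<alpha>(2) unfolding \<beta>_def[symmetric] eq[symmetric] by simp
  next
    fix \<beta> :: "nat^'n"
    assume "\<beta> \<in> {\<beta>. mdeg \<beta> = d}"
    then show "\<beta> + axis i 1 \<in> {\<alpha>. mdeg \<alpha> = Suc d \<and> \<alpha> $ i \<noteq> 0}"
      by (simp add: mdeg_add del: One_nat_def)
  qed (simp add: vec_eq_iff)
  also have "\<dots> = Var i * homog_exp d \<phi>"
    by (simp add: homog_exp_def sum_distrib_left monomial_add Var_def mult_ac)
  finally show ?thesis ..
qed

text \<open>The factor with j = 0 is split off and the others are shifted; for \<alpha>_i = 0 both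
  sides are 0, so truncation does no harm.\<close>

lemma falling_add_axis: "falling (\<beta> + axis i 1) \<alpha> = real (\<alpha> $ i) * falling \<beta> (\<alpha> - axis i 1)"
proof -
  have 1: "(\<Prod>j<Suc k. real a - real j) = real a * (\<Prod>j<k. real (a - 1) - real j)" for a k
  proof (cases "a = 0")
    case False
    then have "(\<Prod>j<k. real a - real (Suc j)) = (\<Prod>j<k. real (a - 1) - real j)"
      by (intro prod.cong) auto
    then show ?thesis by (subst prod.lessThan_Suc_shift) simp
  qed (auto simp: prod.lessThan_Suc_shift)
  have "(\<Prod>k\<in>UNIV - {i}. \<Prod>j<(\<beta> + axis i 1) $ k. real (\<alpha> $ k) - real j)
      = (\<Prod>k\<in>UNIV - {i}. \<Prod>j<\<beta> $ k. real ((\<alpha> - axis i 1) $ k) - real j)"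
    by (intro prod.cong) (auto simp: axis_def)
  then show ?thesis
    unfolding falling_def by (simp add: prod.remove[of UNIV i] axis_def 1 del: prod.lessThan_Suc)
qed

text \<open>For \<beta> = 0 this is the multinomial theorem. Multiplication by a variable acts on
  the coefficient functions exactly as the recursion of \<open>falling\<close>.\<close>

lemma monomial_mult_power_sum_Var:
  fixes \<beta> :: "nat^'n"
  shows "monomial \<beta> * (\<Sum>i\<in>UNIV. Var i) ^ k = Const (fact k) * homog_exp (mdeg \<beta> + k) (falling \<beta>)"
proof (induction \<beta> rule: exponent_induct)
  case zero
  have "(\<Sum>i\<in>UNIV. Var (i :: 'n)) ^ k = Const (fact k) * homog_exp k (\<lambda>_. 1)"
  proof (induction k)
    case 0
    have "{\<alpha> :: nat^'n. mdeg \<alpha> = 0} = {0}"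
      by auto
    then show ?case by (simp add: homog_exp_def)
  next
    case (Suc k)
    have "(\<Sum>i\<in>UNIV. Var (i :: 'n)) * homog_exp k (\<lambda>_. 1) = (\<Sum>i\<in>UNIV. homog_exp (Suc k) (\<lambda>\<alpha>. real (\<alpha> $ i)))"
      by (simp add: sum_distrib_right Var_mult_homog_exp)
    also have "\<dots> = homog_exp (Suc k) (\<lambda>_. real (Suc k) * 1)"
      unfolding homog_exp_sum by (rule homog_exp_cong) (simp add: mdeg_def flip: of_nat_sum)
    also have "\<dots> = Const (real (Suc k)) * homog_exp (Suc k) (\<lambda>_. 1)"
      by (rule homog_exp_Const_mult[symmetric])
    finally show ?case
      using Suc by (simp add: Const_mult mult_ac del: of_nat_Suc)
  qed
  then show ?case by (simp add: falling_def mdeg_def)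
next
  case (axis \<beta> i)
  have "monomial (\<beta> + axis i 1) * (\<Sum>i\<in>UNIV. Var i) ^ k = Var i * (monomial \<beta> * (\<Sum>i\<in>UNIV. Var i) ^ k)"
    by (simp add: monomial_add Var_def mult_ac)
  also have "\<dots> = Const (fact k) * (Var i * homog_exp (mdeg \<beta> + k) (falling \<beta>))"
    unfolding axis by (simp add: mult_ac)
  also have "Var i * homog_exp (mdeg \<beta> + k) (falling \<beta>) = homog_exp (mdeg (\<beta> + axis i 1) + k) (falling (\<beta> + axis i 1))"
    unfolding Var_mult_homog_exp mdeg_add mdeg_axis
    by (simp add: homog_exp_def falling_add_axis del: One_nat_def) simp
  finally show ?case .
qed

text \<open>1 - s^k is divisible by 1 - s. Hence homogenizing by powers of the sum of the variables
  costs nothing modulo the hyperplane.\<close>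

lemma one_eq_power_mod_hyper: "\<exists>q. (1 :: 'n::finite mpoly) = (\<Sum>i\<in>UNIV. Var i) ^ k + hyper_poly * q"
proof (induction k)
  case 0
  show ?case by (intro exI[of _ 0]) simp
next
  case (Suc k)
  then obtain q where q: "(1 :: 'n mpoly) = (\<Sum>i\<in>UNIV. Var i) ^ k + hyper_poly * q" ..
  have "(\<Sum>i\<in>UNIV. Var i) ^ Suc k + hyper_poly * (q + (\<Sum>i\<in>UNIV. Var i) ^ k)
      = ((\<Sum>i\<in>UNIV. Var i) + hyper_poly) * (\<Sum>i\<in>UNIV. Var i) ^ k + hyper_poly * (q :: 'n mpoly)"
    by (simp add: algebra_simps)
  also have "\<dots> = 1"
    using q by (simp add: hyper_poly_def)
  finally show ?case by metis
qed

text \<open>Each monomial of degree b is raised to degree d by the factor (x_1 + ... + x_n)^(d - b),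
  which is 1 modulo the hyperplane.\<close>

lemma homog_exp_expansion:
  fixes p :: "'n::finite mpoly"
  assumes p: "p \<in> polys_le e" and "e \<le> d"
  shows "\<exists>q. p = homog_exp d (\<lambda>\<alpha>. \<Sum>\<beta>\<in>exps_le e. Poly_Mapping.lookup p \<beta> * (fact (d - mdeg \<beta>) * falling \<beta> \<alpha>)) + hyper_poly * q"
proof -
  have ex: "\<exists>q. monomial \<beta> = homog_exp d (\<lambda>\<alpha>. fact (d - mdeg \<beta>) * falling \<beta> \<alpha>) + hyper_poly * q"
    if "\<beta> \<in> exps_le e" for \<beta> :: "nat^'n"
  proof -
    from that \<open>e \<le> d\<close> have d: "mdeg \<beta> + (d - mdeg \<beta>) = d"
      by (simp add: exps_le_def)
    obtain q where q: "(1 :: 'n mpoly) = (\<Sum>i\<in>UNIV. Var i) ^ (d - mdeg \<beta>) + hyper_poly * q"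
      using one_eq_power_mod_hyper by blast
    have "monomial \<beta> = monomial \<beta> * (\<Sum>i\<in>UNIV. Var i) ^ (d - mdeg \<beta>) + hyper_poly * (q * monomial \<beta>)"
      using arg_cong[OF q, of "\<lambda>f. monomial \<beta> * f"] by (simp add: distrib_left mult_ac)
    then show ?thesis
      unfolding monomial_mult_power_sum_Var d homog_exp_Const_mult by blast
  qed
  have "\<exists>q. \<forall>\<beta>\<in>exps_le e.
      (monomial \<beta> :: 'n mpoly) = homog_exp d (\<lambda>\<alpha>. fact (d - mdeg \<beta>) * falling \<beta> \<alpha>) + hyper_poly * q \<beta>"
    by (intro bchoice ballI ex)
  then obtain q where q: "\<And>\<beta>. \<beta> \<in> exps_le e \<Longrightarrow>
      (monomial \<beta> :: 'n mpoly) = homog_exp d (\<lambda>\<alpha>. fact (d - mdeg \<beta>) * falling \<beta> \<alpha>) + hyper_poly * q \<beta>"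
    by blast
  have "p = (\<Sum>\<beta>\<in>exps_le e. Const (Poly_Mapping.lookup p \<beta>) * monomial \<beta>)"
    using p by (intro mpoly_eq_sum) (auto simp: polys_le_def)
  also have "\<dots> = (\<Sum>\<beta>\<in>exps_le e. Const (Poly_Mapping.lookup p \<beta>) *
      (homog_exp d (\<lambda>\<alpha>. fact (d - mdeg \<beta>) * falling \<beta> \<alpha>) + hyper_poly * q \<beta>))"
    using q by (intro sum.cong) auto
  also have "\<dots> = homog_exp d (\<lambda>\<alpha>. \<Sum>\<beta>\<in>exps_le e. Poly_Mapping.lookup p \<beta> * (fact (d - mdeg \<beta>) * falling \<beta> \<alpha>))
      + hyper_poly * (\<Sum>\<beta>\<in>exps_le e. Const (Poly_Mapping.lookup p \<beta>) * q \<beta>)"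
    by (simp add: distrib_left sum.distrib homog_exp_Const_mult homog_exp_sum sum_distrib_left mult_ac)
  finally show ?thesis by blast
qed

section \<open>Asymptotics of the coefficients after homogenization\<close>

lemma tendsto_fact_ratio: "(\<lambda>d. real d ^ b * fact (d - b) / fact d) \<longlonglongrightarrow> 1"
proof (induction b)
  case 0
  then show ?case by simp
next
  case (Suc b)
  have "(\<lambda>d. real d / (real d - real b)) \<longlonglongrightarrow> 1"
  proof (rule Lim_transform_eventually)
    have "(\<lambda>d. 1 / (1 - real b / real d)) \<longlonglongrightarrow> 1 / (1 - 0)"
      by (intro tendsto_divide tendsto_diff tendsto_const lim_const_over_n) simp
    then show "(\<lambda>d. 1 / (1 - real b / real d)) \<longlonglongrightarrow> 1" by simp
    show "\<forall>\<^sub>F d in sequentially. 1 / (1 - real b / real d) = real d / (real d - real b)"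
      using eventually_gt_at_top[of b] by eventually_elim (simp add: field_simps)
  qed
  from tendsto_mult[OF Suc this]
  have "(\<lambda>d. real d ^ b * fact (d - b) / fact d * (real d / (real d - real b))) \<longlonglongrightarrow> 1"
    by simp
  moreover have "\<forall>\<^sub>F d in sequentially. real d ^ b * fact (d - b) / fact d * (real d / (real d - real b))
      = real d ^ Suc b * fact (d - Suc b) / fact d"
    using eventually_gt_at_top[of b]
  proof eventually_elim
    case (elim d)
    then have "d - b = Suc (d - Suc b)" by simp
    then have "fact (d - b) = (real d - real b) * fact (d - Suc b)"
      using elim by (simp add: of_nat_diff)
    then show ?case using elim by simp
  qed
  ultimately show ?case by (rule Lim_transform_eventually)
qed

text \<open>Divided by d!, the coefficient function that x^\<beta> acquires in degree d approximates
  the value of x^\<beta> at the normalized exponent \<alpha> / d.\<close>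

lemma tendsto_falling:
  fixes \<alpha> :: "nat \<Rightarrow> nat^'n" and \<beta> :: "nat^'n"
  assumes d: "filterlim d at_top sequentially"
    and y: "(\<lambda>k. (\<chi> i. real (\<alpha> k $ i) / real (d k))) \<longlonglongrightarrow> y"
  shows "(\<lambda>k. fact (d k - mdeg \<beta>) * falling \<beta> (\<alpha> k) / fact (d k)) \<longlonglongrightarrow> peval (monomial \<beta>) y"
proof -
  have dr: "filterlim (\<lambda>k. real (d k)) at_top sequentially"
    using filterlim_compose[OF filterlim_real_sequentially d] .
  have inv: "(\<lambda>k. c / real (d k)) \<longlonglongrightarrow> 0" for c
    by (intro tendsto_divide_0[OF tendsto_const] filterlim_at_top_imp_at_infinity dr)
  have "(\<lambda>k. (real (\<alpha> k $ i) - real j) / real (d k)) \<longlonglongrightarrow> y $ i" for i j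
    using tendsto_diff[OF tendsto_vec_nth[OF y, of i] inv[of "real j"]] by (simp add: diff_divide_distrib)
  then have "(\<lambda>k. \<Prod>i\<in>UNIV. \<Prod>j<\<beta> $ i. (real (\<alpha> k $ i) - real j) / real (d k)) \<longlonglongrightarrow> (\<Prod>i\<in>UNIV. \<Prod>j<\<beta> $ i. y $ i)"
    by (intro tendsto_prod)
  moreover have "(\<Prod>i\<in>UNIV. \<Prod>j<\<beta> $ i. (real (\<alpha> k $ i) - real j) / real (d k))
      = falling \<beta> (\<alpha> k) / real (d k) ^ mdeg \<beta>" for k
    by (simp add: falling_def prod_dividef mdeg_def power_sum)
  moreover have "(\<Prod>i\<in>UNIV. \<Prod>j<\<beta> $ i. y $ i) = peval (monomial \<beta>) y"
    by (simp add: peval_monomial)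
  ultimately have "(\<lambda>k. falling \<beta> (\<alpha> k) / real (d k) ^ mdeg \<beta>) \<longlonglongrightarrow> peval (monomial \<beta>) y"
    by simp
  from tendsto_mult[OF filterlim_compose[OF tendsto_fact_ratio[of "mdeg \<beta>"] d] this]
  have "(\<lambda>k. real (d k) ^ mdeg \<beta> * fact (d k - mdeg \<beta>) / fact (d k) * (falling \<beta> (\<alpha> k) / real (d k) ^ mdeg \<beta>))
      \<longlonglongrightarrow> peval (monomial \<beta>) y"
    by (simp only: mult_1)
  moreover have "\<forall>\<^sub>F k in sequentially. real (d k) ^ mdeg \<beta> * fact (d k - mdeg \<beta>) / fact (d k) * (falling \<beta> (\<alpha> k) / real (d k) ^ mdeg \<beta>)
      = fact (d k - mdeg \<beta>) * falling \<beta> (\<alpha> k) / fact (d k)"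
    using filterlim_at_top_dense[THEN iffD1, OF dr, rule_format, of 0]
    by eventually_elim simp
  ultimately show ?thesis by (rule Lim_transform_eventually)
qed

text \<open>Compactness: negative coefficients in all large degrees would give normalized exponents
  accumulating at some y of the simplex, and the rescaled coefficients would converge to p(y) >
  0.\<close>

lemma polya_coefficients_nonneg:
  fixes p :: "'n::finite mpoly"
  assumes p: "p \<in> polys_le e" and pos: "\<And>x. x \<in> std_simplex \<Longrightarrow> 0 < peval p x"
  shows "\<exists>d\<ge>e. \<forall>\<alpha>. mdeg \<alpha> = d \<longrightarrow>
    0 \<le> (\<Sum>\<beta>\<in>exps_le e. Poly_Mapping.lookup p \<beta> * (fact (d - mdeg \<beta>) * falling \<beta> \<alpha>))"
proof (rule ccontr)
  assume "\<not> ?thesis"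
  then have "\<exists>\<alpha>. mdeg \<alpha> = d \<and>
      \<not> 0 \<le> (\<Sum>\<beta>\<in>exps_le e. Poly_Mapping.lookup p \<beta> * (fact (d - mdeg \<beta>) * falling \<beta> \<alpha>))"
    if "e \<le> d" for d
    using that by blast
  \<comment> \<open>These degrees are at least \<open>e\<close> and never 0, so exponents can be
    divided by them.\<close>
  from this[of "Suc (e + k)" for k]
  have "\<exists>\<alpha> :: nat^'n. mdeg \<alpha> = Suc (e + k) \<and>
      (\<Sum>\<beta>\<in>exps_le e. Poly_Mapping.lookup p \<beta> * (fact (Suc (e + k) - mdeg \<beta>) * falling \<beta> \<alpha>)) < 0" for k
    by (simp add: not_le)
  then obtain \<alpha> :: "nat \<Rightarrow> nat^'n" where deg: "\<And>k. mdeg (\<alpha> k) = Suc (e + k)"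
    and neg: "\<And>k. (\<Sum>\<beta>\<in>exps_le e. Poly_Mapping.lookup p \<beta> * (fact (Suc (e + k) - mdeg \<beta>) * falling \<beta> (\<alpha> k))) < 0"
    by metis
  define x :: "nat \<Rightarrow> real^'n" where "x k = (\<chi> i. real (\<alpha> k $ i) / real (Suc (e + k)))" for k
  have "x k \<in> std_simplex" for k
  proof (rule std_simplexI)
    have "(\<Sum>i\<in>UNIV. x k $ i) = real (mdeg (\<alpha> k)) / real (Suc (e + k))"
      by (simp add: x_def mdeg_def sum_divide_distrib)
    then show "(\<Sum>i\<in>UNIV. x k $ i) = 1" by (simp add: deg)
  qed (simp add: x_def)
  then obtain y r where y: "y \<in> std_simplex" and r: "strict_mono r" and lim: "(x \<circ> r) \<longlonglongrightarrow> y"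
    using compact_std_simplex unfolding compact_def by blast
  define d where "d k = Suc (e + r k)" for k
  have "filterlim d at_top sequentially"
    unfolding d_def
    by (rule filterlim_at_top_mono[OF filterlim_subseq[OF r]]) simp
  moreover have "(\<lambda>k. \<chi> i. real (\<alpha> (r k) $ i) / real (d k)) \<longlonglongrightarrow> y"
    using lim by (simp add: x_def d_def o_def)
  ultimately have "(\<lambda>k. \<Sum>\<beta>\<in>exps_le e. Poly_Mapping.lookup p \<beta> * (fact (d k - mdeg \<beta>) * falling \<beta> (\<alpha> (r k)) / fact (d k)))
      \<longlonglongrightarrow> (\<Sum>\<beta>\<in>exps_le e. Poly_Mapping.lookup p \<beta> * peval (monomial \<beta>) y)"
    by (intro tendsto_sum tendsto_mult tendsto_const tendsto_falling)
  moreover have "peval p y = (\<Sum>\<beta>\<in>exps_le e. Poly_Mapping.lookup p \<beta> * peval (monomial \<beta>) y)"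
    using p by (subst mpoly_eq_sum[of "exps_le e" p]) (auto simp: polys_le_def)
  ultimately have "\<forall>\<^sub>F k in sequentially.
      0 < (\<Sum>\<beta>\<in>exps_le e. Poly_Mapping.lookup p \<beta> * (fact (d k - mdeg \<beta>) * falling \<beta> (\<alpha> (r k)) / fact (d k)))"
    using pos[OF y] by (intro order_tendstoD(1)) simp_all
  then obtain k where
    "0 < (\<Sum>\<beta>\<in>exps_le e. Poly_Mapping.lookup p \<beta> * (fact (d k - mdeg \<beta>) * falling \<beta> (\<alpha> (r k)) / fact (d k)))"
    by (auto simp: eventually_sequentially)
  also have "\<dots> = (\<Sum>\<beta>\<in>exps_le e. Poly_Mapping.lookup p \<beta> * (fact (d k - mdeg \<beta>) * falling \<beta> (\<alpha> (r k)))) / fact (d k)"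
    by (simp add: sum_divide_distrib)
  finally show False
    using neg[of "r k"] by (simp add: d_def zero_less_divide_iff del: fact_Suc)
qed

text \<open>Working modulo \<open>hyper_poly\<close> gives an inhomogeneous form of the theorem, in
  which the power of the sum of the variables has been replaced by 1.\<close>

theorem polya:
  fixes p :: "'n::finite mpoly"
  assumes pos: "\<And>x. x \<in> std_simplex \<Longrightarrow> 0 < peval p x"
  obtains S c q where "finite S" "\<And>\<alpha>. \<alpha> \<in> S \<Longrightarrow> 0 \<le> c \<alpha>"
    "p = (\<Sum>\<alpha>\<in>S. Const (c \<alpha>) * monomial \<alpha>) + hyper_poly * q"
proof -
  obtain e where e: "p \<in> polys_le e"
    using polys_le_exists by blast
  obtain d where "e \<le> d" and nonneg: "\<And>\<alpha>. mdeg \<alpha> = d \<Longrightarrow>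
      0 \<le> (\<Sum>\<beta>\<in>exps_le e. Poly_Mapping.lookup p \<beta> * (fact (d - mdeg \<beta>) * falling \<beta> \<alpha>))"
    using polya_coefficients_nonneg[OF e pos] by blast
  obtain q where q: "p = homog_exp d (\<lambda>\<alpha>. \<Sum>\<beta>\<in>exps_le e. Poly_Mapping.lookup p \<beta> * (fact (d - mdeg \<beta>) * falling \<beta> \<alpha>)) + hyper_poly * q"
    using homog_exp_expansion[OF e \<open>e \<le> d\<close>] by blast
  show thesis
    by (rule that[OF finite_mdeg_eq _ q[unfolded homog_exp_def]]) (simp add: nonneg prod_nonneg)
qed

context moment_family
begin

text \<open>After subtracting part of the minimum, Polya's theorem leaves a nonnegative combination
  of monomials; each is almost nonnegative, and the subtracted part absorbs the finitely many
  errors.\<close>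

theorem positivstellensatz:
  assumes pos: "\<And>x. x \<in> std_simplex \<Longrightarrow> 0 < peval p x"
  shows "\<exists>\<epsilon>>0. \<forall>f. \<forall>\<^sub>F w in F. \<epsilon> * L w (f ^ 2) \<le> L w (p * f ^ 2)"
proof -
  obtain y where y: "y \<in> std_simplex" and min: "\<And>x. x \<in> std_simplex \<Longrightarrow> peval p y \<le> peval p x"
    using continuous_attains_inf[OF compact_std_simplex _ continuous_on_peval, of p] axis_in_std_simplex
    by blast
  \<comment> \<open>With a third of the minimum, p - 2 \<epsilon> stays positive; one \<epsilon>
    pays for the errors and one remains as the bound.\<close>
  define \<epsilon> where "\<epsilon> = peval p y / 3"
  have \<epsilon>: "\<epsilon> > 0"
    using pos[OF y] by (simp add: \<epsilon>_def)
  have "0 < peval (p - Const (2 * \<epsilon>)) x" if "x \<in> std_simplex" for x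
    using min[OF that] \<epsilon> by (simp add: \<epsilon>_def)
  from polya[OF this] obtain S c q where S: "finite S" "\<And>\<alpha>. \<alpha> \<in> S \<Longrightarrow> 0 \<le> c \<alpha>"
    and p: "p - Const (2 * \<epsilon>) = (\<Sum>\<alpha>\<in>S. Const (c \<alpha>) * monomial \<alpha>) + hyper_poly * q"
    by blast
  \<comment> \<open>With tolerance \<epsilon> / C per monomial the total error is (C - 1) / C times
    \<epsilon> L(f^2); the summand 1 makes C positive even when all coefficients are 0.\<close>
  define C where "C = (\<Sum>\<alpha>\<in>S. c \<alpha>) + 1"
  have C: "C > 0"
    using S sum_nonneg[of S c] by (simp add: C_def add_nonneg_pos)
  have "\<forall>\<^sub>F w in F. \<epsilon> * L w (f ^ 2) \<le> L w (p * f ^ 2)" for f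
  proof -
    have "\<forall>\<alpha>\<in>S. \<forall>\<^sub>F w in F. - (\<epsilon> / C) * L w (f ^ 2) \<le> L w (monomial \<alpha> * f ^ 2)"
      using almost_nonneg_monomial \<epsilon> C unfolding almost_nonneg_def by (metis divide_pos_pos)
    then have "\<forall>\<^sub>F w in F. \<forall>\<alpha>\<in>S. - (\<epsilon> / C) * L w (f ^ 2) \<le> L w (monomial \<alpha> * f ^ 2)"
      using S(1) by (simp add: eventually_ball_finite)
    then show ?thesis
      using L_hyper[of "q * f ^ 2"] square_nonneg[of f]
    proof eventually_elim
      case (elim w)
      have "p * f ^ 2 = (p - Const (2 * \<epsilon>)) * f ^ 2 + Const (2 * \<epsilon>) * f ^ 2"
        by (simp add: algebra_simps)
      also have "\<dots> = (\<Sum>\<alpha>\<in>S. Const (c \<alpha>) * (monomial \<alpha> * f ^ 2)) + hyper_poly * (q * f ^ 2) + Const (2 * \<epsilon>) * f ^ 2"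
        by (simp only: p distrib_right sum_distrib_right mult.assoc)
      finally have "L w (p * f ^ 2) = (\<Sum>\<alpha>\<in>S. c \<alpha> * L w (monomial \<alpha> * f ^ 2)) + 2 * \<epsilon> * L w (f ^ 2)"
        using elim(2) by (simp only: L_add L_sum L_Const_mult)
      moreover have "(\<Sum>\<alpha>\<in>S. c \<alpha> * (- (\<epsilon> / C) * L w (f ^ 2))) \<le> (\<Sum>\<alpha>\<in>S. c \<alpha> * L w (monomial \<alpha> * f ^ 2))"
        using elim(1) S by (intro sum_mono mult_left_mono) auto
      moreover have "(\<Sum>\<alpha>\<in>S. c \<alpha> * (- (\<epsilon> / C) * L w (f ^ 2))) = - (((C - 1) / C) * (\<epsilon> * L w (f ^ 2)))"
        by (simp add: C_def sum_distrib_right sum_divide_distrib sum_negf)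
      moreover have "(C - 1) / C * (\<epsilon> * L w (f ^ 2)) \<le> 1 * (\<epsilon> * L w (f ^ 2))"
        using C \<epsilon> elim(3) by (intro mult_right_mono) (auto simp: field_simps)
      ultimately show ?case by linarith
    qed
  qed
  with \<epsilon> show ?thesis by blast
qed

end

section \<open>Certificates without the ball constraint\<close>

definition is_sos :: "'n::finite mpoly \<Rightarrow> bool" where
  "is_sos f \<longleftrightarrow> (\<exists>qs. f = (\<Sum>q\<leftarrow>qs. q ^ 2))"

lemma is_sos_0: "is_sos 0"
  unfolding is_sos_def by (rule exI[of _ "[]"]) simp

lemma is_sos_square: "is_sos (q ^ 2)"
  unfolding is_sos_def by (rule exI[of _ "[q]"]) simp

lemma is_sos_add: "is_sos f \<Longrightarrow> is_sos g \<Longrightarrow> is_sos (f + g)"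
proof -
  assume "is_sos f" "is_sos g"
  then obtain ps qs where "f = (\<Sum>p\<leftarrow>ps. p ^ 2)" "g = (\<Sum>q\<leftarrow>qs. q ^ 2)"
    by (auto simp: is_sos_def)
  then have "f + g = (\<Sum>q\<leftarrow>ps @ qs. q ^ 2)" by simp
  then show ?thesis unfolding is_sos_def by (rule exI)
qed

lemma is_sos_sum: "(\<And>i. i \<in> S \<Longrightarrow> is_sos (f i)) \<Longrightarrow> is_sos (sum f S)"
  by (induction S rule: infinite_finite_induct) (auto intro: is_sos_add is_sos_0)

lemma is_sos_mult:
  assumes "is_sos f" "is_sos g"
  shows "is_sos (f * g)"
proof -
  from assms obtain ps qs where f: "f = (\<Sum>p\<leftarrow>ps. p ^ 2)" and g: "g = (\<Sum>q\<leftarrow>qs. q ^ 2)"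
    by (auto simp: is_sos_def)
  have *: "is_sos (p ^ 2 * g)" for p
    unfolding is_sos_def g
    by (rule exI[of _ "map (\<lambda>q. p * q) qs"])
      (simp add: sum_list_const_mult[symmetric] power_mult_distrib o_def)
  show ?thesis
    unfolding f by (induction ps) (auto intro: is_sos_0 is_sos_add * simp: distrib_right)
qed

lemma is_sos_of_sos: "f \<in> sos k \<Longrightarrow> is_sos f"
  by (auto simp: sos_def is_sos_def)

text \<open>\<open>1 - |x|\<^sup>2 \<equiv> \<Sum>i. x\<^sub>i (1 - x\<^sub>i)\<close> on the hyperplane, and
  \<open>x (1 - x) = x (1 - x)\<^sup>2 + (1 - x) x\<^sup>2\<close>.\<close>

lemma ball_poly_decomposition:
  "(ball_poly :: 'n::finite mpoly) = hyper_poly * (1 + (\<Sum>i\<in>UNIV. Var i ^ 2))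
    + (\<Sum>i\<in>UNIV. Var i * ((1 - Var i) ^ 2 + (\<Sum>j\<in>UNIV - {i}. Var j ^ 2)))"
proof -
  have 1: "Var i * (1 - Var i) ^ 2 = Var i - Var i ^ 2 - (1 - Var i) * Var i ^ 2" for i :: 'n
    by (simp add: power2_eq_square algebra_simps)
  have 2: "1 - Var i = hyper_poly + (\<Sum>j\<in>UNIV - {i}. Var j)" for i :: 'n
    using sum.remove[of UNIV i Var] by (simp add: hyper_poly_def)
  have 3: "(\<Sum>i\<in>UNIV. \<Sum>j\<in>UNIV - {i}. Var j * Var i ^ 2) = (\<Sum>i\<in>UNIV. \<Sum>j\<in>UNIV - {i}. Var i * Var j ^ 2 :: 'n mpoly)"
  proof -
    have s: "(\<Sum>j\<in>UNIV - {i}. f j) = (\<Sum>j\<in>UNIV. if j = i then 0 else f j)" for i :: 'n and f :: "'n \<Rightarrow> 'n mpoly"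
      by (intro sum.mono_neutral_cong_left) auto
    show ?thesis
      unfolding s by (subst sum.swap) (intro sum.cong refl; auto)
  qed
  have "(\<Sum>i\<in>UNIV. Var i * ((1 - Var i) ^ 2 + (\<Sum>j\<in>UNIV - {i}. Var j ^ 2)))
      = (\<Sum>i\<in>UNIV. Var i) - (\<Sum>i\<in>UNIV. Var i ^ 2) - (\<Sum>i\<in>UNIV. (1 - Var i) * Var i ^ 2)
        + (\<Sum>i\<in>UNIV. \<Sum>j\<in>UNIV - {i}. Var i * Var j ^ 2 :: 'n mpoly)"
    by (simp add: distrib_left sum.distrib sum_subtractf sum_distrib_left 1)
  also have "(\<Sum>i\<in>UNIV. (1 - Var i) * Var i ^ 2)
      = hyper_poly * (\<Sum>i\<in>UNIV. Var i ^ 2) + (\<Sum>i\<in>UNIV. \<Sum>j\<in>UNIV - {i}. Var j * Var i ^ 2 :: 'n mpoly)"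
    unfolding 2 by (simp add: distrib_right sum.distrib sum_distrib_left sum_distrib_right)
  finally show ?thesis
    unfolding 3 by (simp add: hyper_poly_def ball_poly_def algebra_simps)
qed

text \<open>The multipliers of the x_i in \<open>ball_poly_decomposition\<close> are sums of
  squares, so the ball term is absorbed into the other terms.\<close>

lemma IQ_decomposition:
  assumes "p \<in> IQ"
  obtains q as bs where "p = hyper_poly * q + (\<Sum>a\<leftarrow>as. a ^ 2) + (\<Sum>i\<in>UNIV. Var i * (\<Sum>b\<leftarrow>bs i. b ^ 2))"
proof -
  obtain k q s0 s s1 where p: "p = hyper_poly * q + s0 + (\<Sum>i\<in>UNIV. Var i * s i) + ball_poly * s1"
    and "s0 \<in> sos k" "\<And>i. s i \<in> sos (k - 1)" "s1 \<in> sos (k - 1)"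
    using assms by (auto simp: IQ_def IQ_trunc_def)
  define \<tau> :: "'a \<Rightarrow> 'a mpoly" where "\<tau> i = (1 - Var i) ^ 2 + (\<Sum>j\<in>UNIV - {i}. Var j ^ 2)" for i
  have s0: "is_sos s0" and s: "is_sos (s i + \<tau> i * s1)" for i
    unfolding \<tau>_def using \<open>s0 \<in> _\<close> \<open>s i \<in> _\<close> \<open>s1 \<in> _\<close>
    by (auto intro!: is_sos_add is_sos_mult is_sos_sum intro: is_sos_of_sos is_sos_square)
  obtain as where as: "s0 = (\<Sum>a\<leftarrow>as. a ^ 2)"
    using s0 by (auto simp: is_sos_def)
  have "\<exists>bs. \<forall>i. s i + \<tau> i * s1 = (\<Sum>b\<leftarrow>bs i. b ^ 2)"
    by (intro choice allI s[unfolded is_sos_def])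
  then obtain bs where bs: "\<And>i. s i + \<tau> i * s1 = (\<Sum>b\<leftarrow>bs i. b ^ 2)"
    by blast
  have "p = hyper_poly * (q + (1 + (\<Sum>i\<in>UNIV. Var i ^ 2)) * s1) + s0 + (\<Sum>i\<in>UNIV. Var i * (s i + \<tau> i * s1))"
    unfolding p ball_poly_decomposition \<tau>_def[symmetric]
    by (simp add: distrib_left distrib_right sum.distrib sum_distrib_left sum_distrib_right algebra_simps)
  then show thesis
    unfolding as bs by (rule that)
qed

section \<open>Local structure at a zero\<close>

lemma member_le_sum_list_nonneg:
  fixes f :: "'a \<Rightarrow> real"
  assumes "\<And>y. y \<in> set xs \<Longrightarrow> 0 \<le> f y" "x \<in> set xs"
  shows "f x \<le> (\<Sum>y\<leftarrow>xs. f y)"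
  using assms
proof (induction xs)
  case (Cons y ys)
  then have "0 \<le> (\<Sum>z\<leftarrow>ys. f z)"
    by (intro sum_list_nonneg) auto
  with Cons show ?case
    by (cases "x = y") fastforce+
qed simp

lemma sum_list_divide:
  fixes f :: "'a \<Rightarrow> 'b::field"
  shows "(\<Sum>x\<leftarrow>xs. f x) / r = (\<Sum>x\<leftarrow>xs. f x / r)"
  by (induction xs) (simp_all add: add_divide_distrib)

text \<open>The gradient read off from \<open>mpoly_taylor1\<close>; one D serves all directions.
  The form as a quotient fits the certificate after division by t or t^2.\<close>

lemma directional_derivative:
  fixes u :: "real^'n"
  assumes "peval f u = 0"
  shows "\<exists>D. \<forall>v. ((\<lambda>t. peval f (u + t *\<^sub>R v) / t) \<longlongrightarrow> D \<bullet> v) (at 0)"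
proof -
  obtain g where g: "f = Const (peval f u) + (\<Sum>j\<in>UNIV. (Var j - Const (u $ j)) * g j)"
    by (rule mpoly_taylor1)
  define D where "D = (\<chi> j. peval (g j) u)"
  have "((\<lambda>t. peval f (u + t *\<^sub>R v) / t) \<longlongrightarrow> D \<bullet> v) (at 0)" for v
  proof (rule Lim_transform_eventually)
    have "((\<lambda>t. \<Sum>j\<in>UNIV. v $ j * peval (g j) (u + t *\<^sub>R v)) \<longlongrightarrow> (\<Sum>j\<in>UNIV. v $ j * peval (g j) (u + 0 *\<^sub>R v))) (at 0)"
      by (intro tendsto_intros continuous_on_tendsto_compose[OF continuous_on_peval[of UNIV]]) auto
    then show "((\<lambda>t. \<Sum>j\<in>UNIV. v $ j * peval (g j) (u + t *\<^sub>R v)) \<longlongrightarrow> D \<bullet> v) (at 0)"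
      by (simp add: D_def inner_vec_def mult.commute)
    have "peval f (u + t *\<^sub>R v) = t * (\<Sum>j\<in>UNIV. v $ j * peval (g j) (u + t *\<^sub>R v))" for t
      by (subst g) (simp add: assms sum_distrib_left mult.assoc)
    then show "\<forall>\<^sub>F t in at 0. (\<Sum>j\<in>UNIV. v $ j * peval (g j) (u + t *\<^sub>R v)) = peval f (u + t *\<^sub>R v) / t"
      by (auto simp: eventually_at_filter)
  qed
  then show ?thesis by blast
qed

section \<open>Sums of squares of linear forms\<close>

definition square_form :: "(real^'n \<Rightarrow> real) \<Rightarrow> bool" where
  "square_form \<phi> \<longleftrightarrow> (\<exists>ds. \<forall>v. \<phi> v = (\<Sum>d\<leftarrow>ds. (d \<bullet> v) ^ 2))"

lemma square_form_0: "square_form (\<lambda>_. 0)"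
  unfolding square_form_def by (rule exI[of _ "[]"]) simp

lemma square_form_add: "square_form \<phi> \<Longrightarrow> square_form \<psi> \<Longrightarrow> square_form (\<lambda>v. \<phi> v + \<psi> v)"
proof -
  assume "square_form \<phi>" "square_form \<psi>"
  then obtain ds es where "\<And>v. \<phi> v = (\<Sum>d\<leftarrow>ds. (d \<bullet> v) ^ 2)" "\<And>v. \<psi> v = (\<Sum>d\<leftarrow>es. (d \<bullet> v) ^ 2)"
    by (auto simp: square_form_def)
  then have "\<forall>v. \<phi> v + \<psi> v = (\<Sum>d\<leftarrow>ds @ es. (d \<bullet> v) ^ 2)" by simp
  then show ?thesis unfolding square_form_def by (rule exI)
qed

lemma square_form_sum: "(\<And>i. i \<in> S \<Longrightarrow> square_form (\<phi> i)) \<Longrightarrow> square_form (\<lambda>v. \<Sum>i\<in>S. \<phi> i v)"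
  by (induction S rule: infinite_finite_induct) (auto intro: square_form_add square_form_0)

lemma square_form_weighted:
  assumes "0 \<le> r"
  shows "square_form (\<lambda>v. r * (\<Sum>f\<leftarrow>fs. (D f \<bullet> v) ^ 2))"
  unfolding square_form_def
  using assms
  by (intro exI[of _ "map (\<lambda>f. sqrt r *\<^sub>R D f) fs"])
    (simp add: sum_list_const_mult[symmetric] power_mult_distrib o_def)

lemma tendsto_sum_list:
  fixes f :: "'a \<Rightarrow> 'b \<Rightarrow> 'c::topological_monoid_add"
  shows "(\<And>x. x \<in> set xs \<Longrightarrow> (f x \<longlongrightarrow> l x) F) \<Longrightarrow> ((\<lambda>t. \<Sum>x\<leftarrow>xs. f x t) \<longlongrightarrow> (\<Sum>x\<leftarrow>xs. l x)) F"
  by (induction xs) (auto intro!: tendsto_add)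

section \<open>Quadratic forms along lines and the certificate at a zero\<close>

lemma sym_mats_inner_commute:
  fixes W :: "real^'n^'n"
  assumes "W \<in> sym_mats"
  shows "u \<bullet> (W *v v) = v \<bullet> (W *v u)"
proof -
  have "u \<bullet> (W *v v) = (transpose W *v u) \<bullet> v"
    by (simp only: transpose_matrix_vector dot_lmul_matrix)
  then show ?thesis
    using assms by (simp add: sym_mats_def inner_commute del: transpose_matrix_vector)
qed

lemma quadratic_expansion:
  fixes W :: "real^'n^'n"
  assumes "W \<in> sym_mats"
  shows "(u + t *\<^sub>R v) \<bullet> (W *v (u + t *\<^sub>R v)) = u \<bullet> (W *v u) + 2 * t * (v \<bullet> (W *v u)) + t ^ 2 * (v \<bullet> (W *v v))"
proof -
  have "u \<bullet> (W *v v) = v \<bullet> (W *v u)"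
    using assms by (rule sym_mats_inner_commute)
  then show ?thesis
    by (simp add: matrix_vector_right_distrib matrix_vector_mult_scaleR inner_add_left inner_add_right
        power2_eq_square algebra_simps)
qed

locale certificate =
  fixes W :: "real^'n^'n" and q :: "'n mpoly" and as :: "'n mpoly list" and bs :: "'n \<Rightarrow> 'n mpoly list"
  assumes sym: "W \<in> sym_mats"
    and psi_eq: "psi W = hyper_poly * q + (\<Sum>a\<leftarrow>as. a ^ 2) + (\<Sum>i\<in>UNIV. Var i * (\<Sum>b\<leftarrow>bs i. b ^ 2))"
begin

definition zeros :: "(real^'n) set" where
  "zeros = {x \<in> std_simplex. peval (psi W) x = 0}"

lemma eval_on_hyperplane:
  assumes "(\<Sum>i\<in>UNIV. x $ i) = 1"
  shows "x \<bullet> (W *v x) = (\<Sum>a\<leftarrow>as. peval a x ^ 2) + (\<Sum>i\<in>UNIV. x $ i * (\<Sum>b\<leftarrow>bs i. peval b x ^ 2))"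
  using arg_cong[OF psi_eq, of "\<lambda>p. peval p x"] assms by (simp add: o_def)

lemma nonneg_on_simplex: "x \<in> std_simplex \<Longrightarrow> 0 \<le> peval (psi W) x"
  by (auto simp: std_simplex_def eval_on_hyperplane
      intro!: add_nonneg_nonneg sum_nonneg mult_nonneg_nonneg sum_list_nonneg)

lemma sum_list_squares_eq_0:
  fixes f :: "'a \<Rightarrow> real"
  assumes "(\<Sum>x\<leftarrow>xs. f x ^ 2) = 0" "x \<in> set xs"
  shows "f x = 0"
  using member_le_sum_list_nonneg[of xs "\<lambda>x. f x ^ 2" x] assms by simp

context
  fixes u
  assumes u: "u \<in> zeros"
begin

lemma u_nonneg: "0 \<le> u $ i" and u_sum: "(\<Sum>i\<in>UNIV. u $ i) = 1" and u_zero: "u \<bullet> (W *v u) = 0"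
  using u by (auto simp: zeros_def std_simplex_def)

text \<open>At a zero the nonnegative terms of the certificate add up to 0, so each of them is
  0.\<close>

lemma squares_vanish:
  shows "a \<in> set as \<Longrightarrow> peval a u = 0"
    and "b \<in> set (bs i) \<Longrightarrow> u $ i \<noteq> 0 \<Longrightarrow> peval b u = 0"
proof -
  let ?B = "\<lambda>i. u $ i * (\<Sum>b\<leftarrow>bs i. peval b u ^ 2)"
  have A: "0 \<le> (\<Sum>a\<leftarrow>as. peval a u ^ 2)" and B: "0 \<le> ?B i" for i
    using u_nonneg by (auto intro!: sum_list_nonneg mult_nonneg_nonneg)
  have "(\<Sum>a\<leftarrow>as. peval a u ^ 2) + (\<Sum>i\<in>UNIV. ?B i) = 0"
    using eval_on_hyperplane[OF u_sum] u_zero by simp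
  then have "(\<Sum>a\<leftarrow>as. peval a u ^ 2) = 0" and "(\<Sum>i\<in>UNIV. ?B i) = 0"
    using A B sum_nonneg[of UNIV ?B] by (auto simp: add_nonneg_eq_0_iff)
  then show "a \<in> set as \<Longrightarrow> peval a u = 0"
    and "b \<in> set (bs i) \<Longrightarrow> u $ i \<noteq> 0 \<Longrightarrow> peval b u = 0"
    using B sum_list_squares_eq_0[of "\<lambda>f. peval f u"]
    by (auto simp: sum_nonneg_eq_0_iff)
qed

text \<open>f vanishes to first order along the line, so its square is of order t^2.\<close>

lemma quotient_square_tendsto:
  assumes "peval f u = 0"
  shows "((\<lambda>t. peval f (u + t *\<^sub>R v) ^ 2 / t) \<longlongrightarrow> 0) (at 0)"
proof -
  obtain D where "((\<lambda>t. peval f (u + t *\<^sub>R v) / t) \<longlongrightarrow> D \<bullet> v) (at 0)"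
    using directional_derivative[OF assms] by blast
  then have "((\<lambda>t. t * (peval f (u + t *\<^sub>R v) / t) ^ 2) \<longlongrightarrow> 0 * (D \<bullet> v) ^ 2) (at 0)"
    by (intro tendsto_mult tendsto_power tendsto_ident_at)
  moreover have "t * (peval f (u + t *\<^sub>R v) / t) ^ 2 = peval f (u + t *\<^sub>R v) ^ 2 / t" for t
    by (cases "t = 0") (simp_all add: power2_eq_square)
  ultimately show ?thesis by simp
qed

text \<open>First order comparison along the line through u and the vertex e_i, which lies in the
  hyperplane. Squares of polynomials vanishing at u are of order t^2; only the term with factor x_i
  can survive, and only if u_i = 0.\<close>

lemma gradient:
  "2 * (W *v u) $ i = (if u $ i = 0 then \<Sum>b\<leftarrow>bs i. peval b u ^ 2 else 0)"
proof -
  \<comment> \<open>Since u is a zero, pairing this direction with W u leaves just the i-th entry of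
    W u.\<close>
  define v where "v = axis i 1 - u"
  let ?x = "\<lambda>t. u + t *\<^sub>R v"
  have v_W: "v \<bullet> (W *v u) = (W *v u) $ i"
    by (simp add: v_def inner_diff_left u_zero inner_axis')
  have sum_x: "(\<Sum>i\<in>UNIV. ?x t $ i) = 1" for t
    by (simp add: v_def sum.distrib sum_subtractf u_sum sum_distrib_left[symmetric] axis_def)
  have eq: "2 * (W *v u) $ i + t * (v \<bullet> (W *v v))
      = (\<Sum>a\<leftarrow>as. peval a (?x t) ^ 2 / t) + (\<Sum>l\<in>UNIV. ?x t $ l * (\<Sum>b\<leftarrow>bs l. peval b (?x t) ^ 2 / t))"
    if "t \<noteq> 0" for t
  proof -
    have "2 * (W *v u) $ i + t * (v \<bullet> (W *v v)) = (?x t \<bullet> (W *v ?x t)) / t"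
      using that unfolding quadratic_expansion[OF sym] v_W u_zero by (simp add: power2_eq_square field_simps)
    then show ?thesis
      unfolding eval_on_hyperplane[OF sum_x]
      by (simp add: add_divide_distrib sum_divide_distrib sum_list_divide
          times_divide_eq_right[symmetric] del: times_divide_eq_right)
  qed
  have lim_x: "((\<lambda>t. ?x t $ l) \<longlongrightarrow> u $ l) (at 0)" for l
    by (auto intro!: tendsto_eq_intros)
  have 1: "((\<lambda>t. ?x t $ l * (\<Sum>b\<leftarrow>bs l. peval b (?x t) ^ 2 / t)) \<longlongrightarrow>
      (if l = i \<and> u $ i = 0 then \<Sum>b\<leftarrow>bs i. peval b u ^ 2 else 0)) (at 0)" for l
  proof (cases "u $ l = 0")
    case False
    then have "((\<lambda>t. ?x t $ l * (\<Sum>b\<leftarrow>bs l. peval b (?x t) ^ 2 / t)) \<longlongrightarrow> u $ l * (\<Sum>b\<leftarrow>bs l. 0)) (at 0)"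
      using squares_vanish by (intro tendsto_mult lim_x tendsto_sum_list quotient_square_tendsto) auto
    with False show ?thesis by auto
  next
    case True
    show ?thesis
    proof (cases "l = i")
      case False
      \<comment> \<open>Here u_l = v_l = 0, so the term is identically 0 along the line.\<close>
      with True show ?thesis by (simp add: v_def axis_def)
    next
      case True
      \<comment> \<open>Here the i-th coordinate along the line is t itself, which cancels the
        denominator.\<close>
      have "((\<lambda>t. \<Sum>b\<leftarrow>bs i. peval b (?x t) ^ 2) \<longlongrightarrow> (\<Sum>b\<leftarrow>bs i. peval b (u + 0 *\<^sub>R v) ^ 2)) (at 0)"
        by (intro tendsto_sum_list tendsto_intros continuous_on_tendsto_compose[OF continuous_on_peval[of UNIV]]) auto
      moreover have "\<forall>\<^sub>F t in at 0. (\<Sum>b\<leftarrow>bs i. peval b (?x t) ^ 2) = ?x t $ l * (\<Sum>b\<leftarrow>bs l. peval b (?x t) ^ 2 / t)"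
        using True \<open>u $ l = 0\<close>
        by (auto simp: eventually_at_filter v_def axis_def sum_list_const_mult[symmetric])
      ultimately show ?thesis
        using True \<open>u $ l = 0\<close> by (auto intro: Lim_transform_eventually)
    qed
  qed
  have "((\<lambda>t. (\<Sum>a\<leftarrow>as. peval a (?x t) ^ 2 / t) + (\<Sum>l\<in>UNIV. ?x t $ l * (\<Sum>b\<leftarrow>bs l. peval b (?x t) ^ 2 / t)))
      \<longlongrightarrow> (\<Sum>a\<leftarrow>as. 0) + (\<Sum>l\<in>UNIV. if l = i \<and> u $ i = 0 then \<Sum>b\<leftarrow>bs i. peval b u ^ 2 else 0)) (at 0)"
    using squares_vanish(1) by (intro tendsto_add tendsto_sum_list tendsto_sum 1 quotient_square_tendsto) auto
  then have "((\<lambda>t. 2 * (W *v u) $ i + t * (v \<bullet> (W *v v))) \<longlongrightarrow>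
      (\<Sum>a\<leftarrow>as. 0) + (\<Sum>l\<in>UNIV. if l = i \<and> u $ i = 0 then \<Sum>b\<leftarrow>bs i. peval b u ^ 2 else 0)) (at 0)"
    by (rule Lim_transform_eventually) (auto simp: eventually_at_filter eq)
  moreover have "((\<lambda>t. 2 * (W *v u) $ i + t * (v \<bullet> (W *v v))) \<longlongrightarrow> 2 * (W *v u) $ i + 0 * (v \<bullet> (W *v v))) (at 0)"
    by (intro tendsto_intros)
  ultimately have "2 * (W *v u) $ i + 0 * (v \<bullet> (W *v v))
      = (\<Sum>a\<leftarrow>as. 0) + (\<Sum>l\<in>UNIV. if l = i \<and> u $ i = 0 then \<Sum>b\<leftarrow>bs i. peval b u ^ 2 else 0)"
    using tendsto_unique[OF at_neq_bot] by blast
  then show ?thesis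
    by (cases "u $ i = 0") simp_all
qed

text \<open>The gradient 2 W u itself serves as multiplier of the sign constraints, the other two
  multipliers being 0; \<open>gradient\<close> supplies its sign and complementarity. Thus finitely
  many critical points of value 0 means finitely many zeros.\<close>

lemma critical: "simplex_critical (psi W) u"
proof -
  let ?l = "2 *\<^sub>R (W *v u)"
  have "0 \<le> ?l $ i" "?l $ i * u $ i = 0" for i
    using gradient[of i] by (auto intro!: sum_list_nonneg split: if_splits)
  moreover have "((\<lambda>y. peval (psi W) y - 0 * (1 - (\<Sum>i\<in>UNIV. y $ i)) - (\<Sum>i\<in>UNIV. ?l $ i * y $ i) - 0 * (1 - y \<bullet> y))
           has_derivative (\<lambda>_. 0)) (at u)"
  proof -
    have "linear ((*v) W)"
      by simp
    then have W': "((\<lambda>y. W *v y) has_derivative (\<lambda>h. W *v h)) (at u)"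
      by (rule linear_imp_has_derivative)
    have "((\<lambda>y. y \<bullet> (W *v y) - ?l \<bullet> y) has_derivative (\<lambda>h. u \<bullet> (W *v h) + h \<bullet> (W *v u) - ?l \<bullet> h)) (at u)"
      by (intro has_derivative_diff has_derivative_inner W' has_derivative_ident has_derivative_inner_right)
    moreover have "u \<bullet> (W *v h) + h \<bullet> (W *v u) - ?l \<bullet> h = 0" for h
      using sym_mats_inner_commute[OF sym, of u h] by (simp add: inner_commute)
    moreover have "(\<Sum>i\<in>UNIV. ?l $ i * y $ i) = ?l \<bullet> y" for y
      by (simp add: inner_vec_def)
    ultimately show ?thesis
      by (simp only: peval_psi mult_zero_left diff_0_right)
  qed
  moreover have "u \<in> std_simplex"
    using u by (simp add: zeros_def)
  ultimately show ?thesis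
    unfolding simplex_critical_def
    by (intro conjI exI[of _ "0::real"] exI[of _ ?l] allI) auto
qed

text \<open>Second order comparison: for such v the linear term of the quadratic form vanishes along
  u + t v, and division of the certificate by t^2 leaves squares of directional derivatives,
  weighted by u_i.\<close>

lemma tangent_form:
  obtains ds where "\<And>v. (\<Sum>i\<in>UNIV. v $ i) = 0 \<Longrightarrow> (\<And>i. (W *v u) $ i \<noteq> 0 \<Longrightarrow> v $ i = 0) \<Longrightarrow>
    v \<bullet> (W *v v) = (\<Sum>d\<leftarrow>ds. (d \<bullet> v) ^ 2)"
proof -
  obtain D where D: "\<And>f v. peval f u = 0 \<Longrightarrow> ((\<lambda>t. peval f (u + t *\<^sub>R v) / t) \<longlongrightarrow> D f \<bullet> v) (at 0)"
    using choice[of "\<lambda>f D. peval f u = 0 \<longrightarrow> (\<forall>v. ((\<lambda>t. peval f (u + t *\<^sub>R v) / t) \<longlongrightarrow> D \<bullet> v) (at 0))"]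
      directional_derivative[of _ u] by blast
  let ?\<phi> = "\<lambda>v. 1 * (\<Sum>a\<leftarrow>as. (D a \<bullet> v) ^ 2) + (\<Sum>i\<in>UNIV. u $ i * (\<Sum>b\<leftarrow>bs i. (D b \<bullet> v) ^ 2))"
  have "square_form ?\<phi>"
    by (intro square_form_add square_form_sum square_form_weighted u_nonneg) simp
  then obtain ds where ds: "\<And>v. ?\<phi> v = (\<Sum>d\<leftarrow>ds. (d \<bullet> v) ^ 2)"
    unfolding square_form_def by blast
  show thesis
  proof (rule that[of ds])
    fix v :: "real^'n" assume v: "(\<Sum>i\<in>UNIV. v $ i) = 0" "\<And>i. (W *v u) $ i \<noteq> 0 \<Longrightarrow> v $ i = 0"
    let ?x = "\<lambda>t. u + t *\<^sub>R v"
    have v_W: "v \<bullet> (W *v u) = 0"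
      unfolding inner_vec_def using v(2) by (intro sum.neutral) auto
    have sum_x: "(\<Sum>i\<in>UNIV. ?x t $ i) = 1" for t
      using v(1) by (simp add: sum.distrib u_sum sum_distrib_left[symmetric])
    have eq: "v \<bullet> (W *v v) = (\<Sum>a\<leftarrow>as. (peval a (?x t) / t) ^ 2)
        + (\<Sum>i\<in>UNIV. ?x t $ i * (\<Sum>b\<leftarrow>bs i. (peval b (?x t) / t) ^ 2))"
      if "t \<noteq> 0" for t
    proof -
      have "v \<bullet> (W *v v) = (?x t \<bullet> (W *v ?x t)) / t ^ 2"
        using that unfolding quadratic_expansion[OF sym] v_W u_zero by simp
      then show ?thesis
        unfolding eval_on_hyperplane[OF sum_x]
        by (simp add: add_divide_distrib sum_divide_distrib sum_list_divide power_divide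
            times_divide_eq_right[symmetric] del: times_divide_eq_right)
    qed
    have lim_x: "((\<lambda>t. ?x t $ l) \<longlongrightarrow> u $ l) (at 0)" for l
      by (auto intro!: tendsto_eq_intros)
    have "((\<lambda>t. ?x t $ i * (\<Sum>b\<leftarrow>bs i. (peval b (?x t) / t) ^ 2)) \<longlongrightarrow> u $ i * (\<Sum>b\<leftarrow>bs i. (D b \<bullet> v) ^ 2)) (at 0)" for i
    proof (cases "(W *v u) $ i = 0")
      case True
      \<comment> \<open>For u_i = 0 this follows from \<open>gradient\<close>, otherwise from
        \<open>squares_vanish\<close>.\<close>
      have "peval b u = 0" if "b \<in> set (bs i)" for b
        using gradient[of i] True that squares_vanish(2)[OF that] sum_list_squares_eq_0[of "\<lambda>b. peval b u", OF _ that]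
        by (auto split: if_splits)
      then show ?thesis
        by (intro tendsto_mult lim_x tendsto_sum_list tendsto_power D)
    next
      case False
      \<comment> \<open>The polynomials b need not vanish at u here, but the factor x_i is 0 along
        the whole line.\<close>
      then have "u $ i = 0" "v $ i = 0"
        using gradient[of i] v(2) by (auto split: if_splits)
      then show ?thesis by simp
    qed
    then have "((\<lambda>t. (\<Sum>a\<leftarrow>as. (peval a (?x t) / t) ^ 2)
        + (\<Sum>i\<in>UNIV. ?x t $ i * (\<Sum>b\<leftarrow>bs i. (peval b (?x t) / t) ^ 2))) \<longlongrightarrow>
        (\<Sum>a\<leftarrow>as. (D a \<bullet> v) ^ 2) + (\<Sum>i\<in>UNIV. u $ i * (\<Sum>b\<leftarrow>bs i. (D b \<bullet> v) ^ 2))) (at 0)"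
      by (intro tendsto_add tendsto_sum tendsto_sum_list tendsto_power D squares_vanish(1))
    then have "((\<lambda>t::real. v \<bullet> (W *v v)) \<longlongrightarrow> ?\<phi> v) (at 0)"
      unfolding mult_1 by (rule Lim_transform_eventually) (auto simp: eventually_at_filter eq)
    then have "v \<bullet> (W *v v) = ?\<phi> v"
      by (intro tendsto_unique[OF at_neq_bot tendsto_const])
    then show "v \<bullet> (W *v v) = (\<Sum>d\<leftarrow>ds. (d \<bullet> v) ^ 2)"
      by (simp only: ds)
  qed
qed

end

end

text \<open>M lies in the span of the products of vectors that are 0 on T and have sum 0, and D
  vanishes on these by polarization. Explicitly, off T the entry of D splits into terms depending on
  i only or j only, which the row and column sums of M annihilate.\<close>

lemma bilinear_form_trace_zero:
  fixes D M :: "'n::finite \<Rightarrow> 'n \<Rightarrow> real"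
  assumes D_sym: "\<And>i j. D i j = D j i"
    and D_zero: "\<And>v. (\<Sum>i\<in>UNIV. v i) = 0 \<Longrightarrow> (\<And>i. i \<in> T \<Longrightarrow> v i = 0) \<Longrightarrow> (\<Sum>i\<in>UNIV. \<Sum>j\<in>UNIV. D i j * (v i * v j)) = 0"
    and M_T: "\<And>i j. i \<in> T \<Longrightarrow> M i j = 0" and M_sym: "\<And>i j. M i j = M j i"
    and M_sum: "\<And>j. (\<Sum>i\<in>UNIV. M i j) = 0"
    and s: "s \<notin> T"
  shows "(\<Sum>i\<in>UNIV. \<Sum>j\<in>UNIV. D i j * M i j) = 0"
proof -
  define B where "B v w = (\<Sum>i\<in>UNIV. \<Sum>j\<in>UNIV. D i j * (v i * w j))" for v w :: "'n \<Rightarrow> real"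
  have B_sym: "B v w = B w v" for v w
    unfolding B_def by (subst sum.swap) (simp add: D_sym mult.commute)
  have B_add: "B (\<lambda>i. v i + v' i) w = B v w + B v' w" and B_diff: "B (\<lambda>i. v i - v' i) w = B v w - B v' w" for v v' w
    by (simp_all add: B_def algebra_simps sum.distrib sum_subtractf)
  have B_diff': "B w (\<lambda>i. v i - v' i) = B w v - B w v'" for v v' w
    by (metis B_diff B_sym)
  define \<delta> :: "'n \<Rightarrow> 'n \<Rightarrow> real" where "\<delta> i k = (if k = i then 1 else 0)" for i k
  have B_\<delta>: "B (\<delta> i) (\<delta> j) = D i j" for i j
  proof -
    have "B (\<delta> i) (\<delta> j) = (\<Sum>k\<in>UNIV. \<Sum>l\<in>UNIV. if l = j then D k j * \<delta> i k else 0)"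
      unfolding B_def \<delta>_def by (intro sum.cong) auto
    also have "\<dots> = (\<Sum>k\<in>UNIV. if k = i then D i j else 0)"
      by (intro sum.cong) (auto simp: \<delta>_def)
    finally show ?thesis by simp
  qed
  \<comment> \<open>Polarization with e_i - e_s and e_j - e_s, both in the subspace on which the
    form vanishes.\<close>
  have D_eq: "D i j = D i s + D s j - D s s" if "i \<notin> T" "j \<notin> T" for i j
  proof -
    let ?v = "\<lambda>k. \<delta> i k - \<delta> s k" and ?w = "\<lambda>k. \<delta> j k - \<delta> s k"
    have z: "B ?v ?v = 0" "B ?w ?w = 0" "B (\<lambda>k. ?v k + ?w k) (\<lambda>k. ?v k + ?w k) = 0"
      unfolding B_def
      by (intro D_zero; use that s in \<open>auto simp: \<delta>_def sum.distrib sum_subtractf sum_distrib_left[symmetric]\<close>)+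
    have "B (\<lambda>k. ?v k + ?w k) (\<lambda>k. ?v k + ?w k) = B ?v ?v + 2 * B ?v ?w + B ?w ?w"
      by (simp only: B_add B_sym[of _ "\<lambda>k. ?v k + ?w k"]) (simp add: B_sym[of ?w ?v])
    then have "B ?v ?w = 0" using z by simp
    then show ?thesis
      by (simp only: B_diff B_diff' B_\<delta>)
  qed
  have M_T': "M i j = 0" if "j \<in> T" for i j
    using M_T[OF that] M_sym by metis
  have M_sum': "(\<Sum>j\<in>UNIV. M i j) = 0" for i
    using M_sum[of i] by (simp add: M_sym)
  have "(\<Sum>i\<in>UNIV. \<Sum>j\<in>UNIV. D i j * M i j) = (\<Sum>i\<in>UNIV. \<Sum>j\<in>UNIV. (D i s + D s j - D s s) * M i j)"
  proof (intro sum.cong refl)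
    fix i j
    show "D i j * M i j = (D i s + D s j - D s s) * M i j"
      using D_eq[of i j] M_T[of i j] M_T'[of j i] by (cases "i \<in> T"; cases "j \<in> T") auto
  qed
  also have "\<dots> = (\<Sum>i\<in>UNIV. (D i s - D s s) * (\<Sum>j\<in>UNIV. M i j)) + (\<Sum>i\<in>UNIV. \<Sum>j\<in>UNIV. D s j * M i j)"
    by (simp add: sum_distrib_left sum.distrib sum_subtractf algebra_simps)
  also have "(\<Sum>i\<in>UNIV. \<Sum>j\<in>UNIV. D s j * M i j) = (\<Sum>j\<in>UNIV. D s j * (\<Sum>i\<in>UNIV. M i j))"
    by (subst sum.swap) (simp add: sum_distrib_left)
  finally show ?thesis
    by (simp add: M_sum M_sum')
qed

lemma inner_power2_eq: "((d::real^'n) \<bullet> v) ^ 2 = (\<Sum>i\<in>UNIV. \<Sum>j\<in>UNIV. d $ i * d $ j * (v $ i * v $ j))"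
  by (simp add: power2_eq_square inner_vec_def sum_product mult_ac)

lemma quadratic_form_eq: "v \<bullet> (W *v v) = (\<Sum>i\<in>UNIV. \<Sum>j\<in>UNIV. W $ i $ j * (v $ i * v $ j))"
  by (simp add: inner_vec_def matrix_vector_mult_def sum_distrib_left mult_ac)

lemma double_sum_sum_list:
  "(\<Sum>i\<in>A. \<Sum>j\<in>B. (\<Sum>x\<leftarrow>xs. f x i j) * (c i j :: real)) = (\<Sum>x\<leftarrow>xs. \<Sum>i\<in>A. \<Sum>j\<in>B. f x i j * c i j)"
  by (induction xs) (simp_all add: distrib_right sum.distrib)

context certificate
begin

text \<open>Jensen's inequality: \<open>r\<close>, \<open>m\<close> and \<open>M\<close> play the role of the mass and of the moments of
  \<open>x - u\<close> under a functional annihilating \<open>psi W\<close>; then the segment from \<open>u\<close> to the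
  barycenter consists of zeros, hence is trivial.\<close>

lemma barycenter_eq:
  fixes m :: "real^'n" and M :: "'n \<Rightarrow> 'n \<Rightarrow> real"
  assumes fin: "finite zeros" and u: "u \<in> zeros"
    and ds: "\<And>v. (\<Sum>i\<in>UNIV. v $ i) = 0 \<Longrightarrow> (\<And>i. (W *v u) $ i \<noteq> 0 \<Longrightarrow> v $ i = 0) \<Longrightarrow>
      v \<bullet> (W *v v) = (\<Sum>d\<leftarrow>ds. (d \<bullet> v) ^ 2)"
    and r: "0 \<le> r" "r = 0 \<Longrightarrow> m = 0"
    and m_pos: "\<And>i. 0 \<le> r * u $ i + m $ i" and m_sum: "(\<Sum>i\<in>UNIV. m $ i) = 0"
    and m_T: "\<And>i. (W *v u) $ i \<noteq> 0 \<Longrightarrow> m $ i = 0"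
    and M_T: "\<And>i j. (W *v u) $ i \<noteq> 0 \<Longrightarrow> M i j = 0" and M_sym: "\<And>i j. M i j = M j i"
    and M_sum: "\<And>j. (\<Sum>i\<in>UNIV. M i j) = 0"
    and psi_zero: "(\<Sum>i\<in>UNIV. \<Sum>j\<in>UNIV. W $ i $ j * M i j) + (\<Sum>i\<in>UNIV. 2 * (W *v u) $ i * m $ i) = 0"
    and psd: "\<And>d. d \<in> set ds \<Longrightarrow> 0 \<le> (\<Sum>i\<in>UNIV. \<Sum>j\<in>UNIV. d $ i * d $ j * M i j)"
    and cs: "\<And>d. d \<in> set ds \<Longrightarrow> (\<Sum>i\<in>UNIV. \<Sum>j\<in>UNIV. d $ i * d $ j * M i j) \<le> 0 \<Longrightarrow> d \<bullet> m = 0"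
  shows "m = 0"
proof (rule ccontr)
  assume "m \<noteq> 0"
  then have r_pos: "0 < r"
    using r by force
  define T where "T = {i. (W *v u) $ i \<noteq> 0}"
  have u_simplex: "\<And>i. 0 \<le> u $ i" "(\<Sum>i\<in>UNIV. u $ i) = 1" and u_zero: "u \<bullet> (W *v u) = 0"
    using u by (auto simp: zeros_def std_simplex_def)
  have "\<exists>s. u $ s \<noteq> 0"
    using u_simplex(2) by (metis sum.neutral zero_neq_one)
  then obtain s where "u $ s \<noteq> 0" ..
  then have s: "s \<notin> T"
    using gradient[OF u, of s] by (auto simp: T_def)
  \<comment> \<open>D compares W with the sum of squares that represents it on tangent vectors.
    There it vanishes, so its pairing with M is 0 and the squares have total second moment
    0.\<close>
  define D where "D i j = W $ i $ j - (\<Sum>d\<leftarrow>ds. d $ i * d $ j)" for i j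
  have D_split: "(\<Sum>i\<in>UNIV. \<Sum>j\<in>UNIV. D i j * c i j) =
      (\<Sum>i\<in>UNIV. \<Sum>j\<in>UNIV. W $ i $ j * c i j) - (\<Sum>d\<leftarrow>ds. \<Sum>i\<in>UNIV. \<Sum>j\<in>UNIV. d $ i * d $ j * c i j)" for c
    by (simp add: D_def left_diff_distrib sum_subtractf double_sum_sum_list)
  have "(\<Sum>i\<in>UNIV. \<Sum>j\<in>UNIV. D i j * M i j) = 0"
  proof (rule bilinear_form_trace_zero[OF _ _ _ M_sym M_sum s])
    show "D i j = D j i" for i j
      using sym_mats_entry[OF sym] by (simp add: D_def mult.commute)
    show "M i j = 0" if "i \<in> T" for i j
      using that M_T by (simp add: T_def)
    fix v :: "'n \<Rightarrow> real"
    assume v: "(\<Sum>i\<in>UNIV. v i) = 0" "\<And>i. i \<in> T \<Longrightarrow> v i = 0"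
    then have "(\<chi> i. v i) \<bullet> (W *v (\<chi> i. v i)) = (\<Sum>d\<leftarrow>ds. (d \<bullet> (\<chi> i. v i)) ^ 2)"
      by (intro ds) (auto simp: T_def)
    then show "(\<Sum>i\<in>UNIV. \<Sum>j\<in>UNIV. D i j * (v i * v j)) = 0"
      unfolding D_split quadratic_form_eq inner_power2_eq by simp
  qed
  moreover have "(\<Sum>i\<in>UNIV. 2 * (W *v u) $ i * m $ i) = 0"
    using m_T by (intro sum.neutral) auto
  ultimately have total: "(\<Sum>d\<leftarrow>ds. \<Sum>i\<in>UNIV. \<Sum>j\<in>UNIV. d $ i * d $ j * M i j) = 0"
    using psi_zero by (simp add: D_split)
  \<comment> \<open>Nonnegative second moments with sum 0 vanish one by one, and then Cauchy-Schwarz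
    kills the first moments.\<close>
  have "d \<bullet> m = 0" if "d \<in> set ds" for d
    using member_le_sum_list_nonneg[of ds "\<lambda>d. \<Sum>i\<in>UNIV. \<Sum>j\<in>UNIV. d $ i * d $ j * M i j", OF psd that]
    by (intro cs that) (simp add: total)
  then have "(\<Sum>d\<leftarrow>ds. (d \<bullet> m) ^ 2) = (\<Sum>d\<leftarrow>ds. 0)"
    by (intro arg_cong[of _ _ sum_list] map_cong) auto
  then have "m \<bullet> (W *v m) = 0"
    using ds[OF m_sum m_T] by simp
  moreover have "m \<bullet> (W *v u) = 0"
    unfolding inner_vec_def using m_T by (intro sum.neutral) auto
  ultimately have form: "(u + t *\<^sub>R m) \<bullet> (W *v (u + t *\<^sub>R m)) = 0" for t
    unfolding quadratic_expansion[OF sym] by (simp add: u_zero)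
  have "(\<lambda>t. u + t *\<^sub>R m) ` {0..1 / r} \<subseteq> zeros"
  proof safe
    fix t :: real assume t: "t \<in> {0..1 / r}"
    have "u + t *\<^sub>R m \<in> std_simplex"
    proof (rule std_simplexI)
      fix i
      have "0 \<le> t" "0 \<le> 1 - t * r"
        using t r_pos by (auto simp: field_simps)
      \<comment> \<open>The point is a convex combination of u and the barycenter u + m / r, which
        is reached at t = 1 / r.\<close>
      then have "0 \<le> t * (r * u $ i + m $ i) + (1 - t * r) * u $ i"
        by (intro add_nonneg_nonneg[OF mult_nonneg_nonneg mult_nonneg_nonneg] m_pos u_simplex(1))
      then show "0 \<le> (u + t *\<^sub>R m) $ i"
        by (simp add: algebra_simps)
    qed (simp add: sum.distrib u_simplex m_sum sum_distrib_left[symmetric])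
    then show "u + t *\<^sub>R m \<in> zeros"
      by (simp add: zeros_def form)
  qed
  moreover have "inj_on (\<lambda>t. u + t *\<^sub>R m) {0..1 / r}"
    using \<open>m \<noteq> 0\<close> by (auto simp: inj_on_def)
  ultimately have "finite {0..1 / r}"
    using fin finite_subset finite_imageD by blast
  then show False
    using r_pos by (simp add: infinite_Icc)
qed

lemma psi_taylor:
  "psi W = Const (u \<bullet> (W *v u)) + (\<Sum>i\<in>UNIV. Const (2 * (W *v u) $ i) * (Var i - Const (u $ i)))
    + (\<Sum>i\<in>UNIV. \<Sum>j\<in>UNIV. Const (W $ i $ j) * ((Var i - Const (u $ i)) * (Var j - Const (u $ j))))"
proof -
  let ?Y = "\<lambda>i. Var i - Const (u $ i)" and ?w = "\<lambda>i j. Const (W $ i $ j)" and ?u = "\<lambda>i. Const (u $ i)"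
  have W_u: "Const ((W *v u) $ i) = (\<Sum>j\<in>UNIV. ?w i j * ?u j)" for i
    by (simp add: matrix_vector_mult_def Const_sum Const_mult)
  have "psi W = (\<Sum>i\<in>UNIV. \<Sum>j\<in>UNIV. ?w i j * (?u i + ?Y i) * (?u j + ?Y j))"
    by (simp add: psi_def)
  also have "\<dots> = (\<Sum>i\<in>UNIV. \<Sum>j\<in>UNIV. ?u i * (?w i j * ?u j)) + (\<Sum>i\<in>UNIV. \<Sum>j\<in>UNIV. ?w i j * ?u j * ?Y i)
      + (\<Sum>i\<in>UNIV. \<Sum>j\<in>UNIV. ?w i j * ?u i * ?Y j) + (\<Sum>i\<in>UNIV. \<Sum>j\<in>UNIV. ?w i j * (?Y i * ?Y j))"
    by (simp only: sum.distrib[symmetric]) (intro sum.cong refl, simp only: distrib_left distrib_right mult_ac add_ac)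
  also have "(\<Sum>i\<in>UNIV. \<Sum>j\<in>UNIV. ?w i j * ?u i * ?Y j) = (\<Sum>i\<in>UNIV. \<Sum>j\<in>UNIV. ?w i j * ?u j * ?Y i)"
    by (subst sum.swap) (simp add: sym_mats_entry[OF sym])
  also have "(\<Sum>i\<in>UNIV. \<Sum>j\<in>UNIV. ?w i j * ?u j * ?Y i) = (\<Sum>i\<in>UNIV. Const ((W *v u) $ i) * ?Y i)"
    unfolding W_u by (simp only: sum_distrib_right)
  also have "(\<Sum>i\<in>UNIV. \<Sum>j\<in>UNIV. ?u i * (?w i j * ?u j)) = Const (u \<bullet> (W *v u))"
    unfolding inner_vec_def by (simp only: inner_real_def Const_sum Const_mult W_u sum_distrib_left)
  finally show ?thesis
    by (simp add: Const_mult sum_distrib_left[symmetric] mult.assoc)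
qed

end

locale certified_family = certificate W q as bs + moment_family F L
  for W :: "real^'n^'n" and q as bs and F :: "'w filter" and L :: "'w \<Rightarrow> 'n mpoly \<Rightarrow> real" +
  assumes L_psi: "\<forall>\<^sub>F w in F. L w (psi W) = 0"
    and finite_zeros: "finite zeros"
begin

section \<open>Null polynomials obtained from the certificate\<close>

lemma L_sum_list: "L w (\<Sum>x\<leftarrow>xs. f x) = (\<Sum>x\<leftarrow>xs. L w (f x))"
  by (induction xs) (simp_all add: L_add)

text \<open>Applied to the certificate, the functional gives nonnegative terms with sum 0. Each is
  0, and Cauchy-Schwarz turns this into nullity, for the weighted squares only after multiplication
  by the variable.\<close>

lemma null_squares:
  shows "a \<in> set as \<Longrightarrow> null a" and "b \<in> set (bs i) \<Longrightarrow> null (Var i * b)"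
proof -
  have A: "\<forall>\<^sub>F w in F. \<forall>a\<in>set as. 0 \<le> L w (a ^ 2)"
    by (intro eventually_ball_finite ballI square_nonneg) simp
  have B: "\<forall>\<^sub>F w in F. \<forall>i\<in>UNIV. \<forall>b\<in>set (bs i). 0 \<le> L w (Var i * b ^ 2)"
    by (intro eventually_ball_finite ballI Var_square_nonneg) simp_all
  have *: "\<forall>\<^sub>F w in F. (\<forall>a\<in>set as. L w (a ^ 2) \<le> 0) \<and> (\<forall>i. \<forall>b\<in>set (bs i). L w (Var i * b ^ 2) \<le> 0)"
    using A B L_psi L_hyper[of q]
  proof eventually_elim
    case (elim w)
    let ?a = "\<Sum>a\<leftarrow>as. L w (a ^ 2)" and ?b = "\<lambda>i. \<Sum>b\<leftarrow>bs i. L w (Var i * b ^ 2)"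
    have a: "0 \<le> ?a" and b: "0 \<le> ?b i" for i
      using elim by (auto intro!: sum_list_nonneg)
    have "?a + (\<Sum>i\<in>UNIV. ?b i) = 0"
      using elim(3,4)
      by (simp add: psi_eq L_add L_sum L_sum_list sum_list_const_mult[symmetric])
    then have "?a = 0" and "?b i = 0" for i
      using a b sum_nonneg[of UNIV ?b] by (auto simp: add_nonneg_eq_0_iff sum_nonneg_eq_0_iff)
    then show ?case
      using elim member_le_sum_list_nonneg[of as "\<lambda>a. L w (a ^ 2)"]
        member_le_sum_list_nonneg[of "bs _" "\<lambda>b. L w (Var _ * b ^ 2)"]
      by (metis UNIV_I)
  qed
  show "null a" if "a \<in> set as"
    using * by (intro null_of_square, rule eventually_mono) (use that in blast)
  show "null (Var i * b)" if "b \<in> set (bs i)"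
    using * by (intro null_of_Var_square, rule eventually_mono) (use that in blast)
qed

text \<open>\<open>L_psi\<close> alone speaks of L(p); the certificate places p in the ideal and so
  covers all L(p g).\<close>

lemma null_psi: "null (psi W)"
proof -
  have "null (a ^ 2)" if "a \<in> set as" for a
    unfolding power2_eq_square using null_squares(1)[OF that] by (rule null_mult_right)
  moreover have "null (Var i * b ^ 2)" if "b \<in> set (bs i)" for i b
    unfolding power2_eq_square mult.assoc[symmetric] using null_squares(2)[OF that] by (rule null_mult_right)
  ultimately show ?thesis
    unfolding psi_eq sum_list_const_mult[symmetric]
    by (intro null_add null_sum null_sum_list null_mult_right[OF null_hyper]) auto
qed

text \<open>A factor e makes null the coordinates i with nonzero (W u)_i. For every f the functional
  that takes g to L((e f)^2 g) then meets the hypotheses of \<open>barycenter_eq\<close>, so its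
  first moments about u vanish; polarization in f removes the square.\<close>

lemma localizer:
  assumes u: "u \<in> zeros"
  shows "\<exists>e. peval e u \<noteq> 0 \<and> (\<forall>j. null (e * (Var j - Const (u $ j))))"
proof -
  define T where "T = {i. (W *v u) $ i \<noteq> 0}"
  have "\<exists>b\<in>set (bs i). peval b u \<noteq> 0" if "i \<in> T" for i
  proof (rule ccontr)
    assume "\<not> ?thesis"
    then have "(\<Sum>b\<leftarrow>bs i. peval b u ^ 2) = (\<Sum>b\<leftarrow>bs i. 0)"
      by (intro arg_cong[of _ _ sum_list] map_cong) auto
    then show False
      using that gradient[OF u, of i] by (auto simp: T_def split: if_splits)
  qed
  then obtain \<beta> where \<beta>: "\<And>i. i \<in> T \<Longrightarrow> \<beta> i \<in> set (bs i) \<and> peval (\<beta> i) u \<noteq> 0"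
    by metis
  \<comment> \<open>Each \<open>Var i * \<beta> i\<close> is null, so the product handles all of T
    at once, without vanishing at u.\<close>
  define e where "e = (\<Prod>i\<in>T. \<beta> i)"
  have e_u: "peval e u \<noteq> 0"
    using \<beta> by (simp add: e_def)
  have e_T: "null (Var i * e)" if "i \<in> T" for i
  proof -
    have "Var i * e = Var i * \<beta> i * (\<Prod>k\<in>T - {i}. \<beta> k)"
      using that by (simp add: e_def prod.remove[of T i] mult.assoc)
    then show ?thesis
      using null_squares(2) \<beta>[OF that] null_mult_right by metis
  qed
  have u_T: "u $ i = 0" if "i \<in> T" for i
    using that gradient[OF u, of i] by (auto simp: T_def split: if_splits)
  obtain ds where ds: "\<And>v. (\<Sum>i\<in>UNIV. v $ i) = 0 \<Longrightarrow> (\<And>i. (W *v u) $ i \<noteq> 0 \<Longrightarrow> v $ i = 0) \<Longrightarrow>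
      v \<bullet> (W *v v) = (\<Sum>d\<leftarrow>ds. (d \<bullet> v) ^ 2)"
    using tangent_form[OF u] by blast
  let ?Y = "\<lambda>i. Var i - Const (u $ i) :: 'n mpoly"
  have sum_Y: "(\<Sum>i\<in>UNIV. ?Y i) = - hyper_poly"
    using u by (simp add: zeros_def std_simplex_def sum_subtractf hyper_poly_def flip: Const_sum)
  have first_moment: "\<forall>\<^sub>F w in F. L w ((e * f) ^ 2 * ?Y j) = 0" for f j
  proof -
    define E where "E = e * f"
    have E_T: "null (E * ?Y i)" if "i \<in> T" for i
    proof -
      have "E * ?Y i = Var i * e * f"
        by (simp add: E_def u_T[OF that] mult_ac)
      then show ?thesis
        using null_mult_right[OF e_T[OF that]] by simp
    qed
    let ?lin = "\<lambda>d :: real^'n. \<Sum>i\<in>UNIV. Const (d $ i) * ?Y i"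
    \<comment> \<open>Finitely many eventual facts are collected first, so that Jensen's argument
      can run at a single w.\<close>
    have ev_T: "\<forall>\<^sub>F w in F. \<forall>i\<in>T. L w (E * ?Y i * E) = 0 \<and> (\<forall>j\<in>UNIV. L w (E * ?Y i * (E * ?Y j)) = 0)"
      by (intro eventually_ball_finite ballI eventually_conj nullD[OF E_T]) simp_all
    have ev_sum: "\<forall>\<^sub>F w in F. L w (hyper_poly * (E ^ 2)) = 0 \<and> (\<forall>j\<in>UNIV. L w (hyper_poly * (E ^ 2 * ?Y j)) = 0)"
      by (intro eventually_ball_finite ballI eventually_conj L_hyper) simp_all
    have ev_pos: "\<forall>\<^sub>F w in F. \<forall>i\<in>UNIV. 0 \<le> L w (Var i * E ^ 2)"
      by (intro eventually_ball_finite ballI Var_square_nonneg) simp_all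
    have ev_ds: "\<forall>\<^sub>F w in F. \<forall>d\<in>set ds. \<forall>t. 0 \<le> L w ((E * ?lin d + Const t * E) ^ 2)"
      by (intro eventually_ball_finite ballI L_square) simp_all
    have ev_0: "\<forall>\<^sub>F w in F. \<forall>j\<in>UNIV. \<forall>t. 0 \<le> L w ((E + Const t * (E * ?Y j)) ^ 2)"
      by (intro eventually_ball_finite ballI L_square) simp_all
    show ?thesis
      unfolding E_def[symmetric]
      using ev_T ev_sum ev_pos ev_ds ev_0 nullD[OF null_psi, of "E ^ 2"]
    proof eventually_elim
      case (elim w)
      define m0 where "m0 = L w (E ^ 2)"
      define m :: "real^'n" where "m = (\<chi> i. L w (E ^ 2 * ?Y i))"
      define M where "M i j = L w (E ^ 2 * (?Y i * ?Y j))" for i j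
      have lin2: "(\<Sum>i\<in>UNIV. \<Sum>j\<in>UNIV. d $ i * d $ j * M i j) = L w ((E * ?lin d) ^ 2)" for d :: "real^'n"
      proof -
        have "(E * ?lin d) ^ 2 = (\<Sum>i\<in>UNIV. \<Sum>j\<in>UNIV. Const (d $ i * d $ j) * (E ^ 2 * (?Y i * ?Y j)))"
          by (simp only: power2_eq_square sum_distrib_left sum_distrib_right Const_mult mult_ac)
        then show ?thesis
          by (simp only: M_def L_sum L_Const_mult)
      qed
      have lin1: "d \<bullet> m = L w (E * ?lin d * E)" for d :: "real^'n"
      proof -
        have "E * ?lin d * E = (\<Sum>i\<in>UNIV. Const (d $ i) * (E ^ 2 * ?Y i))"
          by (simp only: power2_eq_square sum_distrib_left sum_distrib_right mult_ac)
        then show ?thesis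
          by (simp only: m_def L_sum L_Const_mult inner_vec_def inner_real_def vec_lambda_beta)
      qed
      have "m = 0"
      proof (rule barycenter_eq[OF finite_zeros u ds, where M = M and r = m0])
        \<comment> \<open>The index is arbitrary: at t = 0 only the square of E is left.\<close>
        show "0 \<le> m0"
          using elim(5)[rule_format, of undefined 0] by (simp add: m0_def)
        show "m = 0" if "m0 = 0"
        proof -
          have "L w (E * (E * ?Y j)) = 0" for j
            using elim(5) that by (intro cauchy_schwarz) (auto simp: m0_def)
          then show ?thesis
            by (simp add: m_def vec_eq_iff power2_eq_square mult.assoc)
        qed
        show "0 \<le> m0 * u $ i + m $ i" for i
        proof -
          have "Var i * E ^ 2 = Const (u $ i) * E ^ 2 + E ^ 2 * ?Y i"
            by (simp add: algebra_simps)
          then have "L w (Var i * E ^ 2) = m0 * u $ i + m $ i"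
            by (simp only: L_add L_Const_mult m0_def m_def vec_lambda_beta mult.commute)
          then show ?thesis using elim(3)[rule_format, of i] by simp
        qed
        have sum: "(\<Sum>i\<in>UNIV. L w (g * ?Y i)) = - L w (hyper_poly * g)" for g
          by (simp only: L_sum[symmetric] sum_distrib_left[symmetric] sum_Y mult_minus_right L_uminus mult.commute)
        show "(\<Sum>i\<in>UNIV. m $ i) = 0"
          using sum[of "E ^ 2"] elim(2) by (simp only: m_def vec_lambda_beta)
        have "(\<Sum>i\<in>UNIV. M i j) = (\<Sum>i\<in>UNIV. L w (E ^ 2 * ?Y j * ?Y i))" for j
          by (simp only: M_def mult_ac)
        then show "(\<Sum>i\<in>UNIV. M i j) = 0" for j
          using sum[of "E ^ 2 * ?Y j"] elim(2) by (simp only:) simp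
        show "M i j = M j i" for i j
          by (simp only: M_def mult.commute)
        show "m $ i = 0" if "(W *v u) $ i \<noteq> 0" for i
          using elim(1) that by (simp add: T_def m_def power2_eq_square mult_ac)
        show "M i j = 0" if "(W *v u) $ i \<noteq> 0" for i j
          using elim(1) that by (simp add: T_def M_def power2_eq_square mult_ac)
        show "(\<Sum>i\<in>UNIV. \<Sum>j\<in>UNIV. W $ i $ j * M i j) + (\<Sum>i\<in>UNIV. 2 * (W *v u) $ i * m $ i) = 0"
        proof -
          have u0: "u \<bullet> (W *v u) = 0"
            using u by (simp add: zeros_def)
          have "psi W * E ^ 2 = (\<Sum>i\<in>UNIV. Const (2 * (W *v u) $ i) * (E ^ 2 * ?Y i))
              + (\<Sum>i\<in>UNIV. \<Sum>j\<in>UNIV. Const (W $ i $ j) * (E ^ 2 * (?Y i * ?Y j)))"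
            unfolding psi_taylor[of u] u0
            by (simp only: Const_0 add_0 distrib_left distrib_right sum_distrib_left sum_distrib_right mult_ac)
          then have "L w (psi W * E ^ 2) = (\<Sum>i\<in>UNIV. 2 * (W *v u) $ i * m $ i) + (\<Sum>i\<in>UNIV. \<Sum>j\<in>UNIV. W $ i $ j * M i j)"
            by (simp only: L_add L_sum L_Const_mult m_def M_def vec_lambda_beta)
          then show ?thesis using elim(6) by simp
        qed
        fix d assume d: "d \<in> set ds"
        show "0 \<le> (\<Sum>i\<in>UNIV. \<Sum>j\<in>UNIV. d $ i * d $ j * M i j)"
          unfolding lin2 using elim(4)[rule_format, OF d, of 0] by simp
        show "d \<bullet> m = 0" if "(\<Sum>i\<in>UNIV. \<Sum>j\<in>UNIV. d $ i * d $ j * M i j) \<le> 0"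
          unfolding lin1 using elim(4) d that unfolding lin2 by (intro cauchy_schwarz) auto
      qed
      then show ?case
        by (simp add: m_def vec_eq_iff)
    qed
  qed
  have "null (e ^ 2 * ?Y j)" for j
    unfolding null_def
  proof
    fix g
    show "\<forall>\<^sub>F w in F. L w (e ^ 2 * ?Y j * g) = 0"
      using first_moment[of "g + 1" j] first_moment[of "g - 1" j]
    proof eventually_elim
      case (elim w)
      \<comment> \<open>Polarization: 4 g = (g + 1)^2 - (g - 1)^2.\<close>
      have "4 * (e ^ 2 * ?Y j * g) = (e * (g + 1)) ^ 2 * ?Y j - (e * (g - 1)) ^ 2 * ?Y j"
        by (simp add: power2_eq_square algebra_simps)
      then have "4 * L w (e ^ 2 * ?Y j * g) = L w ((e * (g + 1)) ^ 2 * ?Y j) - L w ((e * (g - 1)) ^ 2 * ?Y j)"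
        by (simp only: L_numeral_mult[symmetric] L_diff[symmetric])
      then show ?case using elim by simp
    qed
  qed
  then show ?thesis
    using e_u by (intro exI[of _ "e ^ 2"]) simp
qed

text \<open>A Nullstellensatz for the null ideal. The localizers make P positive at the zeros and
  psi W makes it positive elsewhere on the simplex, so nullity of P h can be divided by P.\<close>

theorem null_of_vanishing:
  assumes h: "\<And>u. u \<in> zeros \<Longrightarrow> peval h u = 0"
  shows "null h"
proof -
  obtain e where e: "\<And>u. u \<in> zeros \<Longrightarrow> peval (e u) u \<noteq> 0 \<and> (\<forall>j. null (e u * (Var j - Const (u $ j))))"
    using localizer by metis
  define P where "P = psi W + (\<Sum>u\<in>zeros. e u ^ 2)"
  have "0 < peval P x" if x: "x \<in> std_simplex" for x
  proof (cases "x \<in> zeros")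
    case True
    have "0 < peval (e x) x ^ 2"
      using e[OF True] by simp
    also have "\<dots> \<le> (\<Sum>u\<in>zeros. peval (e u) x ^ 2)"
      using True finite_zeros by (intro member_le_sum) auto
    finally show ?thesis
      using nonneg_on_simplex[OF x] by (simp add: P_def)
  next
    case False
    then have "0 < peval (psi W) x"
      using nonneg_on_simplex[OF x] x by (auto simp: zeros_def)
    then show ?thesis
      by (simp add: P_def add_pos_nonneg sum_nonneg)
  qed
  from positivstellensatz[OF this] obtain \<epsilon> where \<epsilon>: "\<epsilon> > 0"
    and bound: "\<forall>\<^sub>F w in F. \<epsilon> * L w (h ^ 2) \<le> L w (P * h ^ 2)"
    by blast
  have e_h: "null (e u * h)" if "u \<in> zeros" for u
  proof -
    obtain g where g: "h = Const (peval h u) + (\<Sum>j\<in>UNIV. (Var j - Const (u $ j)) * g j)"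
      by (rule mpoly_taylor1)
    have "e u * h = (\<Sum>j\<in>UNIV. e u * (Var j - Const (u $ j)) * g j)"
      using g h[OF that] by (simp add: sum_distrib_left mult.assoc)
    then show ?thesis
      using e[OF that] by (auto intro: null_sum null_mult_right)
  qed
  have "null (psi W * h + (\<Sum>u\<in>zeros. e u * (e u * h)))"
    by (intro null_add[OF null_mult_right[OF null_psi]] null_sum null_mult_left[OF e_h])
  moreover have "psi W * h + (\<Sum>u\<in>zeros. e u * (e u * h)) = P * h"
    by (simp add: P_def distrib_right sum_distrib_right power2_eq_square mult.assoc)
  ultimately have "null (P * h)" by simp
  from nullD[OF this, of h] bound have "\<forall>\<^sub>F w in F. L w (h ^ 2) \<le> 0"
  proof eventually_elim
    case (elim w)
    then have "\<epsilon> * L w (h ^ 2) \<le> 0"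
      by (simp add: power2_eq_square mult.assoc)
    then show ?case
      using \<epsilon> by (simp add: mult_le_0_iff)
  qed
  then show ?thesis by (rule null_of_square)
qed

end

section \<open>Moment cones\<close>

lemma riesz_loc_square:
  assumes "f \<in> polys_le t"
  shows "riesz \<xi> (g * f ^ 2) = (\<Sum>\<alpha>\<in>exps_le t. \<Sum>\<beta>\<in>exps_le t.
    Poly_Mapping.lookup f \<alpha> * loc_matrix \<xi> g \<alpha> \<beta> * Poly_Mapping.lookup f \<beta>)"
proof -
  let ?c = "Poly_Mapping.lookup f"
  have f: "f = (\<Sum>\<alpha>\<in>exps_le t. Const (?c \<alpha>) * monomial \<alpha>)"
    using assms by (intro mpoly_eq_sum) (auto simp: polys_le_def)
  have "g * f ^ 2 = (\<Sum>\<alpha>\<in>exps_le t. \<Sum>\<beta>\<in>exps_le t. Const (?c \<alpha>) * (Const (?c \<beta>) * (g * monomial \<alpha> * monomial \<beta>)))"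
    by (subst f, simp only: power2_eq_square sum_product sum_distrib_left mult_ac)
  then show ?thesis
    by (simp only: riesz_sum riesz_Const_mult loc_matrix_def) (simp only: mult_ac)
qed

lemma psd_on_loc_matrix:
  assumes "psd_on (exps_le t) (loc_matrix \<xi> g)" "f \<in> polys_le t"
  shows "0 \<le> riesz \<xi> (g * f ^ 2)"
  using assms(1) by (simp add: riesz_loc_square[OF assms(2)] psd_on_def)

lemma moment_cone_square: "\<xi> \<in> moment_cone k \<Longrightarrow> f \<in> polys_le k \<Longrightarrow> 0 \<le> riesz \<xi> (f ^ 2)"
  using psd_on_loc_matrix[of k \<xi> 1 f] by (simp add: moment_cone_def moment_psd_def)

lemma moment_cone_Var_square: "\<xi> \<in> moment_cone k \<Longrightarrow> f \<in> polys_le (k - 1) \<Longrightarrow> 0 \<le> riesz \<xi> (Var i * f ^ 2)"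
  using psd_on_loc_matrix[of "k - 1" \<xi> "Var i" f] by (simp add: moment_cone_def)

lemma moment_cone_ball_square: "\<xi> \<in> moment_cone k \<Longrightarrow> f \<in> polys_le (k - 1) \<Longrightarrow> 0 \<le> riesz \<xi> (ball_poly * f ^ 2)"
  using psd_on_loc_matrix[of "k - 1" \<xi> ball_poly f] by (simp add: moment_cone_def)

lemma moment_cone_hyper:
  assumes "\<xi> \<in> moment_cone k" "f \<in> polys_le (2 * k - 1)"
  shows "riesz \<xi> (hyper_poly * f) = 0"
proof -
  have f: "f = (\<Sum>\<alpha>\<in>exps_le (2 * k - 1). Const (Poly_Mapping.lookup f \<alpha>) * monomial \<alpha>)"
    using assms(2) by (intro mpoly_eq_sum) (auto simp: polys_le_def)
  have "hyper_poly * f = (\<Sum>\<alpha>\<in>exps_le (2 * k - 1). Const (Poly_Mapping.lookup f \<alpha>) * (hyper_poly * monomial \<alpha>))"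
    by (subst f) (simp add: sum_distrib_left mult_ac)
  then show ?thesis
    using assms(1) by (simp add: riesz_sum riesz_Const_mult moment_cone_def)
qed

text \<open>Duality of the truncated cones: the degree bounds in the certificate match those of the
  conditions on \<xi>.\<close>

lemma moment_cone_IQ_trunc:
  assumes \<xi>: "\<xi> \<in> moment_cone k" and p: "p \<in> IQ_trunc k"
  shows "0 \<le> riesz \<xi> p"
proof -
  obtain q s0 s s1 where p: "p = hyper_poly * q + s0 + (\<Sum>i\<in>UNIV. Var i * s i) + ball_poly * s1"
    and q: "q \<in> polys_le (2 * k - 1)" and s: "s0 \<in> sos k" "\<And>i. s i \<in> sos (k - 1)" "s1 \<in> sos (k - 1)"
    using p unfolding IQ_trunc_def by blast
  have sos: "0 \<le> riesz \<xi> (g * f)"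
    if "\<And>h. h \<in> polys_le t \<Longrightarrow> 0 \<le> riesz \<xi> (g * h ^ 2)" "f \<in> sos t" for g f t
  proof -
    obtain qs where f: "f = (\<Sum>q\<leftarrow>qs. q ^ 2)" and "set qs \<subseteq> polys_le t"
      using \<open>f \<in> sos t\<close> by (auto simp: sos_def)
    from this(2) show ?thesis
      unfolding f by (induction qs) (simp_all add: distrib_left riesz_add that(1))
  qed
  have "0 \<le> riesz \<xi> s0"
    using sos[of k 1 s0] moment_cone_square[OF \<xi>] s by simp
  moreover have "0 \<le> riesz \<xi> (\<Sum>i\<in>UNIV. Var i * s i)"
    unfolding riesz_sum by (intro sum_nonneg sos[OF moment_cone_Var_square[OF \<xi>] s(2)])
  moreover have "0 \<le> riesz \<xi> (ball_poly * s1)"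
    by (rule sos[OF moment_cone_ball_square[OF \<xi>] s(3)])
  ultimately show ?thesis
    using moment_cone_hyper[OF \<xi> q] by (simp add: p riesz_add)
qed

lemma IQ_trunc_nonneg:
  assumes p: "p \<in> IQ_trunc k" and x: "x \<in> std_simplex"
  shows "0 \<le> peval p x"
proof -
  obtain q s0 s s1 where p: "p = hyper_poly * q + s0 + (\<Sum>i\<in>UNIV. Var i * s i) + ball_poly * s1"
    and s: "s0 \<in> sos k" "\<And>i. s i \<in> sos (k - 1)" "s1 \<in> sos (k - 1)"
    using p unfolding IQ_trunc_def by blast
  have "0 \<le> peval f x" if "f \<in> sos t" for f t
    using that by (auto simp: sos_def o_def intro!: sum_list_nonneg)
  with s x show ?thesis
    by (auto simp: p std_simplex_def intro!: add_nonneg_nonneg sum_nonneg mult_nonneg_nonneg)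
qed

lemma IQ_trunc_mono:
  assumes "p \<in> IQ_trunc k" "k \<le> k'"
  shows "p \<in> IQ_trunc k'"
proof -
  have sos_mono: "sos t \<subseteq> sos t'" if "t \<le> t'" for t t'
    using polys_le_mono[OF _ that] by (fastforce simp: sos_def)
  have "sos k \<subseteq> sos k'" "sos (k - 1) \<subseteq> sos (k' - 1)"
    by (rule sos_mono, use assms(2) in simp)+
  moreover have "polys_le (2 * k - 1) \<subseteq> polys_le (2 * k' - 1)"
    using assms(2) by (auto intro: polys_le_mono)
  ultimately show ?thesis
    using assms(1) unfolding IQ_trunc_def by blast
qed

lemma riesz_psi:
  assumes "X \<in> sym_mats" "phi X = restrict \<xi> exps_hom2"
  shows "riesz \<xi> (psi W) = W \<bullet> X"
proof -
  have \<xi>: "\<xi> (axis i 1 + axis j 1) = X $ i $ j" for i j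
    using phi_axis[OF assms(1), of i j] assms(2) axis_add_axis_hom2[of i j] by simp
  have "riesz \<xi> (Const (W $ i $ j) * Var i * Var j) = W $ i $ j * X $ i $ j" for i j
    by (simp only: mult.assoc riesz_Const_mult Var_def monomial_add[symmetric] riesz_monomial \<xi>)
  then show ?thesis
    by (simp add: psi_def riesz_sum inner_vec_def)
qed

text \<open>Moments of the measure with mass l_i at x_i. The restriction makes the family
  extensional, as \<open>moment_cone\<close> requires.\<close>

definition atomic_moments :: "nat \<Rightarrow> nat \<Rightarrow> (nat \<Rightarrow> real) \<Rightarrow> (nat \<Rightarrow> real^'n) \<Rightarrow> nat^'n \<Rightarrow> real" where
  "atomic_moments k N l x = (\<lambda>\<alpha>\<in>exps_le (2 * k). \<Sum>i<N. l i * peval (monomial \<alpha>) (x i))"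

lemma riesz_atomic_moments:
  assumes "f \<in> polys_le (2 * k)"
  shows "riesz (atomic_moments k N l x) f = (\<Sum>i<N. l i * peval f (x i))"
proof -
  have f: "f = (\<Sum>\<alpha>\<in>exps_le (2 * k). Const (Poly_Mapping.lookup f \<alpha>) * monomial \<alpha>)"
    using assms by (intro mpoly_eq_sum) (auto simp: polys_le_def)
  have "riesz (atomic_moments k N l x) f
      = (\<Sum>\<alpha>\<in>exps_le (2 * k). Poly_Mapping.lookup f \<alpha> * (\<Sum>i<N. l i * peval (monomial \<alpha>) (x i)))"
    using assms by (subst riesz_eq[of "exps_le (2 * k)"]) (auto simp: polys_le_def atomic_moments_def)
  also have "\<dots> = (\<Sum>i<N. l i * (\<Sum>\<alpha>\<in>exps_le (2 * k). Poly_Mapping.lookup f \<alpha> * peval (monomial \<alpha>) (x i)))"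
    unfolding sum_distrib_left by (subst sum.swap) (simp only: mult_ac)
  also have "\<dots> = (\<Sum>i<N. l i * peval f (x i))"
    using arg_cong[OF f, of "\<lambda>p. peval p (x i)" for i] by (simp only: peval_sum peval_mult peval_Const)
  finally show ?thesis .
qed

text \<open>The matrix is a combination of the rank one matrices of the atoms with weights l_i
  g(x_i). The degree condition keeps its entries within the range where the moments are
  defined.\<close>

lemma psd_on_atomic_moments:
  assumes g: "g \<in> polys_le e" and e: "e + 2 * t \<le> 2 * k"
    and pos: "\<And>i. i < N \<Longrightarrow> 0 \<le> l i * peval g (x i)"
  shows "psd_on (exps_le t) (loc_matrix (atomic_moments k N l x) g)"
proof -
  have M: "loc_matrix (atomic_moments k N l x) g \<alpha> \<beta>
      = (\<Sum>i<N. l i * peval g (x i) * (peval (monomial \<alpha>) (x i) * peval (monomial \<beta>) (x i)))"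
    if "\<alpha> \<in> exps_le t" "\<beta> \<in> exps_le t" for \<alpha> \<beta>
  proof -
    have "g * monomial \<alpha> * monomial \<beta> \<in> polys_le (e + t + t)"
      using that g by (intro polys_le_mult polys_le_monomial) (auto simp: exps_le_def)
    then have "g * monomial \<alpha> * monomial \<beta> \<in> polys_le (2 * k)"
      by (rule polys_le_mono) (use e in simp)
    then show ?thesis
      by (simp add: loc_matrix_def riesz_atomic_moments mult_ac)
  qed
  have "0 \<le> (\<Sum>\<alpha>\<in>exps_le t. \<Sum>\<beta>\<in>exps_le t. v \<alpha> * loc_matrix (atomic_moments k N l x) g \<alpha> \<beta> * v \<beta>)" for v
  proof -
    have "(\<Sum>\<alpha>\<in>exps_le t. \<Sum>\<beta>\<in>exps_le t. v \<alpha> * loc_matrix (atomic_moments k N l x) g \<alpha> \<beta> * v \<beta>)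
        = (\<Sum>\<alpha>\<in>exps_le t. \<Sum>\<beta>\<in>exps_le t. \<Sum>i<N. l i * peval g (x i)
            * ((v \<alpha> * peval (monomial \<alpha>) (x i)) * (v \<beta> * peval (monomial \<beta>) (x i))))"
      by (intro sum.cong refl) (simp add: M sum_distrib_left sum_distrib_right mult_ac)
    also have "\<dots> = (\<Sum>i<N. l i * peval g (x i) * (\<Sum>\<alpha>\<in>exps_le t. v \<alpha> * peval (monomial \<alpha>) (x i)) ^ 2)"
    proof -
      have "(\<Sum>\<alpha>\<in>exps_le t. f \<alpha>) ^ 2 = (\<Sum>\<alpha>\<in>exps_le t. \<Sum>\<beta>\<in>exps_le t. f \<alpha> * f \<beta>)" for f :: "nat^'a \<Rightarrow> real"
        by (simp only: power2_eq_square sum_product)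
      then show ?thesis
        by (simp only: sum_distrib_left sum.swap[of _ "{..<N}"])
    qed
    also have "\<dots> \<ge> 0"
      using pos by (intro sum_nonneg mult_nonneg_nonneg[OF pos]) auto
    finally show ?thesis .
  qed
  moreover have "loc_matrix (atomic_moments k N l x) g \<alpha> \<beta> = loc_matrix (atomic_moments k N l x) g \<beta> \<alpha>" for \<alpha> \<beta>
    by (simp add: loc_matrix_def mult_ac)
  ultimately show ?thesis
    unfolding psd_on_def by blast
qed

text \<open>The atoms and weights of a completely positive decomposition give the moments that make
  the exact matrix feasible for the relaxation.\<close>

lemma completely_positive_moments:
  fixes X :: "real^'n^'n"
  assumes "completely_positive X" "X \<in> sym_mats" "1 \<le> k"
  obtains \<xi> where "\<xi> \<in> moment_cone k" "phi X = restrict \<xi> exps_hom2"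
proof -
  obtain N :: nat and l x where lx: "\<And>i. i < N \<Longrightarrow> 0 < l i \<and> x i \<in> std_simplex"
    and X: "X = (\<Sum>i<N. l i *\<^sub>R outer (x i))"
    using assms(1) unfolding completely_positive_def by blast
  have l0: "0 \<le> l i" if "i < N" for i
    using lx[OF that] by simp
  let ?\<xi> = "atomic_moments k N l x"
  have "psd_on (exps_le k) (loc_matrix ?\<xi> 1)"
    by (intro psd_on_atomic_moments[where e = 0]) (auto intro: l0)
  moreover have "psd_on (exps_le (k - 1)) (loc_matrix ?\<xi> ball_poly)"
    using lx \<open>1 \<le> k\<close>
    by (intro psd_on_atomic_moments[OF polys_le_ball]) (auto simp: std_simplex_def intro!: mult_nonneg_nonneg l0)
  moreover have "psd_on (exps_le (k - 1)) (loc_matrix ?\<xi> (Var i))" for i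
    using lx \<open>1 \<le> k\<close>
    by (intro psd_on_atomic_moments[OF polys_le_Var]) (auto simp: std_simplex_def intro!: mult_nonneg_nonneg l0)
  moreover have "riesz ?\<xi> (hyper_poly * monomial \<alpha>) = 0" if "\<alpha> \<in> exps_le (2 * k - 1)" for \<alpha>
  proof -
    have "hyper_poly * monomial \<alpha> \<in> polys_le (1 + (2 * k - 1))"
      using that by (intro polys_le_mult polys_le_hyper polys_le_monomial) (auto simp: exps_le_def)
    then have "hyper_poly * monomial \<alpha> \<in> polys_le (2 * k)"
      by (rule polys_le_mono) (use \<open>1 \<le> k\<close> in simp)
    then show ?thesis
      using lx by (simp add: riesz_atomic_moments std_simplex_def)
  qed
  ultimately have "?\<xi> \<in> moment_cone k"
    by (simp add: moment_cone_def moment_psd_def atomic_moments_def)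
  moreover have "phi X = restrict ?\<xi> exps_hom2"
  proof
    fix \<alpha> :: "nat^'n"
    show "phi X \<alpha> = restrict ?\<xi> exps_hom2 \<alpha>"
    proof (cases "\<alpha> \<in> exps_hom2")
      case True
      have "\<exists>i j. \<alpha> = axis i 1 + axis j 1"
      proof -
        obtain \<beta> i where \<beta>: "\<alpha> = \<beta> + axis i 1" "mdeg \<beta> = 1"
          using True by (auto simp: exps_hom2_def intro: mdeg_SucE[of \<alpha> 1])
        moreover obtain \<gamma> j where "\<beta> = \<gamma> + axis j 1" "mdeg \<gamma> = 0"
          using \<beta>(2) by (auto intro: mdeg_SucE[of \<beta> 0])
        ultimately show ?thesis
          by (auto simp: add.commute)
      qed
      then obtain i j where \<alpha>: "\<alpha> = axis i 1 + axis j 1" by blast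
      have "\<alpha> \<in> exps_le (2 * k)"
        using True \<open>1 \<le> k\<close> by (simp add: exps_hom2_def exps_le_def)
      then have "?\<xi> \<alpha> = (\<Sum>m<N. l m * (x m $ i * x m $ j))"
        by (simp add: atomic_moments_def \<alpha> monomial_add del: One_nat_def flip: Var_def)
      also have "\<dots> = X $ i $ j"
        by (simp add: X outer_def)
      finally show ?thesis
        using True phi_axis[OF assms(2), of i j] by (simp add: \<alpha>)
    qed (simp add: phi_def)
  qed
  ultimately show thesis by (rule that)
qed

section \<open>Flat truncation\<close>

lemma sum_fun_apply: "(\<Sum>i\<in>S. f i) x = (\<Sum>i\<in>S. f i x :: 'b::comm_monoid_add)"
  by (induction S rule: infinite_finite_induct) simp_all

lemma (in vector_space_pair) dim_image_inj_on_span: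
  assumes f: "Vector_Spaces.linear s1 s2 f" and inj: "inj_on f (vs1.span S)"
  shows "vs2.dim (f ` S) = vs1.dim S"
proof -
  obtain B where B: "B \<subseteq> S" "vs1.independent B" "S \<subseteq> vs1.span B" "card B = vs1.dim S"
    by (rule vs1.basis_exists)
  have inj_B: "inj_on f (vs1.span B)"
    using inj vs1.span_mono[OF B(1)] by (rule inj_on_subset)
  show ?thesis
  proof (rule vs2.dim_unique)
    show "f ` B \<subseteq> f ` S"
      using B(1) by blast
    show "f ` S \<subseteq> vs2.span (f ` B)"
      using B(3) linear_span_image[OF f, of B] by blast
    show "vs2.independent (f ` B)"
      by (rule linear_independent_injective_image[OF f B(2) inj_B])
    show "card (f ` B) = vs1.dim S"
      using card_image[OF inj_on_subset[OF inj_B vs1.span_superset]] B(4) by simp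
  qed
qed

lemma moment_rank_eqI:
  fixes \<xi> :: "nat^'n \<Rightarrow> real"
  assumes r: "\<And>\<alpha>. \<alpha> \<in> exps_le t \<Longrightarrow> r \<alpha> \<in> polys_le (t - 1)"
    and reduce: "\<And>\<alpha> \<beta>. \<alpha> \<in> exps_le t \<Longrightarrow> \<beta> \<in> exps_le t \<Longrightarrow> riesz \<xi> ((monomial \<alpha> - r \<alpha>) * monomial \<beta>) = 0"
  shows "moment_rank t \<xi> = moment_rank (t - 1) \<xi>"
proof -
  interpret V: vector_space "\<lambda>(r::real) (f::nat^'n \<Rightarrow> real) a. r * f a"
    by (rule vector_space_fun)
  interpret VV: vector_space_pair "\<lambda>(r::real) (f::nat^'n \<Rightarrow> real) a. r * f a" "\<lambda>(r::real) (f::nat^'n \<Rightarrow> real) a. r * f a"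
    by unfold_locales
  define S where "S = (exps_le t :: (nat^'n) set)"
  define S0 where "S0 = (exps_le (t - 1) :: (nat^'n) set)"
  have S0: "S0 \<subseteq> S" and fin: "finite S0"
    using exps_le_mono[of "t - 1" t] by (simp_all add: S_def S0_def)
  define M where "M = loc_matrix \<xi> 1"
  define c where "c \<alpha> \<gamma> = Poly_Mapping.lookup (r \<alpha>) \<gamma>" for \<alpha> \<gamma>
  define col where "col \<beta> = (\<lambda>\<alpha>. if \<alpha> \<in> S then M \<alpha> \<beta> else 0)" for \<beta>
  define R where "R f = (\<lambda>\<alpha>. if \<alpha> \<in> S0 then f \<alpha> else 0)" for f :: "nat^'n \<Rightarrow> real"
  have M_sym: "M \<alpha> \<beta> = M \<beta> \<alpha>" for \<alpha> \<beta>
    by (simp add: M_def loc_matrix_def mult.commute)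
  have rows: "M \<alpha> \<beta> = (\<Sum>\<gamma>\<in>S0. c \<alpha> \<gamma> * M \<gamma> \<beta>)" if "\<alpha> \<in> S" "\<beta> \<in> S" for \<alpha> \<beta>
  proof -
    have "r \<alpha> = (\<Sum>\<gamma>\<in>S0. Const (c \<alpha> \<gamma>) * monomial \<gamma>)"
      unfolding c_def using r that fin by (intro mpoly_eq_sum) (auto simp: polys_le_def S0_def S_def)
    then have "r \<alpha> * monomial \<beta> = (\<Sum>\<gamma>\<in>S0. Const (c \<alpha> \<gamma>) * (monomial \<gamma> * monomial \<beta>))"
      by (simp add: sum_distrib_right mult.assoc)
    moreover have "riesz \<xi> (monomial \<alpha> * monomial \<beta>) = riesz \<xi> (r \<alpha> * monomial \<beta>)"
      using reduce[of \<alpha> \<beta>] that by (simp add: S_def left_diff_distrib riesz_diff)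
    ultimately show ?thesis
      by (simp add: M_def loc_matrix_def riesz_sum riesz_Const_mult)
  qed
  have col_reduce: "col \<beta> = (\<Sum>\<gamma>\<in>S0. (\<lambda>a. c \<beta> \<gamma> * col \<gamma> a))" if "\<beta> \<in> S" for \<beta>
  proof
    fix \<alpha>
    show "col \<beta> \<alpha> = (\<Sum>\<gamma>\<in>S0. (\<lambda>a. c \<beta> \<gamma> * col \<gamma> a)) \<alpha>"
      using rows[OF that, of \<alpha>] by (auto simp: sum_fun_apply col_def M_sym[of \<alpha>])
  qed
  have "col ` S \<subseteq> V.span (col ` S0)"
  proof
    fix f assume "f \<in> col ` S"
    then obtain \<beta> where "\<beta> \<in> S" and f: "f = col \<beta>" by blast
    show "f \<in> V.span (col ` S0)"
      unfolding f by (subst col_reduce[OF \<open>\<beta> \<in> S\<close>]) (intro V.span_sum V.span_scale V.span_base imageI)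
  qed
  then have "V.dim (col ` S) = V.dim (col ` S0)"
    using S0 by (intro V.span_eq_dim) (simp add: V.span_eq image_mono subset_trans[OF _ V.span_superset])
  also have "\<dots> = V.dim (R ` col ` S0)"
  proof (rule VV.dim_image_inj_on_span[symmetric])
    show "Vector_Spaces.linear (\<lambda>r f a. r * f a) (\<lambda>r f a. r * f a) R"
      by unfold_locales (auto simp: R_def fun_eq_iff algebra_simps)
    \<comment> \<open>The row relations extend to the span of the columns and recover a vector from
      its entries in \<open>S0\<close>; this is the injectivity of \<open>R\<close>.\<close>
    have rel: "\<forall>\<alpha>. f \<alpha> = (if \<alpha> \<in> S then \<Sum>\<gamma>\<in>S0. c \<alpha> \<gamma> * f \<gamma> else 0)" if "f \<in> V.span (col ` S0)" for f
      using that
    proof (induction rule: V.span_induct_alt)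
      case base
      then show ?case by simp
    next
      case (step a g f)
      then obtain \<beta> where \<beta>: "\<beta> \<in> S0" "g = col \<beta>" by blast
      have g: "g \<alpha> = (if \<alpha> \<in> S then \<Sum>\<gamma>\<in>S0. c \<alpha> \<gamma> * g \<gamma> else 0)" for \<alpha>
      proof -
        have "(\<Sum>\<gamma>\<in>S0. c \<alpha> \<gamma> * g \<gamma>) = (\<Sum>\<gamma>\<in>S0. c \<alpha> \<gamma> * M \<gamma> \<beta>)"
          using \<beta> S0 by (intro sum.cong) (auto simp: col_def)
        then show ?thesis
          using rows[of \<alpha> \<beta>] \<beta> S0 by (auto simp: col_def)
      qed
      show ?case
      proof
        fix \<alpha>
        show "((\<lambda>\<alpha>. a * g \<alpha>) + f) \<alpha> = (if \<alpha> \<in> S then \<Sum>\<gamma>\<in>S0. c \<alpha> \<gamma> * ((\<lambda>\<alpha>. a * g \<alpha>) + f) \<gamma> else 0)"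
          using g[of \<alpha>] step.IH[rule_format, of \<alpha>]
          by (simp add: distrib_left sum.distrib sum_distrib_left mult.left_commute split: if_splits)
      qed
    qed
    show "inj_on R (V.span (col ` S0))"
    proof (rule inj_onI, rule ext)
      fix f g \<alpha>
      assume f: "f \<in> V.span (col ` S0)" and g: "g \<in> V.span (col ` S0)" and "R f = R g"
      then have "f \<gamma> = g \<gamma>" if "\<gamma> \<in> S0" for \<gamma>
        using that by (auto simp: R_def fun_eq_iff split: if_splits)
      then show "f \<alpha> = g \<alpha>"
        by (subst rel[OF f, rule_format], subst rel[OF g, rule_format]) simp
    qed
  qed
  also have "R ` col ` S0 = (\<lambda>\<beta> \<alpha>. if \<alpha> \<in> S0 then M \<alpha> \<beta> else 0) ` S0"
    using S0 unfolding image_image R_def col_def by (intro image_cong) (auto simp: fun_eq_iff)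
  finally show ?thesis
    unfolding moment_rank_def rank_on_def S_def S0_def M_def col_def[abs_def] .
qed

text \<open>A Lagrange polynomial: the normalized product of the squared distances to the other
  points.\<close>

lemma interpolation:
  fixes Z :: "(real^'n) set"
  assumes "finite Z" "u \<in> Z"
  shows "\<exists>f. peval f u = 1 \<and> (\<forall>v\<in>Z - {u}. peval f v = 0)"
proof -
  define g :: "'n mpoly" where "g = (\<Prod>v\<in>Z - {u}. \<Sum>j\<in>UNIV. (Var j - Const (v $ j)) ^ 2)"
  have val: "peval g x = (\<Prod>v\<in>Z - {u}. (x - v) \<bullet> (x - v))" for x
    by (simp add: g_def inner_vec_def power2_eq_square)
  have "peval g u \<noteq> 0"
    unfolding val using assms by simp
  moreover have "peval g v = 0" if "v \<in> Z - {u}" for v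
    unfolding val using that assms(1) by (auto intro!: prod_zero)
  ultimately show ?thesis
    by (intro exI[of _ "Const (1 / peval g u) * g"]) auto
qed

theorem flat_truncation:
  fixes W :: "real^'n^'n"
  assumes W: "W \<in> sym_mats" "psi W \<in> IQ"
    and fin: "finite {x. simplex_critical (psi W) x \<and> peval (psi W) x = 0}"
  shows "\<exists>K. \<forall>k\<ge>K. \<forall>\<xi>\<in>moment_cone k. riesz \<xi> (psi W) = 0 \<longrightarrow>
    (\<exists>t. 1 \<le> t \<and> t \<le> k \<and> moment_rank t \<xi> = moment_rank (t - 1) \<xi>)"
proof -
  obtain q as bs where "psi W = hyper_poly * q + (\<Sum>a\<leftarrow>as. a ^ 2) + (\<Sum>i\<in>UNIV. Var i * (\<Sum>b\<leftarrow>bs i. b ^ 2))"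
    using IQ_decomposition[OF W(2)] .
  then interpret certificate W q as bs
    using W(1) by unfold_locales
  have finite_zeros: "finite zeros"
    by (rule finite_subset[OF _ fin]) (use critical in \<open>auto simp: zeros_def\<close>)
  \<comment> \<open>k tends to infinity while \<xi> ranges over all admissible sequences of order k;
    an eventual statement is therefore uniform in \<xi>.\<close>
  define F :: "(nat \<times> (nat^'n \<Rightarrow> real)) filter" where
    "F = inf (filtercomap fst sequentially) (principal {(k, \<xi>). \<xi> \<in> moment_cone k \<and> riesz \<xi> (psi W) = 0})"
  have ev_F: "eventually P F \<longleftrightarrow> (\<exists>K. \<forall>k\<ge>K. \<forall>\<xi>\<in>moment_cone k. riesz \<xi> (psi W) = 0 \<longrightarrow> P (k, \<xi>))" for P
    unfolding F_def eventually_inf_principal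
    by (auto simp: eventually_filtercomap_at_top_linorder)
  interpret certified_family W q as bs F "\<lambda>w. riesz (snd w)"
  proof
    fix f g :: "'n mpoly" and i :: 'n
    obtain d e where d: "f \<in> polys_le d" and e: "g \<in> polys_le e"
      using polys_le_exists by metis
    have fg: "f + Const t * g \<in> polys_le k" if "max d e \<le> k" for t k
      using that polys_le_mono[OF d] polys_le_mono[OF e] by (intro polys_le_add polys_le_Const_mult) auto
    show "\<forall>\<^sub>F w in F. \<forall>t. 0 \<le> riesz (snd w) ((f + Const t * g) ^ 2)"
      unfolding ev_F by (intro exI[of _ "max d e"]) (auto intro!: moment_cone_square fg)
    show "\<forall>\<^sub>F w in F. \<forall>t. 0 \<le> riesz (snd w) (Var i * (f + Const t * g) ^ 2)"
      \<comment> \<open>\<open>Suc\<close> because the localizing matrices have order k - 1.\<close>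
      unfolding ev_F by (intro exI[of _ "Suc (max d e)"]) (auto intro!: moment_cone_Var_square fg)
    show "\<forall>\<^sub>F w in F. riesz (snd w) (hyper_poly * f) = 0"
      unfolding ev_F by (intro exI[of _ "Suc d"]) (auto intro!: moment_cone_hyper polys_le_mono[OF d])
    show "\<forall>\<^sub>F w in F. riesz (snd w) (psi W) = 0"
      unfolding ev_F by auto
  qed (simp_all add: riesz_add riesz_Const_mult finite_zeros)
  obtain l where l: "\<And>u. u \<in> zeros \<Longrightarrow> peval (l u) u = 1 \<and> (\<forall>v\<in>zeros - {u}. peval (l u) v = 0)"
    using interpolation[OF finite_zeros] by metis
  have "\<exists>\<delta>. \<forall>u. l u \<in> polys_le (\<delta> u)"
    by (intro choice allI polys_le_exists)
  then obtain \<delta> where \<delta>: "\<And>u. l u \<in> polys_le (\<delta> u)"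
    by blast
  \<comment> \<open>A degree bound for the interpolants of all monomials at once; the rank is shown
    to be stable from order d to d + 1.\<close>
  define d where "d = (\<Sum>u\<in>zeros. \<delta> u)"
  define r where "r \<alpha> = (\<Sum>u\<in>zeros. Const (peval (monomial \<alpha>) u) * l u)" for \<alpha>
  have r_deg: "r \<alpha> \<in> polys_le d" for \<alpha>
    unfolding r_def d_def using finite_zeros
    by (intro polys_le_sum polys_le_Const_mult) (auto intro: polys_le_mono[OF \<delta>] member_le_sum)
  have r_eval: "peval (r \<alpha>) v = peval (monomial \<alpha>) v" if "v \<in> zeros" for \<alpha> v
  proof -
    have "peval (r \<alpha>) v = (\<Sum>u\<in>zeros. if u = v then peval (monomial \<alpha>) u else 0)"
      unfolding r_def using l that by (auto intro!: sum.cong)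
    then show ?thesis
      using finite_zeros that by simp
  qed
  have "null (monomial \<alpha> - r \<alpha>)" for \<alpha>
    by (rule null_of_vanishing) (simp add: r_eval)
  then have "\<forall>\<^sub>F w in F. \<forall>\<alpha>\<in>exps_le (Suc d). \<forall>\<beta>\<in>exps_le (Suc d). riesz (snd w) ((monomial \<alpha> - r \<alpha>) * monomial \<beta>) = 0"
    by (intro eventually_ball_finite ballI nullD) simp_all
  then obtain K where K: "\<And>k \<xi> \<alpha> \<beta>. K \<le> k \<Longrightarrow> \<xi> \<in> moment_cone k \<Longrightarrow> riesz \<xi> (psi W) = 0 \<Longrightarrow>
      \<alpha> \<in> exps_le (Suc d) \<Longrightarrow> \<beta> \<in> exps_le (Suc d) \<Longrightarrow> riesz \<xi> ((monomial \<alpha> - r \<alpha>) * monomial \<beta>) = 0"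
    unfolding ev_F snd_conv by blast
  show ?thesis
  proof (rule exI[of _ "max K (Suc d)"], intro allI ballI impI)
    fix k \<xi>
    assume "max K (Suc d) \<le> k" "\<xi> \<in> moment_cone k" "riesz \<xi> (psi W) = 0"
    then have "moment_rank (Suc d) \<xi> = moment_rank (Suc d - 1) \<xi>"
      using K r_deg by (intro moment_rank_eqI[of "Suc d" r]) auto
    then show "\<exists>t. 1 \<le> t \<and> t \<le> k \<and> moment_rank t \<xi> = moment_rank (t - 1) \<xi>"
      using \<open>max K (Suc d) \<le> k\<close> by (intro exI[of _ "Suc d"]) auto
  qed
qed

section \<open>Duality\<close>

text \<open>The terms with Q and its adjoint cancel. The identity is purely linear, so it can pair a
  relaxed solution with an exact one.\<close>

lemma duality_gap:
  fixes Q :: "real^'n^'n \<Rightarrow> real^'m^'m"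
  assumes Q: "linear_on_sym Q" and X: "X \<in> sym_mats"
    and "\<forall>i. A i \<bullet> X = b $ i" "Q X - (\<Sum>j\<in>UNIV. z $ j *\<^sub>R B j) = Z"
    and "\<forall>j. B j \<bullet> Y = c $ j" "(\<Sum>i\<in>UNIV. w $ i *\<^sub>R A i) - sym_adjoint Q Y = W"
  shows "b \<bullet> w - c \<bullet> z = W \<bullet> X + Z \<bullet> Y"
proof -
  have "W \<bullet> X = b \<bullet> w - Q X \<bullet> Y"
    using assms sym_adjoint(2)[OF Q X, of Y]
    by (auto simp: inner_diff_left inner_diff_right inner_sum_left inner_sum_right inner_vec_def[of b] inner_commute[of _ X] mult.commute)
  moreover have "Z \<bullet> Y = Q X \<bullet> Y - c \<bullet> z"
    using assms by (auto simp: inner_diff_left inner_sum_left inner_vec_def[of c] mult.commute)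
  ultimately show ?thesis by simp
qed

lemma inner_completely_positive_nonneg:
  assumes "completely_positive Y" "\<And>x. x \<in> std_simplex \<Longrightarrow> 0 \<le> peval (psi Z) x"
  shows "0 \<le> Z \<bullet> Y"
proof -
  have "Z \<bullet> outer x = peval (psi Z) x" for x
    by (simp add: inner_vec_def outer_def matrix_vector_mult_def sum_distrib_left mult_ac)
  then show ?thesis
    using assms by (auto simp: completely_positive_def inner_sum_right less_imp_le intro!: sum_nonneg mult_nonneg_nonneg)
qed

lemma SUP_arg_max:
  assumes "is_arg_max f P x"
  shows "(SUP y\<in>Collect P. ereal (f y)) = ereal (f x)"
  using assms by (intro antisym SUP_least SUP_upper) (auto simp: is_arg_max_def not_less)

lemma INF_arg_min:
  assumes "is_arg_min f P x"
  shows "(INF y\<in>Collect P. ereal (f y)) = ereal (f x)"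
  using assms by (intro antisym INF_greatest INF_lower) (auto simp: is_arg_min_def not_less)

theorem theorem5:
  fixes A :: "'i::finite \<Rightarrow> real^'n^'n" and b :: "real^'i"
    and B :: "'j::finite \<Rightarrow> real^'m^'m" and c :: "real^'j"
    and Q :: "real^'n^'n \<Rightarrow> real^'m^'m"
    and Xs :: "real^'n^'n" and zs :: "real^'j" and Zs :: "real^'m^'m"
    and Ys :: "real^'m^'m" and ws :: "real^'i" and Ws :: "real^'n^'n"
  assumes "\<forall>i. A i \<in> sym_mats"
    and "\<forall>j. B j \<in> sym_mats"
    and "linear_on_sym Q"
    and "pmax_value A b B c Q = pmin_value A b B c Q"
    and "is_arg_max (\<lambda>(X, z, Z). c \<bullet> z) (pmax_feasible A b B Q) (Xs, zs, Zs)"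
    and "is_arg_min (\<lambda>(Y, w, W). b \<bullet> w) (pmin_feasible A B c Q) (Ys, ws, Ws)"
    and "psi Zs \<in> IQ"
    and "psi Ws \<in> IQ"
    and "finite {x. simplex_critical (psi Ws) x \<and> peval (psi Ws) x = 0}"
    and "finite {y. simplex_critical (psi Zs) y \<and> peval (psi Zs) y = 0}"
  shows "\<exists>K1 K2. \<forall>k1 k2. 1 \<le> k1 \<longrightarrow> 1 \<le> k2 \<longrightarrow> K1 \<le> k1 \<longrightarrow> K2 \<le> k2 \<longrightarrow>
    (\<forall>X z Z \<xi>. is_arg_max (\<lambda>(X, z, Z, \<xi>). c \<bullet> z) (rmax_feasible k1 k2 A b B Q) (X, z, Z, \<xi>) \<longrightarrow>
       (\<exists>t. 1 \<le> t \<and> t \<le> k1 \<and> moment_rank t \<xi> = moment_rank (t - 1) \<xi>)) \<and>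
    (\<forall>Y w W \<nu>. is_arg_min (\<lambda>(Y, w, W, \<nu>). b \<bullet> w) (rmin_feasible k1 k2 A B c Q) (Y, w, W, \<nu>) \<longrightarrow>
       (\<exists>s. 1 \<le> s \<and> s \<le> k2 \<and> moment_rank s \<nu> = moment_rank (s - 1) \<nu>))"
proof -
  note Q = assms(3)
  have s_max: "Xs \<in> sym_mats" "Zs \<in> sym_mats" "\<forall>i. A i \<bullet> Xs = b $ i"
      "Q Xs - (\<Sum>j\<in>UNIV. zs $ j *\<^sub>R B j) = Zs" "completely_positive Xs"
    using assms(5) by (auto simp: is_arg_max_def pmax_feasible_def)
  have s_min: "Ys \<in> sym_mats" "Ws \<in> sym_mats" "\<forall>j. B j \<bullet> Ys = c $ j"
      "(\<Sum>i\<in>UNIV. ws $ i *\<^sub>R A i) - sym_adjoint Q Ys = Ws" "completely_positive Ys"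
    using assms(6) by (auto simp: is_arg_min_def pmin_feasible_def)
  \<comment> \<open>Both optima are attained, which turns equality of the extended values into
    equality of the objectives.\<close>
  have gap: "c \<bullet> zs = b \<bullet> ws"
    using assms(4) SUP_arg_max[OF assms(5)] INF_arg_min[OF assms(6)]
    by (simp add: pmax_value_def pmin_value_def case_prod_unfold)
  obtain kZ kW where kZ: "psi Zs \<in> IQ_trunc kZ" and kW: "psi Ws \<in> IQ_trunc kW"
    using assms(7,8) by (auto simp: IQ_def)
  obtain KW where KW: "\<And>k \<xi>. KW \<le> k \<Longrightarrow> \<xi> \<in> moment_cone k \<Longrightarrow> riesz \<xi> (psi Ws) = 0 \<Longrightarrow>
      \<exists>t. 1 \<le> t \<and> t \<le> k \<and> moment_rank t \<xi> = moment_rank (t - 1) \<xi>"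
    using flat_truncation[OF s_min(2) assms(8,9)] by blast
  obtain KZ where KZ: "\<And>k \<nu>. KZ \<le> k \<Longrightarrow> \<nu> \<in> moment_cone k \<Longrightarrow> riesz \<nu> (psi Zs) = 0 \<Longrightarrow>
      \<exists>s. 1 \<le> s \<and> s \<le> k \<and> moment_rank s \<nu> = moment_rank (s - 1) \<nu>"
    using flat_truncation[OF s_max(2) assms(7,10)] by blast
  have max_flat: "\<exists>t. 1 \<le> t \<and> t \<le> k1 \<and> moment_rank t \<xi> = moment_rank (t - 1) \<xi>"
    if k: "1 \<le> k1" "max kW KW \<le> k1" "kZ \<le> k2"
      and opt: "is_arg_max (\<lambda>(X, z, Z, \<xi>). c \<bullet> z) (rmax_feasible k1 k2 A b B Q) (X, z, Z, \<xi>)"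
    for k1 k2 X z Z \<xi>
  proof -
    have f: "X \<in> sym_mats" "\<forall>i. A i \<bullet> X = b $ i" "Q X - (\<Sum>j\<in>UNIV. z $ j *\<^sub>R B j) = Z"
        "phi X = restrict \<xi> exps_hom2" "\<xi> \<in> moment_cone k1" "psi Z \<in> IQ_trunc k2"
      using opt by (auto simp: is_arg_max_def rmax_feasible_def)
    \<comment> \<open>With these moments the exact maximizer competes in the relaxation.\<close>
    obtain \<xi>s where "\<xi>s \<in> moment_cone k1" "phi Xs = restrict \<xi>s exps_hom2"
      using completely_positive_moments[OF s_max(5,1) k(1)] .
    then have "rmax_feasible k1 k2 A b B Q (Xs, zs, Zs, \<xi>s)"
      using s_max IQ_trunc_mono[OF kZ k(3)] by (simp add: rmax_feasible_def)
    then have "c \<bullet> zs \<le> c \<bullet> z"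
      using opt by (auto simp: is_arg_max_def not_less)
    \<comment> \<open>The left side is at most 0 and both terms on the right are nonnegative; the
      first is the Riesz functional at \<open>psi Ws\<close>, which therefore vanishes.\<close>
    moreover have "b \<bullet> ws - c \<bullet> z = Ws \<bullet> X + Z \<bullet> Ys"
      by (rule duality_gap[OF Q f(1-3) s_min(3,4)])
    moreover have "0 \<le> Z \<bullet> Ys"
      using inner_completely_positive_nonneg[OF s_min(5)] IQ_trunc_nonneg[OF f(6)] by blast
    moreover have "0 \<le> riesz \<xi> (psi Ws)"
      using moment_cone_IQ_trunc[OF f(5) IQ_trunc_mono[OF kW]] k(2) by simp
    ultimately have "riesz \<xi> (psi Ws) = 0"
      using gap by (simp add: riesz_psi[OF f(1,4)])
    then show ?thesis
      using KW[OF _ f(5)] k(2) by simp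
  qed
  have min_flat: "\<exists>s. 1 \<le> s \<and> s \<le> k2 \<and> moment_rank s \<nu> = moment_rank (s - 1) \<nu>"
    if k: "1 \<le> k2" "max kZ KZ \<le> k2" "kW \<le> k1"
      and opt: "is_arg_min (\<lambda>(Y, w, W, \<nu>). b \<bullet> w) (rmin_feasible k1 k2 A B c Q) (Y, w, W, \<nu>)"
    for k1 k2 Y w W \<nu>
  proof -
    have f: "Y \<in> sym_mats" "\<forall>j. B j \<bullet> Y = c $ j" "(\<Sum>i\<in>UNIV. w $ i *\<^sub>R A i) - sym_adjoint Q Y = W"
        "phi Y = restrict \<nu> exps_hom2" "\<nu> \<in> moment_cone k2" "psi W \<in> IQ_trunc k1"
      using opt by (auto simp: is_arg_min_def rmin_feasible_def)
    obtain \<nu>s where "\<nu>s \<in> moment_cone k2" "phi Ys = restrict \<nu>s exps_hom2"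
      using completely_positive_moments[OF s_min(5,1) k(1)] .
    then have "rmin_feasible k1 k2 A B c Q (Ys, ws, Ws, \<nu>s)"
      using s_min IQ_trunc_mono[OF kW k(3)] by (simp add: rmin_feasible_def)
    then have "b \<bullet> w \<le> b \<bullet> ws"
      using opt by (auto simp: is_arg_min_def not_less)
    moreover have "b \<bullet> w - c \<bullet> zs = W \<bullet> Xs + Zs \<bullet> Y"
      by (rule duality_gap[OF Q s_max(1,3,4) f(2,3)])
    moreover have "0 \<le> W \<bullet> Xs"
      using inner_completely_positive_nonneg[OF s_max(5)] IQ_trunc_nonneg[OF f(6)] by blast
    moreover have "0 \<le> riesz \<nu> (psi Zs)"
      using moment_cone_IQ_trunc[OF f(5) IQ_trunc_mono[OF kZ]] k(2) by simp
    ultimately have "riesz \<nu> (psi Zs) = 0"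
      using gap by (simp add: riesz_psi[OF f(1,4)])
    then show ?thesis
      using KZ[OF _ f(5)] k(2) by simp
  qed
  show ?thesis
  \<comment> \<open>\<open>kW\<close> and \<open>kZ\<close> make the exact solutions feasible and
    the Riesz values nonnegative; \<open>KW\<close> and \<open>KZ\<close> give flatness.\<close>
  proof (rule exI[of _ "max kW KW"], rule exI[of _ "max kZ KZ"], intro allI impI conjI, goal_cases)
    case 1
    then show ?case by (intro max_flat) auto
  next
    case 2
    then show ?case by (intro min_flat) auto
  qed
qed

end
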